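(* Let $\Bbbk$ be a field, $S=\Bbbk[x,y,z]$ and let $[S/I]\in \mathrm{Hilb}^d(\mathbb{A}^3)$ be a point for which $\dim_{\Bbbk} T(I) \not\equiv d \bmod 2$. Then $I$ is not in the linkage class of any homogeneous ideal (and therefore not in the linkage class of any monomial ideal). In particular, $I$ is not licci.
   Context: $\mathrm{Hilb}^d(\mathbb{A}^3)$ parametrizes ideals $I\subseteq S$ with $\dim_\Bbbk S/I=d$. $T(I)=\mathrm{Hom}_S(I,S/I)$ is the tangent space to $\mathrm{Hilb}^d(\mathbb{A}^3)$ at $[S/I]$. Homogeneous means homogeneous with respect to the standard grading on $S$. Linkage: for a cofinite ideal $I\subseteq S$ and a regular sequence $\underline\alpha=(\alpha_1,\alpha_2,\alpha_3)$ of length three contained in $I$, the link of $I$ with respect to $\underline\alpha$ is $(\underline\alpha:I)=\{s\in S : sI\subseteq(\underline\alpha)\}$. Two ideals are linked if one is the link of the other with respect to some such regular sequence; they are in the same linkage class if they are joined by a finite chain of links. An ideal is licci if it is in the linkage class of a complete intersection (an ideal generated by a regular sequence of length three). *)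

theory Defs
  imports
    "HOL-Library.Poly_Mapping"
    "HOL-Library.Numeral_Type"
    "HOL-Number_Theory.Cong"
    "HOL-Algebra.QuotRing"
    "Jordan_Normal_Form.VS_Connect"
begin

section \<open>Modules over a ring record\<close>

text \<open>
  The record type for modules extends the one for rings, so a module also has fields for
  multiplication and one. These are irrelevant here, and their values are immaterial.
\<close>

definition ideal_module :: "('a, 'm) ring_scheme \<Rightarrow> 'a set \<Rightarrow> ('a, 'a) module" where
  "ideal_module R I =
     \<lparr>carrier = I, mult = mult R, one = \<one>\<^bsub>R\<^esub>, zero = \<zero>\<^bsub>R\<^esub>, add = add R, smult = mult R\<rparr>"

definition quotient_module :: "('a, 'm) ring_scheme \<Rightarrow> 'a set \<Rightarrow> ('a, 'a set) module" where
  "quotient_module R I =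
     \<lparr>carrier = carrier (R Quot I), mult = mult (R Quot I), one = \<one>\<^bsub>R Quot I\<^esub>,
      zero = \<zero>\<^bsub>R Quot I\<^esub>, add = add (R Quot I),
      smult = (\<lambda>s A. (I +>\<^bsub>R\<^esub> s) \<otimes>\<^bsub>R Quot I\<^esub> A)\<rparr>"

text \<open>
  Homomorphisms are taken to be extensional (\<^term>\<open>undefined\<close> outside of the carrier of the
  domain); without this, functions agreeing on the carrier would be counted as different.
\<close>

definition Hom_module ::
    "('a, 'm) ring_scheme \<Rightarrow> ('a, 'b) module \<Rightarrow> ('a, 'c) module \<Rightarrow> ('a, 'b \<Rightarrow> 'c) module" where
  "Hom_module R M N =
     \<lparr>carrier = LinearCombinations.module_hom R M N \<inter> extensional (carrier M),
      mult = (\<lambda>f g. \<lambda>v\<in>carrier M. \<zero>\<^bsub>N\<^esub>), one = (\<lambda>v\<in>carrier M. \<zero>\<^bsub>N\<^esub>),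
      zero = (\<lambda>v\<in>carrier M. \<zero>\<^bsub>N\<^esub>),
      add = (\<lambda>f g. \<lambda>v\<in>carrier M. f v \<oplus>\<^bsub>N\<^esub> g v),
      smult = (\<lambda>s f. \<lambda>v\<in>carrier M. s \<odot>\<^bsub>N\<^esub> f v)\<rparr>"

definition restrict_scalars :: "('c \<Rightarrow> 'a) \<Rightarrow> ('a, 'b) module \<Rightarrow> ('c, 'b) module" where
  "restrict_scalars h M =
     \<lparr>carrier = carrier M, mult = mult M, one = \<one>\<^bsub>M\<^esub>, zero = \<zero>\<^bsub>M\<^esub>, add = add M,
      smult = (\<lambda>c v. h c \<odot>\<^bsub>M\<^esub> v)\<rparr>"


section \<open>The polynomial ring in three variables\<close>

text \<open>
  Exponent vectors are the elements of \<open>3 \<Rightarrow>\<^sub>0 nat\<close>, where the numeral type \<open>3\<close> has exactly three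
  elements; polynomials are finitely supported functions from exponent vectors to coefficients,
  with the convolution product of \<^theory>\<open>HOL-Library.Poly_Mapping\<close>.
\<close>

type_synonym 'k poly3 = "(3 \<Rightarrow>\<^sub>0 nat) \<Rightarrow>\<^sub>0 'k"

abbreviation S :: "'k::field poly3 ring" where
  "S \<equiv> class_ring"

definition Const :: "'k::field \<Rightarrow> 'k poly3" where
  "Const c = Poly_Mapping.single 0 c"

definition monomial :: "(3 \<Rightarrow>\<^sub>0 nat) \<Rightarrow> 'k::field poly3" where
  "monomial m = Poly_Mapping.single m 1"

definition total_deg :: "(3 \<Rightarrow>\<^sub>0 nat) \<Rightarrow> nat" where
  "total_deg m = (\<Sum>i\<in>UNIV. Poly_Mapping.lookup m i)"

definition hom_component :: "nat \<Rightarrow> 'k::field poly3 \<Rightarrow> 'k poly3" where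
  "hom_component n f =
     (\<Sum>m | m \<in> Poly_Mapping.keys f \<and> total_deg m = n.
        Poly_Mapping.single m (Poly_Mapping.lookup f m))"

definition homogeneous_ideal :: "'k::field poly3 set \<Rightarrow> bool" where
  "homogeneous_ideal I \<longleftrightarrow> ideal I S \<and> (\<forall>f\<in>I. \<forall>n. hom_component n f \<in> I)"

definition monomial_ideal :: "'k::field poly3 set \<Rightarrow> bool" where
  "monomial_ideal I \<longleftrightarrow> (\<exists>M. I = Idl\<^bsub>S\<^esub> (monomial ` M))"


section \<open>Points of the Hilbert scheme and their tangent spaces\<close>

abbreviation dim_over_k :: "('k::field poly3, 'b) module \<Rightarrow> nat" where
  "dim_over_k M \<equiv> vectorspace.dim (class_ring :: 'k ring) (restrict_scalars Const M)"

abbreviation fin_dim_over_k :: "('k::field poly3, 'b) module \<Rightarrow> bool" where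
  "fin_dim_over_k M \<equiv> vectorspace.fin_dim (class_ring :: 'k ring) (restrict_scalars Const M)"

definition cofinite_ideal :: "'k::field poly3 set \<Rightarrow> bool" where
  "cofinite_ideal I \<longleftrightarrow> ideal I S \<and> fin_dim_over_k (quotient_module S I)"

text \<open>
  The \<open>k\<close>-points of the Hilbert scheme. Finite-dimensionality is required separately because
  \<^const>\<open>vectorspace.dim\<close> is unspecified on infinite-dimensional spaces.
\<close>

definition Hilb :: "nat \<Rightarrow> 'k::field poly3 set set" where
  "Hilb d = {I. cofinite_ideal I \<and> dim_over_k (quotient_module S I) = d}"

definition tangent_space ::
    "'k::field poly3 set \<Rightarrow> ('k poly3, 'k poly3 \<Rightarrow> 'k poly3 set) module" where
  "tangent_space I = Hom_module S (ideal_module S I) (quotient_module S I)"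


section \<open>Linkage\<close>

text \<open>
  Besides each entry being a nonzerodivisor modulo its predecessors, the sequence has to generate a
  proper ideal.
\<close>

definition regular_sequence :: "'k::field poly3 list \<Rightarrow> bool" where
  "regular_sequence fs \<longleftrightarrow>
     (\<forall>i<length fs. \<forall>s. fs ! i * s \<in> Idl\<^bsub>S\<^esub> (set (take i fs)) \<longrightarrow> s \<in> Idl\<^bsub>S\<^esub> (set (take i fs))) \<and>
     Idl\<^bsub>S\<^esub> (set fs) \<noteq> UNIV"

definition link :: "'k::field poly3 list \<Rightarrow> 'k poly3 set \<Rightarrow> 'k poly3 set" where
  "link fs I = {s. \<forall>f\<in>I. s * f \<in> Idl\<^bsub>S\<^esub> (set fs)}"

definition is_link_of :: "'k::field poly3 set \<Rightarrow> 'k poly3 set \<Rightarrow> bool" where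
  "is_link_of J I \<longleftrightarrow> cofinite_ideal I \<and>
     (\<exists>fs. length fs = 3 \<and> regular_sequence fs \<and> set fs \<subseteq> I \<and> J = link fs I)"

definition linked :: "'k::field poly3 set \<Rightarrow> 'k poly3 set \<Rightarrow> bool" where
  "linked I J \<longleftrightarrow> is_link_of I J \<or> is_link_of J I"

definition same_linkage_class :: "'k::field poly3 set \<Rightarrow> 'k poly3 set \<Rightarrow> bool" where
  "same_linkage_class = linked\<^sup>*\<^sup>*"

definition complete_intersection :: "'k::field poly3 set \<Rightarrow> bool" where
  "complete_intersection I \<longleftrightarrow>
     (\<exists>fs. length fs = 3 \<and> regular_sequence fs \<and> I = Idl\<^bsub>S\<^esub> (set fs))"

definition licci :: "'k::field poly3 set \<Rightarrow> bool" where
  "licci I \<longleftrightarrow> (\<exists>J. complete_intersection J \<and> same_linkage_class I J)"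

end

(*
  Both d and the dimension of T(I) are encoded by finite linear algebra.

  Homogeneous ideals: let A be the quotient by I. Homomorphisms from I to A together with linear
  endomorphisms of A correspond to elements of A together with triples P of endomorphisms such that
  the operators X_i + t P_i commute modulo t^2, where X_i is the multiplication by the i-th variable.
  The space of these triples is the radical of a symmetric bilinear form on triples of endomorphisms,
  the Hessian of tr (X_0 [X_1, X_2]). If I is homogeneous, then this form pairs the component of degree
  w with that of degree -1 - w. As w = -1 - w has no solution, its rank is even, and hence
  dim T(I) = d modulo 2.

  Linkage: let J be the link of I with respect to a. A first order deformation q of the ideal (a) extends
  to a deformation of I if and only if it extends to one of J, and the deformations of I and of J that
  fix a correspond to each other. This rests on the fact that homomorphisms from ideals to the quotient R
  by (a) are multiplications by elements of R. Counting dimensions,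
  dim T(I) - 3 dim S/I = dim T(J) - 3 dim S/J.

  That R is injective over itself follows from a nondegenerate functional on R. The Koszul complex
  of the operators x_i w - w X_i on the linear maps w from R to S is a resolution of the dual of R, and
  a zigzag along the regular sequence takes a linear section of S -> R to the functional.
*)
theory Submission
  imports Defs "HOL-Library.Function_Algebras"
begin

section \<open>Linear algebra\<close>

text \<open>Put d = dim S/I. The space \<open>Ext\<close> joins two counts: its dimension is dim
  T(I) + d^2 and also dim \<open>Z1\<close> + d. Since \<open>Z1\<close> is the radical of a form on
  a space of dimension 3 d^2, this gives dim T(I) = 2 d^2 + d - rank, so only the parity of the rank
  matters. The rank is even because the matrix is symmetric with two vanishing diagonal blocks, an
  argument valid over every field. In the linkage formula the factor 3 is odd, so links preserve the
  parity of dim T(I) - d. The unit ideal is homogeneous, has both dimensions 0 and is a link of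
  every complete intersection, which settles the licci case. That links are cofinite rests on S/(a)
  being finite-dimensional. This comes from counting monomials: four polynomials in three variables
  are algebraically dependent, and regularity turns such a dependence into a monic equation for each
  variable modulo (a). Quotients are represented throughout by normal forms supported on a set of
  monomials, so that operators become matrices and dimensions become cardinalities.\<close>

locale vspace = vector_space
begin

text \<open>\<open>dim\<close> is the cardinality of a basis, hence 0 for an infinite one;
  \<open>fd\<close> is the side condition excluding this. It is stated for arbitrary sets, so that
  it passes to subsets at once.\<close>

definition fd :: "'b set \<Rightarrow> bool" where
  "fd V \<longleftrightarrow> (\<exists>B. finite B \<and> V \<subseteq> span B)"

lemma fd_subset: "V \<subseteq> W \<Longrightarrow> fd W \<Longrightarrow> fd V"
  unfolding fd_def by blast

lemma fd_independent_finite: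
  assumes "fd V" "B \<subseteq> V" "independent B"
  shows "finite B"
  using assms independent_span_bound unfolding fd_def by (meson order_trans)

lemma fd_basis:
  assumes "subspace V" "fd V"
  obtains B where "finite B" "independent B" "span B = V" "card B = dim V"
proof -
  obtain B where B: "B \<subseteq> V" "independent B" "V \<subseteq> span B" "card B = dim V"
    using basis_exists by blast
  moreover have "span B = V" using B span_minimal[OF B(1) assms(1)] by blast
  ultimately show ?thesis using that fd_independent_finite assms(2) by metis
qed

text \<open>Such an \<open>x\<close> has two expansions with disjoint supports, and both are its
  unique expansion in \<open>C\<close>.\<close>

lemma span_Int_span_eq_0:
  assumes "independent C" "B \<subseteq> C" "x \<in> span B" "x \<in> span (C - B)"
  shows "x = 0"
proof -
  have "representation C x b = 0" for b
  proof (cases "b \<in> B")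
    case True
    have "representation C x = representation (C - B) x"
      by (rule representation_extend) (use assms in auto)
    then show ?thesis using True representation_ne_zero[of "C - B" x b] by auto
  next
    case False
    have "representation C x = representation B x"
      by (rule representation_extend) (use assms in auto)
    then show ?thesis using False representation_ne_zero[of B x b] by auto
  qed
  moreover have "x \<in> span C" using assms span_mono by blast
  ultimately show ?thesis
    using sum_nonzero_representation_eq[OF assms(1), of x] by simp
qed

lemma dim_mono_fd:
  assumes "V \<subseteq> W" "fd W"
  shows "dim V \<le> dim W"
proof -
  obtain B where B: "B \<subseteq> W" "independent B" "W \<subseteq> span B" "card B = dim W"
    using basis_exists by blast
  then have "finite B" using fd_independent_finite assms(2) by blast
  then show ?thesis using dim_le_card[of V B] B assms(1) by auto
qed

lemma subspace_eq_if_dim_eq: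
  assumes "subspace U" "U \<subseteq> V" "fd V" "dim U = dim V"
  shows "U = V"
proof -
  obtain C where C: "C \<subseteq> U" "independent C" "U \<subseteq> span C" "card C = dim U"
    using basis_exists by blast
  have "C \<subseteq> V" using C(1) assms(2) by (rule order_trans)
  then obtain D where D: "C \<subseteq> D" "D \<subseteq> V" "independent D" "V \<subseteq> span D"
    using C(2) by (rule maximal_independent_subset_extend)
  have "card D = dim V" by (rule basis_card_eq_dim[OF D(2,4,3)])
  moreover have "finite D" using fd_independent_finite[OF assms(3) D(2,3)] .
  ultimately have "C = D" using C(4) D(1) assms(4) by (metis card_subset_eq)
  then show ?thesis using span_minimal[OF C(1) assms(1)] assms(2) D(4) by blast
qed

text \<open>The dimensions in question belong to vector spaces with an explicit carrier. An
  injection \<open>F\<close> onto a subspace of a type-based vector space carries over the axioms,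
  finite-dimensionality and the dimension; bases are pulled back along \<open>F\<close>.\<close>

lemma record_vectorspace:
  fixes V :: "('a, 'v, 'm) module_scheme"
  assumes inj: "inj_on F (carrier V)"
    and U: "subspace (F ` carrier V)"
    and zero: "zero V \<in> carrier V" "F (zero V) = 0"
    and add: "\<And>v w. v \<in> carrier V \<Longrightarrow> w \<in> carrier V \<Longrightarrow> add V v w \<in> carrier V"
      "\<And>v w. v \<in> carrier V \<Longrightarrow> w \<in> carrier V \<Longrightarrow> F (add V v w) = F v + F w"
    and smult: "\<And>c v. v \<in> carrier V \<Longrightarrow> module.smult V c v \<in> carrier V"
      "\<And>c v. v \<in> carrier V \<Longrightarrow> F (module.smult V c v) = scale c (F v)"
  shows "vectorspace class_ring V" (is ?vs)
    and "vectorspace.fin_dim class_ring V \<longleftrightarrow> fd (F ` carrier V)"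
    and "fd (F ` carrier V) \<Longrightarrow> vectorspace.dim class_ring V = dim (F ` carrier V)"
proof -
  note I = inj_onD[OF inj]
  \<comment> \<open>The inverse comes from the image: being a subspace it contains
    \<open>- F v\<close>, whose preimage is the inverse of \<open>v\<close>.\<close>
  have neg: "\<exists>w\<in>carrier V. add V v w = zero V" if v: "v \<in> carrier V" for v
  proof -
    have "- F v \<in> F ` carrier V" using subspace_neg[OF U] v by blast
    then obtain w where w: "w \<in> carrier V" "F w = - F v" by auto
    then have "add V v w = zero V"
      by (intro I) (auto simp: add v zero)
    then show ?thesis using w by blast
  qed
  show ?vs
    by (rule vs_criteria)
      (use neg in \<open>auto intro!: class_field I simp: zero add smult algebra_simps scale_left_distrib\<close>)
  then interpret V: vectorspace "class_ring" V .
  have fs: "F (finsum V g A) = (\<Sum>x\<in>A. F (g x))" if "finite A" "g \<in> A \<rightarrow> carrier V" for g and A :: "'v set"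
    using that
  proof (induction A rule: finite_induct)
    case empty
    then show ?case by (simp add: zero)
  next
    case (insert x A)
    have "finsum V g A \<in> carrier V" using insert by (intro V.finsum_closed) auto
    then show ?case using insert by (simp add: add)
  qed
  have lc: "F (V.lincomb a A) = (\<Sum>x\<in>A. scale (a x) (F x))" if "finite A" "A \<subseteq> carrier V" for a A
    unfolding V.lincomb_def using that
    by (subst fs) (auto intro!: sum.cong simp: smult subset_iff)
  have lcc: "V.lincomb a A \<in> carrier V" if "A \<subseteq> carrier V" for a A
    using that by (intro V.lincomb_closed) auto
  have sp: "F ` V.span A = span (F ` A)" if A: "finite A" "A \<subseteq> carrier V" for A
  proof -
    have "inj_on F A" using inj A inj_on_subset by blast
    then have "(\<Sum>x\<in>F ` A. scale (u x) x) = (\<Sum>x\<in>A. scale (u (F x)) (F x))" for u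
      by (simp add: sum.reindex)
    moreover have "F ` V.span A = {\<Sum>x\<in>A. scale (a x) (F x) | a. True}"
      unfolding V.finite_span[OF A] using lc[OF A] by (auto simp: image_iff) (metis lc[OF A])
    moreover have "span (F ` A) = {\<Sum>x\<in>F ` A. scale (u x) x | u. True}"
      using A by (auto simp: span_finite)
    moreover have "\<exists>u. (\<Sum>x\<in>A. scale (a x) (F x)) = (\<Sum>x\<in>A. scale (u (F x)) (F x))" for a
    proof (rule exI[of _ "\<lambda>y. a (inv_into A F y)"], rule sum.cong)
      fix x assume "x \<in> A"
      then show "scale (a x) (F x) = scale (a (inv_into A F (F x))) (F x)"
        using \<open>inj_on F A\<close> by simp
    qed simp
    ultimately show ?thesis by auto
  qed
  have gen: "V.span A = carrier V \<longleftrightarrow> span (F ` A) = F ` carrier V"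
    if A: "finite A" "A \<subseteq> carrier V" for A
  proof -
    have "V.span A \<subseteq> carrier V" using A lcc by (auto simp: V.span_def)
    then show ?thesis
      using sp[OF A] inj_on_image_eq_iff[OF inj, of "V.span A" "carrier V"] by auto
  qed
  have basis: "\<exists>A. finite A \<and> A \<subseteq> carrier V \<and> V.basis A \<and> card A = dim (F ` carrier V)"
    if fd: "fd (F ` carrier V)"
  proof -
    obtain B where B: "finite B" "independent B" "span B = F ` carrier V" "card B = dim (F ` carrier V)"
      using fd_basis[OF U fd] by blast
    then have "B \<subseteq> F ` carrier V" using span_superset by blast
    then obtain A where A: "A \<subseteq> carrier V" "B = F ` A" "inj_on F A" by (metis subset_image_inj)
    have fA: "finite A" using A B(1) finite_imageD by blast
    have "V.lin_indpt A"
    proof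
      assume "V.lin_dep A"
      then obtain a v where a: "V.lincomb a A = zero V" "v \<in> A" "a v \<noteq> 0"
        using V.finite_lin_dep[OF fA] A by auto
      have "(\<Sum>x\<in>F ` A. scale (a (inv_into A F x)) x) = (\<Sum>x\<in>A. scale (a x) (F x))"
        using A by (simp add: sum.reindex)
      also have "\<dots> = 0" using lc[OF fA A(1)] a zero by metis
      finally have "a (inv_into A F (F v)) = 0"
        using B(1,2) A(2) a(2) by (intro independentD[of B B "\<lambda>x. a (inv_into A F x)" "F v"]) auto
      then show False using a A by simp
    qed
    then show ?thesis
      using gen[OF fA A(1)] A B fA V.basis_def by (metis card_image)
  qed
  show "V.fin_dim \<longleftrightarrow> fd (F ` carrier V)"
  proof
    assume "V.fin_dim"
    then obtain A where "finite A" "A \<subseteq> carrier V" "V.span A = carrier V"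
      by (auto simp: V.fin_dim_def)
    then show "fd (F ` carrier V)" using gen unfolding fd_def by (metis finite_imageI order_refl)
  next
    assume "fd (F ` carrier V)"
    then show "V.fin_dim" using basis by (auto simp: V.fin_dim_def V.basis_def)
  qed
  show "V.dim = dim (F ` carrier V)" if fd: "fd (F ` carrier V)"
    using basis[OF fd] V.dim_basis by metis
qed

end

locale vspace_pair = vs1: vspace s1 + vs2: vspace s2
  for s1 :: "'a::field \<Rightarrow> 'b::ab_group_add \<Rightarrow> 'b"
  and s2 :: "'a::field \<Rightarrow> 'c::ab_group_add \<Rightarrow> 'c"
begin

sublocale vector_space_pair s1 s2 ..


lemma dim_image_inj_on:
  assumes f: "Vector_Spaces.linear s1 s2 f" and V: "vs1.subspace V" and inj: "inj_on f V"
  shows "vs2.dim (f ` V) = vs1.dim V"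
proof -
  obtain B where B: "B \<subseteq> V" "vs1.independent B" "V \<subseteq> vs1.span B" "card B = vs1.dim V"
    using vs1.basis_exists by blast
  have sp: "vs1.span B = V" using B vs1.span_minimal[OF B(1) V] by blast
  have "vs2.independent (f ` B)"
    by (rule linear_independent_injective_image[OF f B(2)]) (use sp inj in simp)
  moreover have "vs2.span (f ` B) = f ` V"
    using linear_span_image[OF f, of B] sp by simp
  moreover have "card (f ` B) = card B"
    using inj B by (meson card_image inj_on_subset)
  ultimately show ?thesis using B(4) vs2.dim_span_eq_card_independent by metis
qed

lemma fd_image:
  assumes f: "Vector_Spaces.linear s1 s2 f" and "vs1.fd V"
  shows "vs2.fd (f ` V)"
proof -
  obtain B where "finite B" "V \<subseteq> vs1.span B" using assms vs1.fd_def by blast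
  then have "f ` V \<subseteq> vs2.span (f ` B)" using linear_span_image[OF f, of B] by blast
  then show ?thesis using \<open>finite B\<close> vs2.fd_def by blast
qed

lemma fd_inj_image:
  assumes f: "Vector_Spaces.linear s1 s2 f" and V: "vs1.subspace V" and inj: "inj_on f V" and "vs2.fd (f ` V)"
  shows "vs1.fd V"
proof -
  obtain B where B: "B \<subseteq> V" "vs1.independent B" "V \<subseteq> vs1.span B" "card B = vs1.dim V"
    using vs1.basis_exists by blast
  have sp: "vs1.span B = V" using B vs1.span_minimal[OF B(1) V] by blast
  have "vs2.independent (f ` B)"
    by (rule linear_independent_injective_image[OF f B(2)]) (use sp inj in simp)
  moreover have "f ` B \<subseteq> f ` V" using B by blast
  ultimately have "finite (f ` B)" using vs2.fd_independent_finite assms(4) by blast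
  then have "finite B" using inj B by (meson finite_imageD inj_on_subset)
  then show ?thesis using B vs1.fd_def by blast
qed

lemma subspace_kernel_on:
  assumes f: "Vector_Spaces.linear s1 s2 f" and V: "vs1.subspace V"
  shows "vs1.subspace {v \<in> V. f v = 0}"
  using V linear_0[OF f] linear_add[OF f] linear_scale[OF f]
  by (auto simp: vs1.subspace_def)

lemma rank_nullity:
  assumes f: "Vector_Spaces.linear s1 s2 f" and V: "vs1.subspace V" and fd: "vs1.fd V"
  shows "vs1.dim V = vs2.dim (f ` V) + vs1.dim {v \<in> V. f v = 0}"
proof -
  let ?K = "{v \<in> V. f v = 0}"
  note K = subspace_kernel_on[OF f V]
  have "vs1.fd ?K" by (rule vs1.fd_subset[OF _ fd]) auto
  then obtain B where B: "finite B" "vs1.independent B" "vs1.span B = ?K" "card B = vs1.dim ?K"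
    by (rule vs1.fd_basis[OF K])
  have "B \<subseteq> V" using B vs1.span_superset by blast
  then obtain C where C: "B \<subseteq> C" "C \<subseteq> V" "vs1.independent C" "V \<subseteq> vs1.span C"
    using vs1.maximal_independent_subset_extend B(2) by metis
  have spC: "vs1.span C = V" using C vs1.span_minimal[OF C(2) V] by blast
  have finC: "finite C" using C vs1.fd_independent_finite[OF fd] by blast
  have inj: "inj_on f (vs1.span (C - B))"
    unfolding linear_inj_on_iff_eq_0[OF f vs1.subspace_span]
  proof (intro ballI impI)
    fix x assume x: "x \<in> vs1.span (C - B)" "f x = 0"
    have "x \<in> V" using x(1) spC vs1.span_mono[of "C - B" C] by auto
    then have "x \<in> vs1.span B" using B(3) x(2) by auto
    then show "x = 0" using vs1.span_Int_span_eq_0[OF C(3) C(1)] x by blast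
  qed
  have ind: "vs2.independent (f ` (C - B))"
    by (rule linear_independent_injective_image[OF f _ inj])
      (use C vs1.independent_mono in blast)
  have "f ` V = vs2.span (f ` C)" using linear_span_image[OF f, of C] spC by simp
  also have "\<dots> = vs2.span (f ` (C - B))"
  proof (rule antisym)
    have "f ` C \<subseteq> vs2.span (f ` (C - B))"
    proof
      fix y assume "y \<in> f ` C"
      then obtain x where x: "x \<in> C" "y = f x" by auto
      show "y \<in> vs2.span (f ` (C - B))"
      proof (cases "x \<in> B")
        case True
        then have "f x = 0" using B(3) vs1.span_base[of x B] by auto
        then show ?thesis using x vs2.span_zero by simp
      next
        case False
        then show ?thesis using x by (auto intro: vs2.span_base)
      qed
    qed
    then show "vs2.span (f ` C) \<subseteq> vs2.span (f ` (C - B))"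
      using vs2.span_minimal vs2.subspace_span by metis
    show "vs2.span (f ` (C - B)) \<subseteq> vs2.span (f ` C)"
      by (rule vs2.span_mono) auto
  qed
  finally have "vs2.dim (f ` V) = card (f ` (C - B))"
    using vs2.dim_span_eq_card_independent[OF ind] by simp
  also have "\<dots> = card (C - B)"
    by (rule card_image, rule inj_on_subset[OF inj vs1.span_superset])
  finally have "vs2.dim (f ` V) + vs1.dim ?K = card C"
    using card_mono[OF finC C(1)] B(1,4) C(1) by (simp add: card_Diff_subset)
  moreover have "vs1.dim V = card C"
    using vs1.dim_span_eq_card_independent[OF C(3)] spC by simp
  ultimately show ?thesis by simp
qed

end

section \<open>Coordinate spaces over the field; row rank equals column rank\<close>

interpretation KF: vspace "\<lambda>(c::'k::field) (f :: 'x \<Rightarrow> 'k) x. c * f x"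
  by unfold_locales (auto simp: fun_eq_iff algebra_simps)

interpretation KF2: vspace_pair "\<lambda>(c::'k::field) (f :: 'x \<Rightarrow> 'k) x. c * f x"
  "\<lambda>(c::'k::field) (f :: 'y \<Rightarrow> 'k) x. c * f x" ..

lemma KF_linearI:
  assumes "\<And>g h. f (\<lambda>x. g x + h x) = (\<lambda>y. f g y + f h y)" "\<And>c g. f (\<lambda>x. c * g x) = (\<lambda>y. c * f g y)"
  shows "Vector_Spaces.linear (\<lambda>(c::'k::field) (g :: 'x \<Rightarrow> 'k) x. c * g x) (\<lambda>c (g :: 'y \<Rightarrow> 'k) x. c * g x) f"
  unfolding Vector_Spaces.linear_iff
  by (intro conjI allI KF.vector_space_axioms) (simp_all add: plus_fun_def assms)

text \<open>The coordinate space of \<open>X\<close>, realised among the functions on the whole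
  type. The quotient, its endomorphisms and triples of its elements are counted by identification
  with such spaces.\<close>

definition supp :: "'x set \<Rightarrow> ('x \<Rightarrow> 'k::zero) set" where
  "supp X = {g. \<forall>x. x \<notin> X \<longrightarrow> g x = 0}"

lemma subspace_supp: "KF.subspace (supp X)"
  by (auto simp: KF.subspace_def supp_def)

lemma supp_dim:
  assumes X: "finite X"
  shows "KF.dim (supp X :: ('x \<Rightarrow> 'k::field) set) = card X"
    and "KF.fd (supp X :: ('x \<Rightarrow> 'k::field) set)"
proof -
  let ?d = "\<lambda>x y. if y = x then 1 else (0::'k)"
  have inj: "inj_on ?d X"
    by (rule inj_onI) (metis one_neq_zero)
  have ex: "g = (\<Sum>x\<in>X. (\<lambda>y. g x * ?d x y))" if "g \<in> supp X" for g
  proof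
    fix y
    have "(\<Sum>x\<in>X. (\<lambda>y. g x * ?d x y)) y = (\<Sum>x\<in>X. g x * ?d x y)"
      by (induction X rule: infinite_finite_induct) auto
    also have "\<dots> = (\<Sum>x\<in>X. if x = y then g x else 0)"
      by (rule sum.cong) auto
    also have "\<dots> = g y"
      using that X by (auto simp: supp_def)
    finally show "g y = (\<Sum>x\<in>X. (\<lambda>y. g x * ?d x y)) y" by simp
  qed
  have sp: "supp X \<subseteq> KF.span (?d ` X)"
  proof
    fix g :: "'x \<Rightarrow> 'k" assume "g \<in> supp X"
    then have "g = (\<Sum>x\<in>X. (\<lambda>y. g x * ?d x y))" by (rule ex)
    also have "\<dots> \<in> KF.span (?d ` X)"
      by (intro KF.span_sum KF.span_scale KF.span_base) auto
    finally show "g \<in> KF.span (?d ` X)" .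
  qed
  have ind: "KF.independent (?d ` X)"
  proof (rule KF.independent_if_scalars_zero)
    show "finite (?d ` X)" using X by simp
    fix f v assume s: "(\<Sum>x\<in>?d ` X. (\<lambda>y. f x * x y)) = 0" and "v \<in> ?d ` X"
    then obtain x where x: "x \<in> X" "v = ?d x" by blast
    have "0 = (\<Sum>z\<in>X. (\<lambda>y. f (?d z) * ?d z y)) x"
      using s inj by (simp add: sum.reindex)
    also have "\<dots> = (\<Sum>z\<in>X. f (?d z) * ?d z x)"
      by (induction X rule: infinite_finite_induct) auto
    also have "\<dots> = (\<Sum>z\<in>X. if z = x then f (?d z) else 0)"
      by (rule sum.cong) auto
    also have "\<dots> = f v" using x X by simp
    finally show "f v = 0" by simp
  qed
  have sub: "?d ` X \<subseteq> supp X" by (auto simp: supp_def)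
  show "KF.dim (supp X :: ('x \<Rightarrow> 'k::field) set) = card X"
    by (rule KF.dim_unique[OF sub sp ind]) (simp add: card_image[OF inj])
  show "KF.fd (supp X :: ('x \<Rightarrow> 'k::field) set)"
    unfolding KF.fd_def using sp X by blast
qed

lemma sum_fun_apply: "(\<Sum>i\<in>A. f i) x = (\<Sum>i\<in>A. f i x)"
  by (induction A rule: infinite_finite_induct) auto

text \<open>Let \<open>W\<close> be the image of the map \<open>f\<close> with matrix
  \<open>M\<close>. Vectors orthogonal to a basis of \<open>W\<close> are orthogonal to every row
  \<open>M x\<close>, and they are cut out by dim \<open>W\<close> equations. So the second kernel
  has dimension at least card \<open>Y\<close> - dim \<open>W\<close>, while the first has dimension
  card \<open>X\<close> - dim \<open>W\<close>.\<close>

lemma dim_kernel_transpose_le: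
  fixes M :: "'x \<Rightarrow> 'y \<Rightarrow> 'k::field"
  assumes X: "finite X" and Y: "finite Y"
  shows "KF.dim {g \<in> supp X. \<forall>y\<in>Y. (\<Sum>x\<in>X. M x y * g x) = 0} + card Y \<le>
         KF.dim {h \<in> supp Y. \<forall>x\<in>X. (\<Sum>y\<in>Y. M x y * h y) = 0} + card X"
proof -
  let ?K = "{g \<in> supp X. \<forall>y\<in>Y. (\<Sum>x\<in>X. M x y * g x) = 0}"
  let ?N = "{h \<in> supp Y. \<forall>x\<in>X. (\<Sum>y\<in>Y. M x y * h y) = 0}"
  define f where "f = (\<lambda>g y. if y \<in> Y then \<Sum>x\<in>X. M x y * g x else 0)"
  have f: "Vector_Spaces.linear (\<lambda>(c::'k) g x. c * g x) (\<lambda>(c::'k) g x. c * g x) f"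
    by (rule KF_linearI)
      (auto simp: f_def fun_eq_iff algebra_simps sum.distrib sum_distrib_left)
  let ?W = "f ` supp X"
  have K: "?K = {g \<in> supp X. f g = 0}"
    by (auto simp: f_def fun_eq_iff)
  have rk: "card X = KF.dim ?W + KF.dim ?K"
    using KF2.rank_nullity[OF f subspace_supp supp_dim(2)[OF X]] supp_dim(1)[OF X, where 'k='k] K by simp
  have W: "KF.subspace ?W" using KF2.linear_subspace_image[OF f subspace_supp] .
  obtain B where B: "finite B" "KF.span B = ?W" "card B = KF.dim ?W"
    by (rule KF.fd_basis[OF W KF2.fd_image[OF f supp_dim(2)[OF X]]])
  \<comment> \<open>Pairing with a basis of the image, rather than with all rows, keeps the target
    of \<open>e\<close> at dimension dim \<open>W\<close>.\<close>
  define e where "e = (\<lambda>h w. if w \<in> B then \<Sum>y\<in>Y. w y * h y else (0::'k))"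
  have e: "Vector_Spaces.linear (\<lambda>(c::'k) g x. c * g x) (\<lambda>(c::'k) g x. c * g x) e"
    by (rule KF_linearI)
      (auto simp: e_def fun_eq_iff algebra_simps sum.distrib sum_distrib_left)
  have "KF.dim (e ` supp Y) \<le> KF.dim (supp B :: (_ \<Rightarrow> 'k) set)"
    by (rule KF.dim_mono_fd) (auto simp: e_def supp_def supp_dim[OF B(1), unfolded supp_def])
  then have 1: "KF.dim (e ` supp Y) \<le> KF.dim ?W" using supp_dim(1)[OF B(1), where 'k='k] B by simp
  have "{h \<in> supp Y. e h = 0} \<subseteq> ?N"
  proof safe
    fix h :: "'y \<Rightarrow> 'k" and x assume h: "h \<in> supp Y" "e h = 0" and x: "x \<in> X"
    have B0: "(\<Sum>y\<in>Y. w y * h y) = 0" if "w \<in> B" for w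
      using h(2) that by (auto simp: e_def fun_eq_iff split: if_splits)
    have sub: "KF.subspace {w. (\<Sum>y\<in>Y. w y * h y) = 0}"
    proof -
      have "(\<Sum>y\<in>Y. c * w y * h y) = c * (\<Sum>y\<in>Y. w y * h y)" for c w
        by (simp add: sum_distrib_left mult.assoc)
      then show ?thesis
        by (auto simp: KF.subspace_def algebra_simps sum.distrib)
    qed
    have "KF.span B \<subseteq> {w. (\<Sum>y\<in>Y. w y * h y) = 0}"
      by (rule KF.span_minimal[OF _ sub]) (use B0 in auto)
    then have "?W \<subseteq> {w. (\<Sum>y\<in>Y. w y * h y) = 0}" unfolding B(2) .
    moreover have "f (\<lambda>z. if z = x then 1 else 0) \<in> ?W"
      using x by (auto simp: supp_def)
    ultimately have "(\<Sum>y\<in>Y. f (\<lambda>z. if z = x then 1 else 0) y * h y) = 0"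
      by (drule_tac subsetD) auto
    moreover have "f (\<lambda>z. if z = x then 1 else 0) y = M x y" if "y \<in> Y" for y
    proof -
      have "(\<Sum>z\<in>X. M z y * (if z = x then 1 else 0)) = (\<Sum>z\<in>X. if z = x then M z y else 0)"
        by (rule sum.cong) auto
      then show ?thesis using that x X by (simp add: f_def)
    qed
    ultimately show "(\<Sum>y\<in>Y. M x y * h y) = 0" by (simp cong: sum.cong)
  qed
  then have 2: "KF.dim {h \<in> supp Y. e h = 0} \<le> KF.dim ?N"
    by (rule KF.dim_mono_fd) (rule KF.fd_subset[OF _ supp_dim(2)[OF Y]], auto)
  have "card Y = KF.dim (e ` supp Y) + KF.dim {h \<in> supp Y. e h = 0}"
    using KF2.rank_nullity[OF e subspace_supp supp_dim(2)[OF Y]] supp_dim(1)[OF Y, where 'k='k] by simp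
  then show ?thesis using 1 2 rk by linarith
qed

lemma dim_kernel_transpose:
  fixes M :: "'x \<Rightarrow> 'y \<Rightarrow> 'k::field"
  assumes X: "finite X" and Y: "finite Y"
  shows "KF.dim {g \<in> supp X. \<forall>y\<in>Y. (\<Sum>x\<in>X. M x y * g x) = 0} + card Y =
         KF.dim {h \<in> supp Y. \<forall>x\<in>X. (\<Sum>y\<in>Y. M x y * h y) = 0} + card X"
  using dim_kernel_transpose_le[OF X Y, of M] dim_kernel_transpose_le[OF Y X, of "\<lambda>y x. M x y"]
  by linarith

section \<open>Polynomials and ideals\<close>

abbreviation lookup :: "('a \<Rightarrow>\<^sub>0 'b::zero) \<Rightarrow> 'a \<Rightarrow> 'b" where
  "lookup \<equiv> Poly_Mapping.lookup"

abbreviation keys :: "('a \<Rightarrow>\<^sub>0 'b::zero) \<Rightarrow> 'a set" where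
  "keys \<equiv> Poly_Mapping.keys"

lemma Const_simps:
  "Const (a + b) = Const a + Const b" "Const (a * b) = Const a * Const b"
  "Const 0 = 0" "Const 1 = 1" "Const (- a) = - Const a"
  by (simp_all add: Const_def single_add mult_single single_uminus)

lemma lookup_Const_mult: "lookup (Const c * p) m = c * lookup p m"
  by (simp add: Const_def flip: mult_map_scale_conv_mult) (simp add: Poly_Mapping.map.rep_eq when_def)

definition var :: "3 \<Rightarrow> 'k::field poly3" where
  "var i = monomial (Poly_Mapping.single i 1)"

lemma monomial_mult: "monomial m * monomial n = monomial (m + n)"
  by (simp add: monomial_def mult_single)

lemma monomial_0: "monomial 0 = 1"
  by (simp add: monomial_def)

lemma lookup_monomial: "lookup (monomial m) n = (if n = m then 1 else 0)"
  by (simp add: monomial_def lookup_single when_def)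

interpretation P: vspace "\<lambda>(c::'k::field) p. Const c * p"
  by unfold_locales (auto simp: Const_simps algebra_simps)

interpretation PF: vspace "\<lambda>(c::'k::field) (f :: 'x \<Rightarrow> 'k poly3) x. Const c * f x"
  by unfold_locales (auto simp: fun_eq_iff Const_simps algebra_simps)

interpretation PP: vspace_pair "\<lambda>(c::'k::field) p. Const c * p" "\<lambda>(c::'k::field) p. Const c * p" ..

interpretation PFPF: vspace_pair "\<lambda>(c::'k::field) (f :: 'x \<Rightarrow> 'k poly3) x. Const c * f x"
  "\<lambda>(c::'k::field) (f :: 'y \<Rightarrow> 'k poly3) x. Const c * f x" ..

interpretation PFKF: vspace_pair "\<lambda>(c::'k::field) (f :: 'x \<Rightarrow> 'k poly3) x. Const c * f x"
  "\<lambda>(c::'k::field) (f :: 'y \<Rightarrow> 'k) x. c * f x" ..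

lemma poly_expand: "p = (\<Sum>m\<in>keys p. Const (lookup p m) * monomial m)"
proof (rule poly_mapping_eqI)
  fix n
  have "lookup (\<Sum>m\<in>keys p. Const (lookup p m) * monomial m) n =
      (\<Sum>m\<in>keys p. lookup p m * lookup (monomial m) n)"
    by (simp add: lookup_sum lookup_Const_mult)
  also have "\<dots> = (\<Sum>m\<in>keys p. if m = n then lookup p m else 0)"
    by (rule sum.cong) (auto simp: lookup_monomial)
  finally show "lookup p n = lookup (\<Sum>m\<in>keys p. Const (lookup p m) * monomial m) n"
    by (simp add: in_keys_iff)
qed

lemma keys_subset_span: "keys p \<subseteq> B \<Longrightarrow> p \<in> P.span (monomial ` B)"
  by (subst poly_expand, rule P.span_sum, rule P.span_scale, rule P.span_base) auto

lemma subspace_keys: "P.subspace {p. keys p \<subseteq> B}"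
proof -
  have "keys p \<subseteq> B \<longleftrightarrow> (\<forall>m. m \<notin> B \<longrightarrow> lookup p m = 0)" for p :: "'a poly3"
    by (auto simp: in_keys_iff)
  then show ?thesis
    by (auto simp: P.subspace_def lookup_add lookup_Const_mult)
qed

lemma span_monomials: "P.span (monomial ` B) = {p. keys p \<subseteq> B}"
proof
  show "P.span (monomial ` B) \<subseteq> {p. keys p \<subseteq> B}"
    by (rule P.span_minimal[OF _ subspace_keys]) (auto simp: monomial_def)
qed (auto intro: keys_subset_span)

lemma independent_monomials: "P.independent (monomial ` B :: 'k::field poly3 set)"
proof -
  have *: "P.independent (monomial ` F :: 'k poly3 set)" if F: "finite F" for F
  proof (rule P.independent_if_scalars_zero)
    show "finite (monomial ` F)" using F by simp
    fix f :: "'k poly3 \<Rightarrow> 'k" and p :: "'k poly3"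
    assume s: "(\<Sum>x\<in>monomial ` F. Const (f x) * x) = 0" and "p \<in> monomial ` F"
    then obtain m where m: "m \<in> F" "p = monomial m" by blast
    have "inj_on (monomial :: _ \<Rightarrow> 'k poly3) F"
      by (rule inj_onI) (metis lookup_monomial zero_neq_one)
    then have "0 = lookup (\<Sum>n\<in>F. Const (f (monomial n)) * monomial n) m"
      using s by (simp add: sum.reindex)
    also have "\<dots> = (\<Sum>n\<in>F. f (monomial n) * lookup (monomial n) m)"
      by (simp add: lookup_sum lookup_Const_mult)
    also have "\<dots> = (\<Sum>n\<in>F. if n = m then f (monomial n) else 0)"
      by (rule sum.cong) (auto simp: lookup_monomial)
    also have "\<dots> = f p" using m F by simp
    finally show "f p = 0" by simp
  qed
  show ?thesis
  proof
    assume "P.dependent (monomial ` B :: 'k poly3 set)"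
    then obtain T u v where T: "finite T" "T \<subseteq> monomial ` B"
        "(\<Sum>v\<in>T. Const (u v) * v) = 0" "v \<in> T" "u v \<noteq> (0 :: 'k)"
      unfolding P.dependent_explicit by blast
    then have "P.dependent T" unfolding P.dependent_explicit by blast
    moreover obtain F where "finite F" "T = monomial ` F"
      using T(1,2) by (metis finite_subset_image)
    ultimately show False using * by blast
  qed
qed

lemma dim_keys:
  assumes "finite B"
  shows "P.dim {p :: 'k::field poly3. keys p \<subseteq> B} = card B"
proof -
  have "P.dim (P.span (monomial ` B) :: 'k poly3 set) = card (monomial ` B :: 'k poly3 set)"
    by (rule P.dim_span_eq_card_independent[OF independent_monomials])
  moreover have "inj_on (monomial :: _ \<Rightarrow> 'k poly3) B"
    by (rule inj_onI) (metis lookup_monomial zero_neq_one)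
  ultimately show ?thesis by (simp add: span_monomials card_image)
qed

lemma fd_keys: "P.fd {p :: 'k::field poly3. keys p \<subseteq> B} \<longleftrightarrow> finite B"
proof
  assume "finite B"
  then show "P.fd {p :: 'k poly3. keys p \<subseteq> B}"
    unfolding P.fd_def span_monomials[symmetric] by blast
next
  assume fd: "P.fd {p :: 'k poly3. keys p \<subseteq> B}"
  have "finite (monomial ` B :: 'k poly3 set)"
    by (rule P.fd_independent_finite[OF fd _ independent_monomials]) (auto simp: monomial_def)
  moreover have "inj_on (monomial :: _ \<Rightarrow> 'k poly3) B"
    by (rule inj_onI) (metis lookup_monomial zero_neq_one)
  ultimately show "finite B" using finite_imageD by blast
qed

section \<open>Linear maps of the polynomial ring to itself, and induction on polynomials\<close>

definition klin :: "('k::field poly3 \<Rightarrow> 'k poly3) \<Rightarrow> bool" where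
  "klin f \<longleftrightarrow> (\<forall>p q. f (p + q) = f p + f q) \<and> (\<forall>c p. f (Const c * p) = Const c * f p)"

lemma klin_add: "klin f \<Longrightarrow> f (p + q) = f p + f q"
  and klin_scale: "klin f \<Longrightarrow> f (Const c * p) = Const c * f p"
  by (auto simp: klin_def)

lemma klin_0: "klin f \<Longrightarrow> f 0 = 0"
  by (metis add_0 add_right_cancel klin_add)

lemma klin_neg: "klin f \<Longrightarrow> f (- p) = - f p"
  using minus_unique[of "f p" "f (- p)"] klin_add[of f p "- p"] klin_0[of f] by simp

lemma klin_diff: "klin f \<Longrightarrow> f (p - q) = f p - f q"
  using klin_add[of f p "- q"] by (simp add: klin_neg)

lemma klin_sum: "klin f \<Longrightarrow> f (\<Sum>i\<in>A. g i) = (\<Sum>i\<in>A. f (g i))"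
  by (induction A rule: infinite_finite_induct) (auto simp: klin_0 klin_add)

lemma klin_linear: "klin f \<longleftrightarrow> Vector_Spaces.linear (\<lambda>c p. Const c * p) (\<lambda>c p. Const c * p) f"
  unfolding Vector_Spaces.linear_iff klin_def by (auto intro: P.vector_space_axioms)

lemma klin_eqI:
  assumes "klin f" "klin g" "\<And>m. f (monomial m) = g (monomial m)"
  shows "f p = g p"
  by (subst (1 2) poly_expand) (simp add: klin_sum klin_scale assms)

lemma exponent_induct [case_names zero add]:
  fixes m :: "3 \<Rightarrow>\<^sub>0 nat"
  assumes "Q 0" "\<And>m i. Q m \<Longrightarrow> Q (m + Poly_Mapping.single i 1)"
  shows "Q m"
proof (induction "\<Sum>i\<in>UNIV. lookup m i" arbitrary: m)
  case 0
  then have "m = 0" by (intro poly_mapping_eqI) simp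
  then show ?case using assms(1) by simp
next
  case (Suc n)
  then obtain i where i: "lookup m i > 0"
    by (metis gr0I sum.neutral nat.distinct(1))
  define m' where "m' = m - Poly_Mapping.single i 1"
  have m: "m = m' + Poly_Mapping.single i 1"
    using i by (intro poly_mapping_eqI) (auto simp: m'_def lookup_add lookup_minus lookup_single when_def)
  have "(\<Sum>j\<in>UNIV. lookup m j) = (\<Sum>j\<in>UNIV. if j = i then 1 else 0) + (\<Sum>j\<in>UNIV. lookup m' j)"
    unfolding sum.distrib[symmetric]
    by (subst m, rule sum.cong) (auto simp: lookup_add lookup_single when_def)
  then have "n = (\<Sum>j\<in>UNIV. lookup m' j)" using Suc(2) by simp
  then show ?case unfolding m by (intro assms(2) Suc(1))
qed

text \<open>Reduces assertions about multiplication by arbitrary polynomials to the three variables,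
  so that three operators carry all the information on a module.\<close>

lemma poly3_induct [case_names zero add Const var]:
  assumes "Q 0" "\<And>p q. Q p \<Longrightarrow> Q q \<Longrightarrow> Q (p + q)"
    "\<And>c. Q (Const c)" "\<And>i p. Q p \<Longrightarrow> Q (var i * p)"
  shows "Q p"
proof -
  have "Q (Const c * monomial m)" for c m
  proof (induction m rule: exponent_induct)
    case zero
    then show ?case using assms(3) by (simp add: monomial_0)
  next
    case (add m i)
    then have "Q (var i * (Const c * monomial m))" by (rule assms)
    then show ?case
      by (simp add: var_def mult.left_commute monomial_mult add.commute)
  qed
  then have "Q (\<Sum>m\<in>A. Const (lookup p m) * monomial m)" for A
    by (induction A rule: infinite_finite_induct) (auto intro: assms)
  then show ?thesis by (subst poly_expand)
qed

section \<open>Ideals and their generators\<close>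

definition is_ideal :: "'k::field poly3 set \<Rightarrow> bool" where
  "is_ideal I \<longleftrightarrow> 0 \<in> I \<and> (\<forall>f\<in>I. \<forall>g\<in>I. f + g \<in> I) \<and> (\<forall>f\<in>I. \<forall>s. s * f \<in> I)"

lemma is_idealD:
  assumes "is_ideal I"
  shows "0 \<in> I" "f \<in> I \<Longrightarrow> g \<in> I \<Longrightarrow> f + g \<in> I" "f \<in> I \<Longrightarrow> s * f \<in> I" "f \<in> I \<Longrightarrow> f * s \<in> I"
    "f \<in> I \<Longrightarrow> - f \<in> I" "f \<in> I \<Longrightarrow> g \<in> I \<Longrightarrow> f - g \<in> I"
proof -
  show "0 \<in> I" and a: "\<And>f g. f \<in> I \<Longrightarrow> g \<in> I \<Longrightarrow> f + g \<in> I" and s: "\<And>f s. f \<in> I \<Longrightarrow> s * f \<in> I"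
    using assms by (auto simp: is_ideal_def)
  then show "f \<in> I \<Longrightarrow> f * s \<in> I" by (simp add: mult.commute)
  show n: "\<And>f. f \<in> I \<Longrightarrow> - f \<in> I" using s[of _ "-1"] by simp
  show "f \<in> I \<Longrightarrow> g \<in> I \<Longrightarrow> f - g \<in> I" using a[of f "- g"] n by simp
qed

lemma is_ideal_sum: "is_ideal I \<Longrightarrow> (\<And>x. x \<in> A \<Longrightarrow> g x \<in> I) \<Longrightarrow> sum g A \<in> I"
  by (induction A rule: infinite_finite_induct) (auto intro: is_idealD)

lemma ideal_iff: "ideal I S \<longleftrightarrow> is_ideal I"
proof
  assume "ideal I S"
  then interpret ideal I S .
  show "is_ideal I"
    using zero_closed a_closed I_l_closed unfolding is_ideal_def by simp
next
  assume I: "is_ideal I"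
  show "ideal I S"
  proof (rule idealI)
    show "ring (S :: 'a poly3 ring)" by (rule class_ring.ring_axioms)
    show "subgroup I (add_monoid S)"
    proof
      fix x assume x: "x \<in> I"
      have "\<ominus>\<^bsub>S\<^esub> x = - x" by (simp add: class_ring_simps)
      then have "inv\<^bsub>add_monoid S\<^esub> x = - x" by (simp add: a_inv_def)
      then show "inv\<^bsub>add_monoid S\<^esub> x \<in> I" using x I is_idealD by metis
    qed (use I is_idealD in auto)
  qed (use I is_idealD in auto)
qed

definition Gen :: "'k::field poly3 set \<Rightarrow> 'k poly3 set" where
  "Gen A = Idl\<^bsub>S\<^esub> A"

lemma is_ideal_Gen: "is_ideal (Gen A)"
  unfolding Gen_def by (subst ideal_iff[symmetric]) (rule ring.genideal_ideal[OF class_ring.ring_axioms], simp)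

lemma Gen_superset: "A \<subseteq> Gen A"
  unfolding Gen_def using ring.genideal_self[OF class_ring.ring_axioms, of A] by simp

lemma Gen_minimal: "is_ideal I \<Longrightarrow> A \<subseteq> I \<Longrightarrow> Gen A \<subseteq> I"
  unfolding Gen_def by (rule ring.genideal_minimal[OF class_ring.ring_axioms]) (simp_all add: ideal_iff)

lemma Gen_empty: "Gen {} = {0}"
proof
  show "Gen {} \<subseteq> {0 :: 'a poly3}" by (rule Gen_minimal) (auto simp: is_ideal_def)
qed (use is_ideal_Gen is_idealD in blast)

lemma Gen_insert: "Gen (insert a A) = {u * a + g | u g. g \<in> Gen A}"
proof
  have "is_ideal {u * a + g | u g. g \<in> Gen A}"
    unfolding is_ideal_def
  proof (intro conjI ballI allI)
    note G = is_idealD[OF is_ideal_Gen[of A]]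
    show "0 \<in> {u * a + g | u g. g \<in> Gen A}" using G by (auto intro!: exI[of _ 0])
    fix f assume "f \<in> {u * a + g | u g. g \<in> Gen A}"
    then obtain u g where f: "f = u * a + g" "g \<in> Gen A" by blast
    show "s * f \<in> {u * a + g | u g. g \<in> Gen A}" for s
    proof -
      have "s * f = (s * u) * a + s * g" by (simp add: f algebra_simps)
      then show ?thesis using G(3)[of g s] f by blast
    qed
    fix h assume "h \<in> {u * a + g | u g. g \<in> Gen A}"
    then obtain v g' where h: "h = v * a + g'" "g' \<in> Gen A" by blast
    show "f + h \<in> {u * a + g | u g. g \<in> Gen A}"
    proof -
      have "f + h = (u + v) * a + (g + g')" by (simp add: f h algebra_simps)
      then show ?thesis using G(2)[of g g'] f h by blast
    qed
  qed
  moreover have "insert a A \<subseteq> {u * a + g | u g. g \<in> Gen A}"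
  proof -
    have "a = 1 * a + 0" by simp
    moreover have "x = 0 * a + x" for x by simp
    ultimately show ?thesis using Gen_superset[of A] is_idealD(1)[OF is_ideal_Gen[of A]] by blast
  qed
  ultimately show "Gen (insert a A) \<subseteq> {u * a + g | u g. g \<in> Gen A}" by (rule Gen_minimal)
  have "Gen A \<subseteq> Gen (insert a A)"
    by (rule Gen_minimal[OF is_ideal_Gen]) (use Gen_superset[of "insert a A"] in auto)
  then show "{u * a + g | u g. g \<in> Gen A} \<subseteq> Gen (insert a A)"
    using Gen_superset[of "insert a A"] is_idealD[OF is_ideal_Gen[of "insert a A"]] by blast
qed

section \<open>Normal forms modulo an ideal\<close>

text \<open>\<open>nf\<close> is the projection along \<open>I\<close> onto the span of the
  monomials with exponents in \<open>B\<close>. No monomial order is involved: these monomials are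
  just some basis of a complement of \<open>I\<close>.\<close>

definition normal_form :: "'k::field poly3 set \<Rightarrow> (3 \<Rightarrow>\<^sub>0 nat) set \<Rightarrow> ('k poly3 \<Rightarrow> 'k poly3) \<Rightarrow> bool" where
  "normal_form I B nf \<longleftrightarrow> klin nf \<and> (\<forall>p. nf p = 0 \<longleftrightarrow> p \<in> I) \<and>
     (\<forall>p. keys (nf p) \<subseteq> B) \<and> (\<forall>p. keys p \<subseteq> B \<longrightarrow> nf p = p)"

lemma subspace_ideal: "is_ideal I \<Longrightarrow> P.subspace I"
  by (auto simp: P.subspace_def intro: is_idealD)

text \<open>A basis of \<open>I\<close> is extended to a basis of S by monomials; the added
  monomials give \<open>B\<close>, and \<open>nf\<close> kills the former and fixes the latter. The
  quotient may be infinite-dimensional here, as finiteness of \<open>B\<close> is sometimes the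
  point to be proved.\<close>

lemma normal_form_exists:
  fixes I :: "'k::field poly3 set"
  assumes "is_ideal I"
  shows "\<exists>B nf. normal_form I B nf"
proof -
  obtain A where A: "A \<subseteq> I" "P.independent A" "I \<subseteq> P.span A"
    using P.maximal_independent_subset[of I] by blast
  have spA: "P.span A = I"
    using A P.span_minimal[OF A(1) subspace_ideal[OF assms]] by blast
  obtain C where C: "A \<subseteq> C" "C \<subseteq> A \<union> range monomial" "P.independent C"
      "A \<union> range monomial \<subseteq> P.span C"
    using P.maximal_independent_subset_extend[of A "A \<union> range monomial"] A(2) by blast
  have spC: "p \<in> P.span C" for p
  proof -
    have "P.span (range monomial) \<subseteq> P.span C"
      by (rule P.span_minimal) (use C in auto)
    then show ?thesis using keys_subset_span[of p UNIV] by auto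
  qed
  define B where "B = {m. monomial m \<in> C - A}"
  define nf where "nf = PP.construct C (\<lambda>c. if c \<in> A then 0 else c)"
  have lin: "klin nf"
    unfolding klin_linear nf_def by (rule PP.linear_construct[OF C(3)])
  have nfC: "nf c = (if c \<in> A then 0 else c)" if "c \<in> C" for c
    unfolding nf_def using PP.construct_basis[OF C(3) that] by simp
  have sub: "P.subspace {p. nf p - p \<in> I \<and> keys (nf p) \<subseteq> B}"
    using subspace_ideal[OF assms] subspace_keys[of B] unfolding P.subspace_def
    by (simp add: klin_0 klin_add klin_scale lin add_diff_add right_diff_distrib[symmetric]) blast
  have "C \<subseteq> {p. nf p - p \<in> I \<and> keys (nf p) \<subseteq> B}"
  proof
    fix c assume c: "c \<in> C"
    show "c \<in> {p. nf p - p \<in> I \<and> keys (nf p) \<subseteq> B}"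
    proof (cases "c \<in> A")
      case True
      then show ?thesis using A(1) nfC[OF c] is_idealD[OF assms] by auto
    next
      case False
      then obtain m where "c = monomial m" using C(2) c by blast
      then show ?thesis using False nfC[OF c] c is_idealD(1)[OF assms] by (auto simp: B_def monomial_def)
    qed
  qed
  then have "P.span C \<subseteq> {p. nf p - p \<in> I \<and> keys (nf p) \<subseteq> B}"
    by (rule P.span_minimal[OF _ sub])
  then have *: "nf p - p \<in> I" "keys (nf p) \<subseteq> B" for p using spC by blast+
  have "P.subspace {p. nf p = 0}"
    by (auto simp: P.subspace_def klin_0 klin_add klin_scale lin)
  then have "P.span A \<subseteq> {p. nf p = 0}"
    by (rule P.span_minimal[rotated]) (use nfC C(1) in auto)
  then have "p \<in> I \<Longrightarrow> nf p = 0" for p using spA by blast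
  moreover have "nf p = 0 \<Longrightarrow> p \<in> I" for p
    using *(1)[of p] is_idealD(5)[OF assms, of "- p"] by simp
  moreover have "nf p = p" if "keys p \<subseteq> B" for p
  proof -
    have "nf p = (\<Sum>m\<in>keys p. Const (lookup p m) * nf (monomial m))"
      by (subst poly_expand) (simp add: klin_sum klin_scale lin)
    also have "\<dots> = (\<Sum>m\<in>keys p. Const (lookup p m) * monomial m)"
      by (rule sum.cong) (use that nfC in \<open>auto simp: B_def\<close>)
    finally show ?thesis using poly_expand[of p] by simp
  qed
  ultimately have "normal_form I B nf"
    using lin *(2) unfolding normal_form_def by blast
  then show ?thesis by blast
qed

lemma
  assumes "normal_form I B nf"
  shows nf_klin: "klin nf" and nf_eq_0: "nf p = 0 \<longleftrightarrow> p \<in> I" and nf_keys: "keys (nf p) \<subseteq> B"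
    and nf_id: "keys p \<subseteq> B \<Longrightarrow> nf p = p"
  using assms by (auto simp: normal_form_def)

lemma nf_nf: "normal_form I B nf \<Longrightarrow> nf (nf p) = nf p"
  by (simp add: nf_id nf_keys)

lemma nf_eq: "normal_form I B nf \<Longrightarrow> nf p = nf q \<longleftrightarrow> p - q \<in> I"
  using nf_eq_0[of I B nf "p - q"] by (simp add: klin_diff nf_klin)

lemma nf_diff: "normal_form I B nf \<Longrightarrow> nf p - p \<in> I" "normal_form I B nf \<Longrightarrow> p - nf p \<in> I"
  by (auto simp: nf_nf simp flip: nf_eq)

lemma nf_range:
  fixes I :: "'a::field poly3 set"
  assumes "normal_form I B nf"
  shows "range nf = {p. keys p \<subseteq> B}"
proof (intro equalityI subsetI)
  fix p :: "'a poly3" assume "p \<in> {p. keys p \<subseteq> B}"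
  then have "p = nf p" using nf_id[OF assms] by simp
  then show "p \<in> range nf" by (rule range_eqI)
qed (use nf_keys[OF assms] in auto)

lemma nf_mult_cong:
  assumes "normal_form I B nf" "is_ideal I" "nf p = nf q"
  shows "nf (s * p) = nf (s * q)"
  using assms is_idealD(3)[of I "p - q" s] by (simp add: nf_eq right_diff_distrib)

lemma nf_mult_nf: 
  assumes "normal_form I B nf" "is_ideal I"
  shows "nf (s * nf p) = nf (s * p)"
  by (rule nf_mult_cong[OF assms]) (rule nf_nf[OF assms(1)])

lemma coset_eq:
  assumes "is_ideal I"
  shows "(I +>\<^bsub>S\<^esub> a = I +>\<^bsub>S\<^esub> b) \<longleftrightarrow> a - b \<in> I"
proof -
  have I: "ideal I S" using assms by (simp add: ideal_iff)
  show ?thesis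
  proof
    assume "I +>\<^bsub>S\<^esub> a = I +>\<^bsub>S\<^esub> b"
    moreover have "a \<in> I +>\<^bsub>S\<^esub> a"
      using is_idealD(1)[OF assms] by (auto simp: a_r_coset_def r_coset_def)
    ultimately have "a \<in> I +>\<^bsub>S\<^esub> b" by simp
    then show "a - b \<in> I" by (auto simp: a_r_coset_def r_coset_def)
  next
    assume "a - b \<in> I"
    then show "I +>\<^bsub>S\<^esub> a = I +>\<^bsub>S\<^esub> b"
      apply (auto simp: a_r_coset_def r_coset_def)
      subgoal for h using is_idealD(2)[OF assms, of h "a - b"] by (auto intro!: bexI[of _ "h + (a - b)"])
      subgoal for h using is_idealD(6)[OF assms, of h "a - b"] by (auto intro!: bexI[of _ "h - (a - b)"])
      done
  qed
qed

text \<open>The normal form of an arbitrary representative identifies the quotient with a subspace of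
  the polynomial ring.\<close>

definition coset_nf :: "('k::field poly3 \<Rightarrow> 'k poly3) \<Rightarrow> 'k poly3 set \<Rightarrow> 'k poly3" where
  "coset_nf nf A = nf (SOME a. a \<in> A)"

lemma coset_nf:
  assumes "normal_form I B nf" "is_ideal I"
  shows "coset_nf nf (I +>\<^bsub>S\<^esub> a) = nf a"
proof -
  have "a \<in> I +>\<^bsub>S\<^esub> a"
    using is_idealD(1)[OF assms(2)] by (auto simp: a_r_coset_def r_coset_def)
  then have "(SOME b. b \<in> I +>\<^bsub>S\<^esub> a) \<in> I +>\<^bsub>S\<^esub> a" by (rule someI)
  then have "(SOME b. b \<in> I +>\<^bsub>S\<^esub> a) - a \<in> I" by (auto simp: a_r_coset_def r_coset_def)
  then show ?thesis by (simp add: coset_nf_def nf_eq[OF assms(1)])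
qed

lemma quotient_simps:
  assumes "is_ideal I"
  shows "carrier (quotient_module S I) = range (\<lambda>a. I +>\<^bsub>S\<^esub> a)"
    "\<zero>\<^bsub>quotient_module S I\<^esub> = I +>\<^bsub>S\<^esub> 0"
    "(I +>\<^bsub>S\<^esub> a) \<oplus>\<^bsub>quotient_module S I\<^esub> (I +>\<^bsub>S\<^esub> b) = I +>\<^bsub>S\<^esub> (a + b)"
    "s \<odot>\<^bsub>quotient_module S I\<^esub> (I +>\<^bsub>S\<^esub> a) = I +>\<^bsub>S\<^esub> (s * a)"
proof -
  interpret I: ideal I S using assms by (simp add: ideal_iff)
  show "carrier (quotient_module S I) = range (\<lambda>a. I +>\<^bsub>S\<^esub> a)"
    by (auto simp: quotient_module_def FactRing_def A_RCOSETS_def')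
  show "\<zero>\<^bsub>quotient_module S I\<^esub> = I +>\<^bsub>S\<^esub> 0"
    by (auto simp: quotient_module_def FactRing_def a_r_coset_def r_coset_def)
  show "(I +>\<^bsub>S\<^esub> a) \<oplus>\<^bsub>quotient_module S I\<^esub> (I +>\<^bsub>S\<^esub> b) = I +>\<^bsub>S\<^esub> (a + b)"
    using I.a_rcos_sum[of a b] by (simp add: quotient_module_def FactRing_def)
  show "s \<odot>\<^bsub>quotient_module S I\<^esub> (I +>\<^bsub>S\<^esub> a) = I +>\<^bsub>S\<^esub> (s * a)"
    using I.rcoset_mult_add[of s a] by (simp add: quotient_module_def FactRing_def)
qed

lemma quotient_dim:
  fixes I :: "'k::field poly3 set"
  assumes nf: "normal_form I B nf" and I: "is_ideal I"
  shows "fin_dim_over_k (quotient_module S I) \<longleftrightarrow> finite B"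
    and "finite B \<Longrightarrow> dim_over_k (quotient_module S I) = card B"
proof -
  let ?V = "restrict_scalars Const (quotient_module S I)"
  have simps: "carrier ?V = carrier (quotient_module S I)" "zero ?V = zero (quotient_module S I)"
    "add ?V = add (quotient_module S I)" "module.smult ?V c A = module.smult (quotient_module S I) (Const c) A" for c A
    by (auto simp: restrict_scalars_def)
  have im: "coset_nf nf ` carrier ?V = {p. keys p \<subseteq> B}"
    unfolding simps quotient_simps[OF I] image_image coset_nf[OF nf I] nf_range[OF nf] ..
  have inj: "inj_on (coset_nf nf) (carrier ?V)"
    by (rule inj_onI) (clarsimp simp: simps quotient_simps[OF I] coset_nf[OF nf I] nf_eq[OF nf] coset_eq[OF I])
  have U: "P.subspace (coset_nf nf ` carrier ?V)" unfolding im by (rule subspace_keys)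
  note rv = P.record_vectorspace[OF inj U]
  have "fin_dim_over_k (quotient_module S I) \<longleftrightarrow> P.fd (coset_nf nf ` carrier ?V)"
    by (rule rv(2)) (auto simp: simps quotient_simps[OF I] coset_nf[OF nf I]
        klin_0 klin_add klin_scale nf_klin[OF nf])
  then show "fin_dim_over_k (quotient_module S I) \<longleftrightarrow> finite B"
    unfolding im fd_keys .
  assume B: "finite B"
  have "P.fd (coset_nf nf ` carrier ?V)" unfolding im fd_keys by (rule B)
  then have "dim_over_k (quotient_module S I) = P.dim (coset_nf nf ` carrier ?V)"
    by (intro rv(3)) (auto simp: simps quotient_simps[OF I] coset_nf[OF nf I]
        klin_0 klin_add klin_scale nf_klin[OF nf])
  then show "dim_over_k (quotient_module S I) = card B"
    unfolding im dim_keys[OF B] .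
qed

section \<open>Tangent spaces\<close>

text \<open>A tangent vector, which is a homomorphism from \<open>I\<close> to the quotient, is extended by zero to the
  chosen complement of \<open>I\<close>, and its values are represented by normal forms. The larger space \<open>Ext\<close>
  drops the requirement on the complement.\<close>

definition Ext :: "'k::field poly3 set \<Rightarrow> ('k poly3 \<Rightarrow> 'k poly3) \<Rightarrow> ('k poly3 \<Rightarrow> 'k poly3) set" where
  "Ext I nf = {\<psi>. klin \<psi> \<and> (\<forall>p. nf (\<psi> p) = \<psi> p) \<and> (\<forall>f\<in>I. \<forall>s. \<psi> (s * f) = nf (s * \<psi> f))}"

definition Tan :: "'k::field poly3 set \<Rightarrow> ('k poly3 \<Rightarrow> 'k poly3) \<Rightarrow> ('k poly3 \<Rightarrow> 'k poly3) set" where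
  "Tan I nf = {\<psi> \<in> Ext I nf. \<forall>p. \<psi> (nf p) = 0}"

lemma
  assumes "\<psi> \<in> Ext I nf"
  shows Ext_klin: "klin \<psi>" and Ext_nf: "nf (\<psi> p) = \<psi> p"
    and Ext_mult: "f \<in> I \<Longrightarrow> \<psi> (s * f) = nf (s * \<psi> f)"
  using assms by (auto simp: Ext_def)

lemma
  assumes "\<psi> \<in> Tan I nf"
  shows Tan_Ext: "\<psi> \<in> Ext I nf" and Tan_nf: "\<psi> (nf p) = 0"
  using assms by (auto simp: Tan_def)

lemma subspace_Ext:
  assumes "normal_form I B nf"
  shows "PF.subspace (Ext I nf)"
proof -
  note nf = nf_klin[OF assms]
  show ?thesis
  proof (rule PF.subspaceI)
    show "0 \<in> Ext I nf" by (simp add: Ext_def klin_def klin_0[OF nf])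
    fix \<psi> assume \<psi>: "\<psi> \<in> Ext I nf"
    note 1 = Ext_klin[OF \<psi>] Ext_nf[OF \<psi>] Ext_mult[OF \<psi>]
    show "(\<lambda>p. Const c * \<psi> p) \<in> Ext I nf" for c
    proof -
      have "nf (s * (Const c * \<psi> p)) = Const c * nf (s * \<psi> p)" for s p
        using klin_scale[OF nf, of c "s * \<psi> p"] by (simp add: mult.left_commute)
      then show ?thesis
        by (simp add: Ext_def klin_def 1 klin_add[OF 1(1)] klin_scale[OF 1(1)] klin_scale[OF nf]
            distrib_left mult.left_commute)
    qed
    fix \<chi> assume \<chi>: "\<chi> \<in> Ext I nf"
    note 2 = Ext_klin[OF \<chi>] Ext_nf[OF \<chi>] Ext_mult[OF \<chi>]
    show "\<psi> + \<chi> \<in> Ext I nf"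
      by (simp add: Ext_def klin_def 1 2 klin_add[OF 1(1)] klin_scale[OF 1(1)] klin_add[OF 2(1)]
          klin_scale[OF 2(1)] klin_add[OF nf] distrib_left)
  qed
qed

lemma subspace_Tan:
  assumes "normal_form I B nf"
  shows "PF.subspace (Tan I nf)"
  using subspace_Ext[OF assms] unfolding PF.subspace_def Tan_def by auto

lemma PFKF_linearI:
  assumes "\<And>g h. f (\<lambda>x. g x + h x) = (\<lambda>y. f g y + f h y)" "\<And>c g. f (\<lambda>x. Const c * g x) = (\<lambda>y. c * f g y)"
  shows "Vector_Spaces.linear (\<lambda>(c::'k::field) (g :: 'x \<Rightarrow> 'k poly3) x. Const c * g x) (\<lambda>c (g :: 'y \<Rightarrow> 'k) x. c * g x) f"
  unfolding Vector_Spaces.linear_iff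
  by (intro conjI allI KF.vector_space_axioms PF.vector_space_axioms) (simp_all add: plus_fun_def assms)

lemma PFPF_linearI:
  assumes "\<And>g h. f (\<lambda>x. g x + h x) = (\<lambda>y. f g y + f h y)" "\<And>c g. f (\<lambda>x. Const c * g x) = (\<lambda>y. Const c * f g y)"
  shows "Vector_Spaces.linear (\<lambda>(c::'k::field) (g :: 'x \<Rightarrow> 'k poly3) x. Const c * g x) (\<lambda>c (g :: 'y \<Rightarrow> 'k poly3) x. Const c * g x) f"
  unfolding Vector_Spaces.linear_iff
  by (intro conjI allI PF.vector_space_axioms) (simp_all add: plus_fun_def assms)

lemma klin_nf_expand:
  assumes "klin f" "normal_form I B nf"
  shows "f (nf p) = (\<Sum>b\<in>keys (nf p). Const (lookup (nf p) b) * f (monomial b))"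
  by (subst poly_expand[of "nf p"]) (simp add: klin_sum klin_scale assms(1))

lemma Ext_nf_eq_0:
  assumes "normal_form I B nf" "\<psi> \<in> Ext I nf" "\<And>b. b \<in> B \<Longrightarrow> \<psi> (s * monomial b) = 0"
  shows "\<psi> (s * nf p) = 0"
proof -
  have "klin (\<lambda>p. \<psi> (s * p))"
    using klin_scale[OF Ext_klin[OF assms(2)], of _ "s * _"]
    by (simp add: klin_def klin_add[OF Ext_klin[OF assms(2)]] distrib_left mult.left_commute)
  from klin_nf_expand[OF this assms(1)] show ?thesis
    using nf_keys[OF assms(1), of p] assms(3) by (simp add: subset_iff)
qed

text \<open>An element of \<open>Ext\<close> is determined by its values on a finite set
  \<open>E\<close>: on 1, on the monomials of \<open>B\<close>, and on their products with the
  variables. Indeed \<open>var i * p\<close> splits into \<open>var i * nf p\<close> and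
  \<open>var i * (p - nf p)\<close>, and linearity over S applies to the second part since
  \<open>p - nf p\<close> lies in \<open>I\<close>.\<close>

lemma fd_Ext:
  fixes I :: "'k::field poly3 set"
  assumes nf: "normal_form I B nf" and I: "is_ideal I" and B: "finite B"
  shows "PF.fd (Ext I nf)"
proof -
  define E :: "'k poly3 set" where
    "E = insert 1 (monomial ` B \<union> (\<lambda>(i, b). var i * monomial b) ` (UNIV \<times> B))"
  define G where "G = (\<lambda>(\<psi> :: 'k poly3 \<Rightarrow> 'k poly3) (p :: 'k poly3, a). if p \<in> E then lookup (\<psi> p) a else (0::'k))"
  have lin: "Vector_Spaces.linear (\<lambda>c g x. Const c * g x) (\<lambda>c g x. c * g x) G"
    by (rule PFKF_linearI) (auto simp: G_def fun_eq_iff lookup_add lookup_Const_mult)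
  have inj: "inj_on G (Ext I nf)"
    unfolding PFKF.linear_inj_on_iff_eq_0[OF lin subspace_Ext[OF nf]]
  proof (intro ballI impI)
    fix \<psi> assume \<psi>: "\<psi> \<in> Ext I nf" and "G \<psi> = 0"
    then have "lookup (\<psi> p) a = 0" if "p \<in> E" for p a
      using that by (auto simp: G_def fun_eq_iff split: if_splits)
    then have E: "\<psi> p = 0" if "p \<in> E" for p
      using that by (intro poly_mapping_eqI) simp
    have lin: "klin \<psi>" by (rule Ext_klin[OF \<psi>])
    have 0: "\<psi> (nf p) = 0" for p
      using Ext_nf_eq_0[OF nf \<psi>, of 1] E by (simp add: E_def)
    have 1: "\<psi> (var i * nf p) = 0" for i p
      by (rule Ext_nf_eq_0[OF nf \<psi>], rule E) (auto simp: E_def)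
    have "\<psi> p = 0" for p
    proof (induction p rule: poly3_induct)
      case (Const c)
      then show ?case using klin_scale[OF lin, of c 1] E[of 1] by (simp add: E_def)
    next
      case (var i p)
      have "\<psi> (p - nf p) = 0" using var 0 by (simp add: klin_diff lin)
      then have "\<psi> (var i * (p - nf p)) = 0"
        using Ext_mult[OF \<psi> nf_diff(2)[OF nf]] klin_0[OF nf_klin[OF nf]] by simp
      then show ?case using 1 by (simp add: right_diff_distrib klin_diff lin)
    qed (simp_all add: lin klin_0 klin_add)
    then show "\<psi> = 0" by (simp add: fun_eq_iff)
  qed
  have sub: "G ` Ext I nf \<subseteq> supp (E \<times> B)"
  proof (intro image_subsetI)
    fix \<psi> assume \<psi>: "\<psi> \<in> Ext I nf"
    have "lookup (\<psi> p) a = 0" if "a \<notin> B" for p a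
      using nf_keys[OF nf, of "\<psi> p"] that unfolding Ext_nf[OF \<psi>] by (auto simp: in_keys_iff)
    then show "G \<psi> \<in> supp (E \<times> B)" by (auto simp: G_def supp_def)
  qed
  have "finite (E \<times> B)" using B by (auto simp: E_def)
  then show ?thesis
    by (rule PFKF.fd_inj_image[OF lin subspace_Ext[OF nf] inj KF.fd_subset[OF sub supp_dim(2)]])
qed

lemma fd_Tan:
  assumes "normal_form I B nf" "is_ideal I" "finite B"
  shows "PF.fd (Tan I nf)"
  by (rule PF.fd_subset[OF _ fd_Ext[OF assms]]) (auto simp: Tan_def)

text \<open>\<open>F\<close> extends a homomorphism by zero along the complement of \<open>I\<close>
  and replaces cosets by normal forms. It is injective because extensional homomorphisms are
  determined by their values on \<open>I\<close>.\<close>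

lemma tangent_space_dim:
  fixes I :: "'k::field poly3 set"
  assumes nf: "normal_form I B nf" and I: "is_ideal I" and B: "finite B"
  shows "dim_over_k (tangent_space I) = PF.dim (Tan I nf)"
proof -
  let ?Q = "quotient_module S I"
  let ?V = "restrict_scalars Const (tangent_space I)"
  define F where "F = (\<lambda>\<phi> p. coset_nf nf (\<phi> (p - nf p)))"
  note Q = quotient_simps[OF I] coset_nf[OF nf I]
  note lin = nf_klin[OF nf]
  have I_mult: "f \<in> I \<Longrightarrow> s * f \<in> I" "f \<in> I \<Longrightarrow> g \<in> I \<Longrightarrow> f + g \<in> I" "0 \<in> I" for f g s
    using is_idealD[OF I] by auto
  have car: "\<phi> \<in> carrier ?V \<longleftrightarrow> \<phi> \<in> extensional I \<and> (\<forall>f\<in>I. \<phi> f \<in> carrier ?Q) \<and>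
      (\<forall>f\<in>I. \<forall>g\<in>I. \<phi> (f + g) = \<phi> f \<oplus>\<^bsub>?Q\<^esub> \<phi> g) \<and> (\<forall>f\<in>I. \<forall>s. \<phi> (s * f) = s \<odot>\<^bsub>?Q\<^esub> \<phi> f)" for \<phi>
    by (simp add: restrict_scalars_def tangent_space_def Hom_module_def ideal_module_def
        LinearCombinations.module_hom_def Pi_iff) blast
  have ops: "\<zero>\<^bsub>?V\<^esub> = (\<lambda>v\<in>I. \<zero>\<^bsub>?Q\<^esub>)" "\<phi> \<oplus>\<^bsub>?V\<^esub> \<chi> = (\<lambda>v\<in>I. \<phi> v \<oplus>\<^bsub>?Q\<^esub> \<chi> v)"
    "c \<odot>\<^bsub>?V\<^esub> \<phi> = (\<lambda>v\<in>I. Const c \<odot>\<^bsub>?Q\<^esub> \<phi> v)" for \<phi> \<chi> c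
    by (auto simp: restrict_scalars_def tangent_space_def Hom_module_def ideal_module_def)
  have QI: "A \<in> carrier ?Q \<Longrightarrow> A = I +>\<^bsub>S\<^esub> coset_nf nf A" for A
    by (clarsimp simp: Q coset_eq[OF I] nf_diff[OF nf])
  have Qadd: "coset_nf nf (A \<oplus>\<^bsub>?Q\<^esub> A') = coset_nf nf A + coset_nf nf A'" "A \<oplus>\<^bsub>?Q\<^esub> A' \<in> carrier ?Q"
    if "A \<in> carrier ?Q" "A' \<in> carrier ?Q" for A A'
    using that by (auto simp: Q klin_add[OF lin])
  have Qsmult: "coset_nf nf (s \<odot>\<^bsub>?Q\<^esub> A) = nf (s * coset_nf nf A)" "s \<odot>\<^bsub>?Q\<^esub> A \<in> carrier ?Q"
    if "A \<in> carrier ?Q" for A s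
    using that by (auto simp: Q nf_mult_nf[OF nf I])
  have Qnf: "nf (coset_nf nf A) = coset_nf nf A" for A
    by (simp add: coset_nf_def nf_nf[OF nf])
  have inI: "p - nf p \<in> I" for p by (rule nf_diff[OF nf])
  have FI: "F \<phi> f = coset_nf nf (\<phi> f)" if "f \<in> I" for \<phi> f
    using that nf_eq_0[OF nf, of f] by (simp add: F_def)
  have Tan: "F \<phi> \<in> Tan I nf" if \<phi>: "\<phi> \<in> carrier ?V" for \<phi>
  proof -
    have c: "\<phi> f \<in> carrier ?Q" if "f \<in> I" for f using \<phi> that by (simp add: car)
    have "F \<phi> (p + q) = F \<phi> p + F \<phi> q" for p q
    proof -
      have "\<phi> ((p + q) - nf (p + q)) = \<phi> ((p - nf p) + (q - nf q))"
        by (simp add: klin_add[OF lin] algebra_simps)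
      also have "\<dots> = \<phi> (p - nf p) \<oplus>\<^bsub>?Q\<^esub> \<phi> (q - nf q)"
        using \<phi> inI by (simp add: car)
      finally show ?thesis using c[OF inI] by (simp add: F_def Qadd)
    qed
    moreover have "F \<phi> (Const a * p) = Const a * F \<phi> p" for a p
    proof -
      have "\<phi> (Const a * p - nf (Const a * p)) = \<phi> (Const a * (p - nf p))"
        by (simp add: klin_scale[OF lin] right_diff_distrib)
      also have "\<dots> = Const a \<odot>\<^bsub>?Q\<^esub> \<phi> (p - nf p)"
        using \<phi> inI by (simp add: car)
      finally show ?thesis using c[OF inI] by (simp add: F_def Qsmult klin_scale[OF lin] Qnf)
    qed
    moreover have "F \<phi> (s * f) = nf (s * F \<phi> f)" if "f \<in> I" for s f
      using that \<phi> I_mult by (simp add: FI car Qsmult)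
    moreover have "nf (F \<phi> p) = F \<phi> p" for p by (simp add: F_def Qnf)
    moreover have "F \<phi> (nf p) = 0" for p
    proof -
      have "\<phi> (0 * 0) = 0 \<odot>\<^bsub>?Q\<^esub> \<phi> 0" using \<phi> I_mult(3) unfolding car by blast
      then have "coset_nf nf (\<phi> 0) = nf (0 * coset_nf nf (\<phi> 0))"
        using Qsmult(1)[OF c[OF I_mult(3)], of 0] by (metis mult_zero_left)
      then have "coset_nf nf (\<phi> 0) = 0" by (simp add: klin_0[OF lin])
      then show ?thesis by (simp add: F_def nf_nf[OF nf])
    qed
    ultimately show ?thesis by (simp add: Tan_def Ext_def klin_def)
  qed
  have im: "F ` carrier ?V = Tan I nf"
  proof (intro equalityI subsetI)
    fix \<psi> assume \<psi>: "\<psi> \<in> Tan I nf"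
    note E = Tan_Ext[OF \<psi>]
    define \<phi> where "\<phi> = (\<lambda>f\<in>I. I +>\<^bsub>S\<^esub> \<psi> f)"
    have "\<phi> \<in> carrier ?V"
      using I_mult by (auto simp: car \<phi>_def Q klin_add[OF Ext_klin[OF E]] Ext_mult[OF E] coset_eq[OF I]
          nf_diff[OF nf])
    moreover have "F \<phi> = \<psi>"
    proof
      fix p
      have "\<psi> (p - nf p) = \<psi> p" by (simp add: klin_diff[OF Ext_klin[OF E]] Tan_nf[OF \<psi>])
      then show "F \<phi> p = \<psi> p" using inI by (simp add: F_def \<phi>_def Q Ext_nf[OF E])
    qed
    ultimately show "\<psi> \<in> F ` carrier ?V" by blast
  qed (use Tan in auto)
  have inj: "inj_on F (carrier ?V)"
  proof (rule inj_onI)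
    fix \<phi> \<chi> assume \<phi>: "\<phi> \<in> carrier ?V" and \<chi>: "\<chi> \<in> carrier ?V" and "F \<phi> = F \<chi>"
    show "\<phi> = \<chi>"
    proof (rule extensionalityI[of _ I])
      fix f assume f: "f \<in> I"
      have "coset_nf nf (\<phi> f) = coset_nf nf (\<chi> f)"
        using FI[OF f, of \<phi>] FI[OF f, of \<chi>] \<open>F \<phi> = F \<chi>\<close> by simp
      then show "\<phi> f = \<chi> f" using QI[of "\<phi> f"] QI[of "\<chi> f"] \<phi> \<chi> f by (simp add: car)
    qed (use \<phi> \<chi> car in auto)
  qed
  have zero: "\<zero>\<^bsub>?V\<^esub> \<in> carrier ?V" "F \<zero>\<^bsub>?V\<^esub> = 0"
    using I_mult inI unfolding car ops by (auto simp: Q F_def fun_eq_iff klin_0[OF lin])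
  have add: "\<phi> \<oplus>\<^bsub>?V\<^esub> \<chi> \<in> carrier ?V" "F (\<phi> \<oplus>\<^bsub>?V\<^esub> \<chi>) = F \<phi> + F \<chi>"
    if "\<phi> \<in> carrier ?V" "\<chi> \<in> carrier ?V" for \<phi> \<chi>
  proof -
    show F: "F (\<phi> \<oplus>\<^bsub>?V\<^esub> \<chi>) = F \<phi> + F \<chi>"
      using that inI by (simp add: fun_eq_iff F_def ops car Qadd)
    \<comment> \<open>Closure of the carrier is read off from the image: the sum of the two images
      is \<open>F \<xi>\<close> with \<open>\<xi>\<close> in the carrier, and the pointwise sum
      agrees with \<open>\<xi>\<close>.\<close>
    have "F \<phi> + F \<chi> \<in> F ` carrier ?V"
      unfolding im using that Tan PF.subspace_add[OF subspace_Tan[OF nf]] by blast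
    then obtain \<xi> where \<xi>: "\<xi> \<in> carrier ?V" "F \<xi> = F \<phi> + F \<chi>" by auto
    have "\<phi> \<oplus>\<^bsub>?V\<^esub> \<chi> = \<xi>"
    proof (rule extensionalityI[of _ I])
      fix f assume f: "f \<in> I"
      have "coset_nf nf ((\<phi> \<oplus>\<^bsub>?V\<^esub> \<chi>) f) = coset_nf nf (\<xi> f)"
        using FI[OF f] F \<xi>(2) by metis
      moreover have "(\<phi> \<oplus>\<^bsub>?V\<^esub> \<chi>) f \<in> carrier ?Q" using f that by (simp add: ops car Qadd)
      moreover have "\<xi> f \<in> carrier ?Q" using f \<xi> by (simp add: car)
      ultimately show "(\<phi> \<oplus>\<^bsub>?V\<^esub> \<chi>) f = \<xi> f" using QI by metis
    qed (use \<xi> car in \<open>auto simp: ops\<close>)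
    then show "\<phi> \<oplus>\<^bsub>?V\<^esub> \<chi> \<in> carrier ?V" using \<xi> by simp
  qed
  have smult: "c \<odot>\<^bsub>?V\<^esub> \<phi> \<in> carrier ?V" "F (c \<odot>\<^bsub>?V\<^esub> \<phi>) = (\<lambda>x. Const c * F \<phi> x)"
    if "\<phi> \<in> carrier ?V" for \<phi> c
  proof -
    show F: "F (c \<odot>\<^bsub>?V\<^esub> \<phi>) = (\<lambda>x. Const c * F \<phi> x)"
      using that inI by (simp add: fun_eq_iff F_def ops car Qsmult klin_scale[OF lin] Qnf)
    have "(\<lambda>x. Const c * F \<phi> x) \<in> F ` carrier ?V"
      unfolding im using that Tan PF.subspace_scale[OF subspace_Tan[OF nf]] by blast
    then obtain \<xi> where \<xi>: "\<xi> \<in> carrier ?V" "F \<xi> = (\<lambda>x. Const c * F \<phi> x)" by auto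
    have "c \<odot>\<^bsub>?V\<^esub> \<phi> = \<xi>"
    proof (rule extensionalityI[of _ I])
      fix f assume f: "f \<in> I"
      have "coset_nf nf ((c \<odot>\<^bsub>?V\<^esub> \<phi>) f) = coset_nf nf (\<xi> f)"
        using FI[OF f] F \<xi>(2) by metis
      moreover have "(c \<odot>\<^bsub>?V\<^esub> \<phi>) f \<in> carrier ?Q" using f that by (simp add: ops car Qsmult)
      moreover have "\<xi> f \<in> carrier ?Q" using f \<xi> by (simp add: car)
      ultimately show "(c \<odot>\<^bsub>?V\<^esub> \<phi>) f = \<xi> f" using QI by metis
    qed (use \<xi> car in \<open>auto simp: ops\<close>)
    then show "c \<odot>\<^bsub>?V\<^esub> \<phi> \<in> carrier ?V" using \<xi> by simp
  qed
  have "dim_over_k (tangent_space I) = PF.dim (F ` carrier ?V)"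
    by (rule PF.record_vectorspace(3)[of F ?V, OF inj _ zero add smult])
      (simp_all add: im subspace_Tan[OF nf] fd_Tan[OF nf I B])
  then show ?thesis unfolding im .
qed

lemma exhaust_three: "x = 0 \<or> x = 1 \<or> x = (2::3)"
proof (cases x rule: bit1_cases)
  case (of_int z)
  then have "z = 0 \<or> z = 1 \<or> z = 2" by auto
  then show ?thesis using of_int by auto
qed

locale cofinite_normal_form =
  fixes I :: "'k::field poly3 set" and B nf
  assumes nf: "normal_form I B nf" and I: "is_ideal I" and B: "finite B"
begin

lemmas lin = nf_klin[OF nf]

definition pol :: "((3 \<Rightarrow>\<^sub>0 nat) \<Rightarrow> 'k) \<Rightarrow> 'k poly3" where
  "pol v = (\<Sum>a\<in>B. Const (v a) * monomial a)"

lemma lookup_pol: "lookup (pol v) a = (if a \<in> B then v a else 0)"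
proof -
  have "lookup (pol v) a = (\<Sum>b\<in>B. if b = a then v b else 0)"
    unfolding pol_def lookup_sum
    by (rule sum.cong) (auto simp: lookup_Const_mult lookup_monomial)
  then show ?thesis using B by simp
qed

lemma keys_pol: "keys (pol v) \<subseteq> B"
  by (auto simp: in_keys_iff lookup_pol split: if_splits)

lemma lookup_nf: "a \<notin> B \<Longrightarrow> lookup (nf p) a = 0"
  using nf_keys[OF nf, of p] by (auto simp: in_keys_iff)

lemma pol_lookup: "pol (lookup (nf p)) = nf p"
  by (rule poly_mapping_eqI) (simp add: lookup_pol lookup_nf)

lemma nf_expand:
  assumes "klin f"
  shows "f (nf p) = (\<Sum>b\<in>B. Const (lookup (nf p) b) * f (monomial b))"
  by (subst pol_lookup[symmetric]) (simp add: pol_def klin_sum klin_scale assms)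

end

section \<open>Deformations of the commuting multiplication operators\<close>

lemma funpow_commute:
  assumes "\<And>x. f (g x) = g (f x)"
  shows "f ((g ^^ n) x) = (g ^^ n) (f x)"
  by (induction n) (simp_all add: assms)

text \<open>\<open>W m\<close> is the monomial with exponent \<open>m\<close> in the operators,
  applied to \<open>v\<close>; by commutation the order of the factors does not matter.\<close>

lemma commuting_power_products:
  fixes X :: "3 \<Rightarrow> 'v \<Rightarrow> 'v"
  assumes "\<And>i j v. X i (X j v) = X j (X i v)"
  shows "\<exists>W. W 0 = v \<and> (\<forall>m i. W (m + Poly_Mapping.single i (1::nat)) = X i (W m))"
proof -
  note c = funpow_commute[of "X _" "X _", OF assms]
  define W where "W = (\<lambda>m :: 3 \<Rightarrow>\<^sub>0 nat. (X 0 ^^ lookup m 0) ((X 1 ^^ lookup m 1) ((X 2 ^^ lookup m 2) v)))"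
  have "W (m + Poly_Mapping.single i 1) = X i (W m)" for m and i :: 3
    using exhaust_three[of i] by (auto simp: W_def lookup_add lookup_single c)
  then show ?thesis by (intro exI[of _ W]) (simp add: W_def)
qed

context cofinite_normal_form
begin

text \<open>\<open>g (i, a, b)\<close> is row \<open>a\<close>, column \<open>b\<close> of the
  matrix of P_i. Acting on \<open>nf p\<close> makes the operator depend only on the class of
  \<open>p\<close>.\<close>

definition op :: "(3 \<times> (3 \<Rightarrow>\<^sub>0 nat) \<times> (3 \<Rightarrow>\<^sub>0 nat) \<Rightarrow> 'k) \<Rightarrow> 3 \<Rightarrow> 'k poly3 \<Rightarrow> 'k poly3" where
  "op g i p = (\<Sum>b\<in>B. Const (lookup (nf p) b) * pol (\<lambda>a. g (i, a, b)))"

lemma klin_op: "klin (op g i)"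
proof -
  have "op g i (p + q) = op g i p + op g i q" for p q
    by (simp add: op_def klin_add[OF lin] lookup_add Const_simps(1) distrib_right sum.distrib)
  moreover have "op g i (Const c * p) = Const c * op g i p" for c p
    unfolding op_def klin_scale[OF lin] lookup_Const_mult Const_simps(2) sum_distrib_left mult.assoc ..
  ultimately show ?thesis by (simp add: klin_def)
qed

lemma op_nf: "op g i (nf p) = op g i p"
  by (simp add: op_def nf_nf[OF nf])

lemma op_cong: "nf p = nf q \<Longrightarrow> op g i p = op g i q"
  by (simp add: op_def)

lemma lookup_op: "a \<in> B \<Longrightarrow> lookup (op g i p) a = (\<Sum>b\<in>B. lookup (nf p) b * g (i, a, b))"
  by (simp add: op_def lookup_sum lookup_Const_mult lookup_pol)

lemma nf_op: "nf (op g i p) = op g i p"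
proof (rule nf_id[OF nf])
  show "keys (op g i p) \<subseteq> B"
    by (auto simp: in_keys_iff op_def lookup_sum lookup_Const_mult lookup_pol intro: ccontr)
qed

lemma op_monomial: "b \<in> B \<Longrightarrow> op g i (monomial b) = pol (\<lambda>a. g (i, a, b))"
proof -
  assume b: "b \<in> B"
  have n: "nf (monomial b) = monomial b"
    by (rule nf_id[OF nf]) (use b in \<open>simp add: monomial_def\<close>)
  have "op g i (monomial b) = (\<Sum>c\<in>B. if c = b then pol (\<lambda>a. g (i, a, c)) else 0)"
    unfolding op_def n by (rule sum.cong) (auto simp: lookup_monomial Const_simps)
  then show ?thesis using b B by simp
qed

definition X :: "3 \<Rightarrow> (3 \<Rightarrow>\<^sub>0 nat) \<Rightarrow> (3 \<Rightarrow>\<^sub>0 nat) \<Rightarrow> 'k" where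
  "X i a b = lookup (nf (var i * monomial b)) a"

text \<open>The commutator [X_i, P_j] on the quotient; \<open>ent\<close> is its matrix.\<close>

definition comm where
  "comm g i j p = nf (var i * op g j p) - op g j (var i * p)"

definition ent where
  "ent g i j a b = (\<Sum>c\<in>B. X i a c * g (j, c, b)) - (\<Sum>c\<in>B. g (j, a, c) * X i c b)"

lemma lookup_comm:
  assumes "a \<in> B" "b \<in> B"
  shows "lookup (comm g i j (monomial b)) a = ent g i j a b"
proof -
  have "nf (var i * op g j (monomial b)) = (\<Sum>c\<in>B. Const (g (j, c, b)) * nf (var i * monomial c))"
    by (simp add: op_monomial assms pol_def sum_distrib_left mult.left_commute[of "var i"]
        klin_sum[OF lin] klin_scale[OF lin])
  then show ?thesis
    using assms by (simp add: comm_def ent_def lookup_minus lookup_op lookup_sum lookup_Const_mult X_def mult.commute[of "g _"])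
qed

lemma klin_comm: "klin (comm g i j)"
  by (simp add: klin_def comm_def klin_add[OF lin] klin_scale[OF lin] klin_add[OF klin_op] klin_scale[OF klin_op]
      distrib_left mult.left_commute[of "var i"] right_diff_distrib)

lemma comm_nf: "comm g i j (nf p) = comm g i j p"
  using op_cong[of "var i * nf p" "var i * p"] by (simp add: comm_def op_nf nf_mult_nf[OF nf I])

lemma comm_eq_iff:
  "(\<forall>p. comm g i j p = comm g j i p) \<longleftrightarrow> (\<forall>a\<in>B. \<forall>b\<in>B. ent g i j a b = ent g j i a b)"
proof
  assume "\<forall>p. comm g i j p = comm g j i p"
  then show "\<forall>a\<in>B. \<forall>b\<in>B. ent g i j a b = ent g j i a b"
    by (metis lookup_comm)
next
  assume e: "\<forall>a\<in>B. \<forall>b\<in>B. ent g i j a b = ent g j i a b"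
  have b: "comm g i j (monomial b) = comm g j i (monomial b)" if "b \<in> B" for b
  proof (rule poly_mapping_eqI)
    fix a
    have "lookup (comm g k l p) a = 0" if "a \<notin> B" for k l p
    proof -
      have "lookup (op g l (var k * p)) a = 0"
        using lookup_nf[OF that, of "op g l (var k * p)"] by (simp add: nf_op)
      then show ?thesis using that by (simp add: comm_def lookup_minus lookup_nf)
    qed
    then show "lookup (comm g i j (monomial b)) a = lookup (comm g j i (monomial b)) a"
      using e that by (cases "a \<in> B") (simp_all add: lookup_comm)
  qed
  show "\<forall>p. comm g i j p = comm g j i p"
  proof
    fix p
    have "comm g i j (nf p) = comm g j i (nf p)"
      unfolding nf_expand[OF klin_comm] by (rule sum.cong) (simp_all add: b)
    then show "comm g i j p = comm g j i p" by (simp add: comm_nf)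
  qed
qed

text \<open>The condition [X_i, P_j] = [X_j, P_i] is the vanishing of the coefficient of t in the
  commutator of X_i + t P_i and X_j + t P_j. Equivalently, sending x_i to P_i defines a derivation
  from S to the endomorphisms of the quotient, a 1-cocycle.\<close>

definition Z1 where
  "Z1 = {g \<in> supp (UNIV \<times> B \<times> B). \<forall>i j. \<forall>a\<in>B. \<forall>b\<in>B. ent g i j a b = ent g j i a b}"

lemma Z1_iff: "g \<in> Z1 \<longleftrightarrow> g \<in> supp (UNIV \<times> B \<times> B) \<and> (\<forall>i j p. comm g i j p = comm g j i p)"
  unfolding Z1_def by (auto simp: comm_eq_iff[symmetric])

text \<open>The failure of \<open>\<psi>\<close> to commute with x_i. Elements of \<open>Ext\<close>
  are linear over S on \<open>I\<close>, so for them it vanishes on \<open>I\<close> and induces an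
  endomorphism of the quotient.\<close>

definition dP where
  "dP \<psi> i p = \<psi> (var i * p) - nf (var i * \<psi> p)"

definition mat where
  "mat \<psi> = (\<lambda>(i, a, b). if a \<in> B \<and> b \<in> B then lookup (nf (\<psi> (var i * monomial b) - var i * \<psi> (monomial b))) a else 0)"

lemma linear_mat: "Vector_Spaces.linear (\<lambda>c g x. Const c * g x) (\<lambda>c g x. c * g x) mat"
proof (rule PFKF_linearI)
  show "mat (\<lambda>x. g x + h x) = (\<lambda>y. mat g y + mat h y)" for g h
  proof
    fix y :: "3 \<times> (3 \<Rightarrow>\<^sub>0 nat) \<times> (3 \<Rightarrow>\<^sub>0 nat)"
    obtain i a b where y: "y = (i, a, b)" by (cases y)
    show "mat (\<lambda>x. g x + h x) y = mat g y + mat h y"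
      by (simp add: mat_def y klin_add[OF lin] klin_diff[OF lin] lookup_add lookup_minus distrib_left)
  qed
  show "mat (\<lambda>x. Const c * g x) = (\<lambda>y. c * mat g y)" for c g
  proof
    fix y :: "3 \<times> (3 \<Rightarrow>\<^sub>0 nat) \<times> (3 \<Rightarrow>\<^sub>0 nat)"
    obtain i a b where y: "y = (i, a, b)" by (cases y)
    have "Const c * g p - var i * (Const c * q) = Const c * (g p - var i * q)" for p q
      by (simp add: right_diff_distrib mult.left_commute)
    then show "mat (\<lambda>x. Const c * g x) y = c * mat g y"
      by (simp add: mat_def y klin_scale[OF lin] lookup_Const_mult)
  qed
qed

context
  fixes \<psi>
  assumes \<psi>: "\<psi> \<in> Ext I nf"
begin

lemma klin_dP: "klin (dP \<psi> i)"
proof -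
  note l = Ext_klin[OF \<psi>]
  have "\<psi> (var i * (Const c * p)) = Const c * \<psi> (var i * p)" for c p
    using klin_scale[OF l, of c "var i * p"] by (simp add: mult.left_commute)
  moreover have "nf (var i * (Const c * p)) = Const c * nf (var i * p)" for c p
    using klin_scale[OF lin, of c "var i * p"] by (simp add: mult.left_commute)
  ultimately show ?thesis
    by (simp add: klin_def dP_def klin_add[OF l] klin_scale[OF l] klin_add[OF lin] distrib_left
        right_diff_distrib)
qed

lemma dP_ideal: "f \<in> I \<Longrightarrow> dP \<psi> i f = 0"
  by (simp add: dP_def Ext_mult[OF \<psi>])

lemma dP_nf: "dP \<psi> i (nf p) = dP \<psi> i p"
  using dP_ideal[OF nf_diff(1)[OF nf, of p], of i] by (simp add: klin_diff[OF klin_dP])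

lemma nf_dP: "nf (dP \<psi> i p) = dP \<psi> i p"
  by (simp add: dP_def klin_diff[OF lin] Ext_nf[OF \<psi>] nf_nf[OF nf])

lemma mat_dP: "a \<in> B \<Longrightarrow> b \<in> B \<Longrightarrow> mat \<psi> (i, a, b) = lookup (dP \<psi> i (monomial b)) a"
  by (simp add: mat_def dP_def klin_diff[OF lin] Ext_nf[OF \<psi>])

lemma op_mat: "op (mat \<psi>) i p = dP \<psi> i p"
proof -
  have "op (mat \<psi>) i (nf p) = dP \<psi> i (nf p)"
    unfolding nf_expand[OF klin_op] nf_expand[OF klin_dP]
  proof (rule sum.cong[OF refl])
    fix b assume b: "b \<in> B"
    have "op (mat \<psi>) i (monomial b) = dP \<psi> i (monomial b)"
    proof (rule poly_mapping_eqI)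
      fix a
      show "lookup (op (mat \<psi>) i (monomial b)) a = lookup (dP \<psi> i (monomial b)) a"
        using lookup_nf[of a "dP \<psi> i (monomial b)"] b
        by (cases "a \<in> B") (auto simp: op_monomial lookup_pol mat_dP nf_dP)
    qed
    then show "Const (lookup (nf p) b) * op (mat \<psi>) i (monomial b) =
        Const (lookup (nf p) b) * dP \<psi> i (monomial b)" by simp
  qed
  then show ?thesis by (simp add: op_nf dP_nf)
qed

lemma mat_in_Z1: "mat \<psi> \<in> Z1"
  unfolding Z1_iff
proof (intro conjI allI)
  show "mat \<psi> \<in> supp (UNIV \<times> B \<times> B)" by (auto simp: supp_def mat_def)
  have "comm (mat \<psi>) i j p = nf (var i * \<psi> (var j * p)) + nf (var j * \<psi> (var i * p))
      - nf (var i * (var j * \<psi> p)) - \<psi> (var j * (var i * p))" for i j p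
    by (simp add: comm_def op_mat dP_def right_diff_distrib klin_diff[OF lin] nf_mult_nf[OF nf I])
  then show "comm (mat \<psi>) i j p = comm (mat \<psi>) j i p" for i j p
    by (simp add: mult.left_commute)
qed

text \<open>If all \<open>dP\<close> vanish, then \<open>\<psi>\<close> commutes with the variables,
  so it is linear over S and determined by its value at 1.\<close>

lemma mat_eq_0D:
  assumes "mat \<psi> = 0"
  shows "\<psi> p = nf (p * \<psi> 1)"
proof -
  have 0: "\<psi> (var i * q) = nf (var i * \<psi> q)" for i q
    using op_mat[of i q] by (simp add: assms op_def pol_def Const_simps dP_def)
  note l = Ext_klin[OF \<psi>]
  show ?thesis
  proof (induction p rule: poly3_induct)
    case (Const c)
    then show ?case using klin_scale[OF l, of c 1] by (simp add: klin_scale[OF lin] Ext_nf[OF \<psi>])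
  next
    case (var i p)
    then show ?case by (simp add: 0 nf_mult_nf[OF nf I] mult.assoc)
  qed (simp_all add: klin_0 klin_add l lin distrib_right)
qed

end

text \<open>The operators X_i + t P_i commute modulo t^2, so they make the pairs u + t v of normal
  forms a module over S. Applying the monomials to the class of 1 and reading off the coefficient of
  t yields a preimage \<open>\<psi>\<close> of \<open>g\<close>.\<close>

lemma Z1_subset_mat:
  assumes g: "g \<in> Z1"
  shows "g \<in> mat ` Ext I nf"
proof -
  \<comment> \<open>The pair \<open>(u, v)\<close> stands for u + t v, and \<open>Xh i\<close> for
    X_i + t P_i modulo t^2.\<close>
  define Xh where "Xh = (\<lambda>i (u, v). (nf (var i * u), nf (var i * v) + op g i u))"
  have "Xh i (Xh j w) = Xh j (Xh i w)" for i j w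
  proof -
    obtain u v where w: "w = (u, v)" by (cases w)
    have "nf (var i * op g j u) + op g i (var j * u) = nf (var j * op g i u) + op g j (var i * u)"
    proof -
      have "comm g i j u = comm g j i u" using g unfolding Z1_iff by blast
      then show ?thesis by (simp add: comm_def algebra_simps)
    qed
    then show ?thesis
      by (simp add: w Xh_def klin_add[OF lin] distrib_left nf_mult_nf[OF nf I] op_nf add.assoc mult.left_commute)
  qed
  from commuting_power_products[of Xh, OF this, of "(nf 1, 0)"]
  obtain W :: "(3 \<Rightarrow>\<^sub>0 nat) \<Rightarrow> 'k poly3 \<times> 'k poly3" where W': "W 0 = (nf 1, 0) \<and> (\<forall>m i. W (m + Poly_Mapping.single i 1) = Xh i (W m))"
    by (rule exE)
  then have W0: "W 0 = (nf 1, 0)" and W: "W (m + Poly_Mapping.single i 1) = Xh i (W m)" for m i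
    by simp_all
  define \<psi> where "\<psi> = PP.construct (range monomial) (\<lambda>q. snd (W (SOME m. monomial m = q)))"
  have l: "klin \<psi>"
    unfolding klin_linear \<psi>_def by (rule PP.linear_construct[OF independent_monomials])
  have some: "(SOME n. monomial n = (monomial m :: 'k poly3)) = m" for m
    by (rule some_equality) (auto, metis lookup_monomial zero_neq_one)
  have \<psi>m: "\<psi> (monomial m) = snd (W m)" for m
    unfolding \<psi>_def by (subst PP.construct_basis[OF independent_monomials]) (simp_all add: some)
  have mon: "monomial (m + Poly_Mapping.single i 1) = var i * monomial m" for m i
    by (simp add: var_def monomial_mult add.commute)
  have fst: "fst (W m) = nf (monomial m)" for m
  proof (induction m rule: exponent_induct)
    case zero
    show ?case by (simp add: W0 monomial_0)
  next
    case (add m i)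
    then show ?case unfolding W mon by (simp add: Xh_def split_beta nf_mult_nf[OF nf I])
  qed
  \<comment> \<open>The coefficient of t obeys a product rule, which says that
    \<open>dP \<psi> i\<close> is the prescribed operator \<open>op g i\<close>.\<close>
  have rec: "\<psi> (var i * p) = nf (var i * \<psi> p) + op g i p" for i p
  proof -
    have kl: "klin (\<lambda>p. \<psi> (var i * p))"
      using klin_scale[OF l, of _ "var i * _"]
      by (simp add: klin_def klin_add[OF l] distrib_left mult.left_commute)
    have kr: "klin (\<lambda>p. nf (var i * \<psi> p) + op g i p)"
      using klin_scale[OF lin, of _ "var i * _"]
      by (simp add: klin_def klin_add[OF l] klin_add[OF lin] klin_scale[OF l] klin_add[OF klin_op]
        klin_scale[OF klin_op] distrib_left mult.left_commute)
    show ?thesis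
    proof (rule klin_eqI[OF kl kr])
      fix m
      have "\<psi> (var i * monomial m) = snd (Xh i (W m))"
        unfolding mon[symmetric] \<psi>m W ..
      then show "\<psi> (var i * monomial m) = nf (var i * \<psi> (monomial m)) + op g i (monomial m)"
        by (simp add: Xh_def split_beta fst op_nf \<psi>m)
    qed
  qed
  have nf\<psi>: "nf (\<psi> p) = \<psi> p" for p
  proof (induction p rule: poly3_induct)
    case (Const c)
    have "\<psi> 1 = 0" using \<psi>m[of 0] by (simp add: W0 monomial_0)
    then show ?case using klin_scale[OF l, of c 1] by (simp add: klin_0[OF lin])
  next
    case (var i p)
    then show ?case by (simp add: rec klin_add[OF lin] nf_nf[OF nf] nf_op)
  qed (simp_all add: klin_0 klin_add l lin)
  have op0: "op g i f = 0" if "f \<in> I" for i f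
    using op_cong[of f 0] that nf_eq_0[OF nf, of f] by (simp add: klin_0 klin_op lin)
  have "\<psi> (s * f) = nf (s * \<psi> f)" if f: "f \<in> I" for s f
  proof (induction s rule: poly3_induct)
    case (Const c)
    then show ?case by (simp add: klin_scale[OF l] klin_scale[OF lin] nf\<psi>)
  next
    case (var i s)
    have "op g i (s * f) = 0" using op0 is_idealD(3)[OF I f] by blast
    then show ?case by (simp add: var rec mult.assoc nf_mult_nf[OF nf I])
  qed (simp_all add: klin_0 klin_add l lin distrib_right)
  then have E: "\<psi> \<in> Ext I nf" using l nf\<psi> by (simp add: Ext_def)
  have "mat \<psi> = g"
  proof
    fix y :: "3 \<times> (3 \<Rightarrow>\<^sub>0 nat) \<times> (3 \<Rightarrow>\<^sub>0 nat)"
    obtain i a b where y: "y = (i, a, b)" by (cases y)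
    show "mat \<psi> y = g y"
    proof (cases "a \<in> B \<and> b \<in> B")
      case True
      then have "mat \<psi> y = lookup (op g i (monomial b)) a"
        by (simp add: y mat_dP[OF E] dP_def rec)
      then show ?thesis using True by (simp add: op_monomial lookup_pol y)
    next
      case False
      then show ?thesis using g by (auto simp: y mat_def Z1_def supp_def)
    qed
  qed
  then show ?thesis using E by blast
qed

text \<open>Exact sequence 0 -> A -> Ext -> Z1 -> 0 with A the quotient: the kernel of
  \<open>mat\<close> consists of the maps sending p to the class of p c, and c is recovered as the
  value at 1.\<close>

lemma dim_Ext_Z1: "PF.dim (Ext I nf) = KF.dim Z1 + card B"
proof -
  have im: "mat ` Ext I nf = Z1"
    using Z1_subset_mat mat_in_Z1 by blast
  let ?K = "{\<psi> \<in> Ext I nf. mat \<psi> = 0}"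
  note sub = PFKF.subspace_kernel_on[OF linear_mat subspace_Ext[OF nf]]
  define h :: "('k poly3 \<Rightarrow> 'k poly3) \<Rightarrow> (3 \<Rightarrow>\<^sub>0 nat) \<Rightarrow> 'k" where "h = (\<lambda>\<psi>. lookup (\<psi> 1))"
  have h: "Vector_Spaces.linear (\<lambda>c g x. Const c * g x) (\<lambda>c g x. c * g x) h"
    by (rule PFKF_linearI) (auto simp: h_def fun_eq_iff lookup_add lookup_Const_mult)
  have inj: "inj_on h ?K"
    unfolding PFKF.linear_inj_on_iff_eq_0[OF h sub]
  proof (intro ballI impI)
    fix \<psi> assume \<psi>: "\<psi> \<in> ?K" and "h \<psi> = 0"
    then have "\<psi> 1 = 0" by (intro poly_mapping_eqI) (simp add: h_def fun_eq_iff)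
    then show "\<psi> = 0" using \<psi> mat_eq_0D[of \<psi>] by (simp add: fun_eq_iff klin_0[OF lin])
  qed
  have "h ` ?K = supp B"
  proof (intro equalityI subsetI)
    fix v assume "v \<in> h ` ?K"
    then obtain \<psi> where "\<psi> \<in> Ext I nf" "v = h \<psi>" by blast
    then show "v \<in> supp B" using lookup_nf[of _ "\<psi> 1"] by (auto simp: supp_def h_def Ext_nf)
  next
    fix v :: "(3 \<Rightarrow>\<^sub>0 nat) \<Rightarrow> 'k" assume v: "v \<in> supp B"
    define \<psi> where "\<psi> = (\<lambda>p. nf (p * pol v))"
    have nfpol: "nf (pol v) = pol v" by (rule nf_id[OF nf keys_pol])
    have "\<psi> \<in> Ext I nf"
    proof -
      have "nf (Const c * p * pol v) = Const c * nf (p * pol v)" for c p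
        using klin_scale[OF lin, of c "p * pol v"] by (simp add: mult.assoc)
      then show ?thesis
        by (simp add: Ext_def \<psi>_def klin_def klin_add[OF lin] distrib_right nf_nf[OF nf] nf_mult_nf[OF nf I] mult.assoc)
    qed
    moreover have "mat \<psi> = 0"
      by (auto simp: mat_def \<psi>_def fun_eq_iff klin_diff[OF lin] nf_nf[OF nf] nf_mult_nf[OF nf I] mult.assoc)
    moreover have "h \<psi> = v"
      using v by (auto simp: h_def \<psi>_def nfpol lookup_pol fun_eq_iff supp_def)
    ultimately show "v \<in> h ` ?K" by blast
  qed
  then have "PF.dim ?K = card B"
    using PFKF.dim_image_inj_on[OF h sub inj] supp_dim(1)[OF B, where 'k='k] by simp
  then show ?thesis
    using PFKF.rank_nullity[OF linear_mat subspace_Ext[OF nf] fd_Ext[OF nf I B]] im by simp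
qed

text \<open>Exact sequence 0 -> Tan -> Ext -> End(A) -> 0, given by restriction to the complement of
  \<open>I\<close>. It is onto because an endomorphism of A, composed with the projection, vanishes
  on \<open>I\<close> and so belongs to \<open>Ext\<close>.\<close>

lemma dim_Ext_Tan: "PF.dim (Ext I nf) = PF.dim (Tan I nf) + card B * card B"
proof -
  define f :: "('k poly3 \<Rightarrow> 'k poly3) \<Rightarrow> 'k poly3 \<Rightarrow> 'k poly3" where "f = (\<lambda>\<psi> p. \<psi> (nf p))"
  have f: "Vector_Spaces.linear (\<lambda>c g x. Const c * g x) (\<lambda>c g x. Const c * g x) f"
    by (rule PFPF_linearI) (auto simp: f_def)
  have ker: "{\<psi> \<in> Ext I nf. f \<psi> = 0} = Tan I nf"
    by (auto simp: Tan_def f_def fun_eq_iff)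
  define E where "E = {m. klin m \<and> (\<forall>p. nf (m p) = m p) \<and> (\<forall>p. m (nf p) = m p)}"
  have im: "f ` Ext I nf = E"
  proof (intro equalityI subsetI)
    fix m assume "m \<in> f ` Ext I nf"
    then obtain \<psi> where \<psi>: "\<psi> \<in> Ext I nf" "m = f \<psi>" by blast
    show "m \<in> E"
      using Ext_klin[OF \<psi>(1)] lin by (auto simp: E_def \<psi>(2) f_def klin_def Ext_nf[OF \<psi>(1)] nf_nf[OF nf])
  next
    fix m assume m: "m \<in> E"
    have "m g = 0" if "g \<in> I" for g
      using that m nf_eq_0[OF nf, of g] klin_0[of m] by (auto simp: E_def) metis
    then have "m \<in> Ext I nf"
      using m is_idealD(3)[OF I] by (auto simp: E_def Ext_def klin_0[OF lin])
    moreover have "f m = m" using m by (simp add: f_def E_def)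
    ultimately show "m \<in> f ` Ext I nf" by (metis rev_image_eqI)
  qed
  have sub: "PF.subspace E"
    unfolding im[symmetric] by (rule PFPF.linear_subspace_image[OF f subspace_Ext[OF nf]])
  define h where "h = (\<lambda>(m :: 'k poly3 \<Rightarrow> 'k poly3) (a, b). if b \<in> B then lookup (m (monomial b)) a else 0)"
  have h: "Vector_Spaces.linear (\<lambda>c g x. Const c * g x) (\<lambda>c g x. c * g x) h"
    by (rule PFKF_linearI) (auto simp: h_def fun_eq_iff lookup_add lookup_Const_mult)
  have inj: "inj_on h E"
    unfolding PFKF.linear_inj_on_iff_eq_0[OF h sub]
  proof (intro ballI impI)
    fix m assume m: "m \<in> E" and h0: "h m = 0"
    have b: "m (monomial b) = 0" if "b \<in> B" for b
    proof (rule poly_mapping_eqI)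
      fix a
      have "h m (a, b) = 0" by (simp add: h0)
      then show "lookup (m (monomial b)) a = lookup 0 a" using that by (simp add: h_def)
    qed
    have "m p = 0" for p
    proof -
      have "m p = m (nf p)" using m by (simp add: E_def)
      also have "\<dots> = 0" using m by (subst nf_expand) (simp_all add: E_def b)
      finally show ?thesis .
    qed
    then show "m = 0" by (simp add: fun_eq_iff)
  qed
  have "h ` E = supp (B \<times> B)"
  proof (intro equalityI subsetI)
    fix v assume "v \<in> h ` E"
    then obtain m where m: "m \<in> E" "v = h m" by blast
    have "lookup (m p) a = 0" if "a \<notin> B" for a p
      using lookup_nf[OF that, of "m p"] m by (simp add: E_def)
    then show "v \<in> supp (B \<times> B)" by (auto simp: m(2) supp_def h_def)
  next
    fix v :: "(3 \<Rightarrow>\<^sub>0 nat) \<times> (3 \<Rightarrow>\<^sub>0 nat) \<Rightarrow> 'k" assume v: "v \<in> supp (B \<times> B)"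
    \<comment> \<open>\<open>op\<close> is reused, with index 0, to turn a single matrix into an
      endomorphism.\<close>
    define m where "m = op (\<lambda>(i, a, b). v (a, b)) 0"
    have "m \<in> E" by (simp add: E_def m_def klin_op nf_op op_nf)
    moreover have "h m = v"
      using v by (auto simp: h_def m_def op_monomial lookup_pol fun_eq_iff supp_def)
    ultimately show "v \<in> h ` E" by blast
  qed
  then have "PF.dim E = card B * card B"
    using PFKF.dim_image_inj_on[OF h sub inj] supp_dim(1)[of "B \<times> B", where 'k='k] B
    by (simp add: card_cartesian_product)
  then show ?thesis
    using PFPF.rank_nullity[OF f subspace_Ext[OF nf] fd_Ext[OF nf I B]] im ker by simp
qed

end

section \<open>Regular sequences of length three are cofinite\<close>

definition box :: "nat \<Rightarrow> (3 \<Rightarrow>\<^sub>0 nat) set" where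
  "box n = {m. \<forall>i. lookup m i \<le> n}"

lemma box_card: "finite (box n)" "card (box n) \<le> (n + 1) ^ 3"
proof -
  let ?f = "\<lambda>m :: 3 \<Rightarrow>\<^sub>0 nat. (lookup m 0, lookup m 1, lookup m 2)"
  have inj: "inj_on ?f (box n)"
  proof (rule inj_onI, rule poly_mapping_eqI)
    fix m m' i assume "?f m = ?f m'"
    then show "lookup m i = lookup m' i" using exhaust_three[of i] by auto
  qed
  have sub: "?f ` box n \<subseteq> {..n} \<times> {..n} \<times> {..n}" by (auto simp: box_def)
  show "finite (box n)" by (rule inj_on_finite[OF inj sub]) simp
  have "card (box n) \<le> card ({..n} \<times> {..n} \<times> {..n})"
    by (rule card_inj_on_le[OF inj sub]) simp
  also have "\<dots> = (n + 1) ^ 3"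
    by (simp add: card_cartesian_product power3_eq_cube algebra_simps)
  finally show "card (box n) \<le> (n + 1) ^ 3" .
qed

lemma box_mult:
  assumes "keys p \<subseteq> box a" "keys q \<subseteq> box b"
  shows "keys (p * q) \<subseteq> box (a + b)"
proof
  fix m assume "m \<in> keys (p * q)"
  then obtain u v where "u \<in> keys p" "v \<in> keys q" "m = u + v" using keys_mult by blast
  then show "m \<in> box (a + b)"
    using assms by (auto simp: box_def lookup_add subset_iff add_mono)
qed

lemma box_mono: "a \<le> b \<Longrightarrow> box a \<subseteq> box b"
  by (auto simp: box_def intro: order_trans)

lemma box_power: "keys p \<subseteq> box a \<Longrightarrow> keys (p ^ n) \<subseteq> box (a * n)"
proof (induction n)
  case 0
  then show ?case by (simp add: box_def)
next
  case (Suc n)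
  then show ?case using box_mult[of p a "p ^ n" "a * n"] by simp
qed

lemma in_box: "\<exists>n. keys p \<subseteq> box n"
proof -
  have "lookup m i \<le> (\<Sum>m\<in>keys p. \<Sum>i\<in>UNIV. lookup m i)" if "m \<in> keys p" for m i
  proof -
    have "lookup m i \<le> (\<Sum>i\<in>UNIV. lookup m i)" by (rule member_le_sum) auto
    also have "\<dots> \<le> (\<Sum>m\<in>keys p. \<Sum>i\<in>UNIV. lookup m i)"
      using that by (intro member_le_sum[of m "keys p" "\<lambda>m. \<Sum>i\<in>UNIV. lookup m i"]) auto
    finally show ?thesis .
  qed
  then show ?thesis by (auto simp: box_def intro!: exI[of _ "\<Sum>m\<in>keys p. \<Sum>i\<in>UNIV. lookup m i"])
qed

lemma linear_relation:
  fixes f :: "'t \<Rightarrow> 'k::field poly3"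
  assumes T: "finite T" and W: "finite W" and f: "f ` T \<subseteq> P.span W" and c: "card W < card T"
  shows "\<exists>u. (\<Sum>t\<in>T. Const (u t) * f t) = 0 \<and> (\<exists>t\<in>T. u t \<noteq> 0)"
proof (cases "inj_on f T")
  case True
  then have "card (f ` T) > card W" using c by (simp add: card_image)
  then have "P.dependent (f ` T)" using P.independent_span_bound[OF W _ f] by auto
  then obtain u where u: "\<exists>v\<in>f ` T. u v \<noteq> 0" "(\<Sum>v\<in>f ` T. Const (u v) * v) = 0"
    using P.dependent_finite[of "f ` T"] T by auto
  then show ?thesis using True by (intro exI[of _ "u \<circ> f"]) (auto simp: sum.reindex)
next
  case False
  then obtain s t where st: "s \<in> T" "t \<in> T" "s \<noteq> t" "f s = f t" by (auto simp: inj_on_def)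
  define u where "u = (\<lambda>x. if x = s then 1 else if x = t then -1 else (0::'k))"
  have "(\<Sum>x\<in>T. Const (u x) * f x) = (\<Sum>x\<in>{s, t}. Const (u x) * f x)"
    by (rule sum.mono_neutral_right) (use T st in \<open>auto simp: u_def Const_simps\<close>)
  then show ?thesis using st by (intro exI[of _ u]) (auto simp: u_def Const_simps)
qed

text \<open>There are (N + 1)^4 products with exponents at most N, but the number of monomials
  occurring in them grows only like N^3.\<close>

lemma algebraic_dependence:
  fixes p a1 a2 a3 :: "'k::field poly3"
  shows "\<exists>N u. (\<Sum>(i, j, k, l)\<in>{..N} \<times> {..N} \<times> {..N} \<times> {..N}. Const (u i j k l) * (p ^ i * a1 ^ j * a2 ^ k * a3 ^ l)) = 0 \<and>
    (\<exists>i\<le>N. \<exists>j\<le>N. \<exists>k\<le>N. \<exists>l\<le>N. u i j k l \<noteq> 0)"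
proof -
  obtain e0 e1 e2 e3 where "keys p \<subseteq> box e0" "keys a1 \<subseteq> box e1" "keys a2 \<subseteq> box e2" "keys a3 \<subseteq> box e3"
    using in_box by metis
  \<comment> \<open>The summand 1 makes \<open>e\<close> positive, which is needed for D + 1 <= 4 e
    (N + 1).\<close>
  moreover define e where "e = e0 + e1 + e2 + e3 + 1"
  ultimately have e: "keys p \<subseteq> box e" "keys a1 \<subseteq> box e" "keys a2 \<subseteq> box e" "keys a3 \<subseteq> box e"
    using box_mono[of e0 e] box_mono[of e1 e] box_mono[of e2 e] box_mono[of e3 e] by auto
  \<comment> \<open>Chosen so that (4 e (N + 1))^3 = N (N + 1)^3, which is just below the number (N
    + 1)^4 of products.\<close>
  define N where "N = (4 * e) ^ 3"
  define T where "T = {..N} \<times> {..N} \<times> {..N} \<times> {..N}"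
  define f where "f = (\<lambda>(i, j, k, l). p ^ i * a1 ^ j * a2 ^ k * a3 ^ l)"
  define D where "D = 4 * e * N"
  have "keys (f t) \<subseteq> box D" if "t \<in> T" for t
  proof -
    obtain i j k l where t1: "t = (i, j, k, l)" by (cases t rule: prod_cases4)
    with that have t: "t = (i, j, k, l)" "i \<le> N" "j \<le> N" "k \<le> N" "l \<le> N"
      by (simp_all add: T_def)
    have "keys (f t) \<subseteq> box (e * i + e * j + e * k + e * l)"
      by (simp add: f_def t(1) box_mult box_power e)
    also have "\<dots> \<subseteq> box D"
    proof (rule box_mono)
      have "e * (i + j + k + l) \<le> e * (4 * N)" using t by (intro mult_left_mono) auto
      then show "e * i + e * j + e * k + e * l \<le> D" by (simp add: D_def algebra_simps)
    qed
    finally show ?thesis .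
  qed
  then have f: "f ` T \<subseteq> P.span (monomial ` box D)"
    unfolding span_monomials by (intro image_subsetI) simp
  have "card (monomial ` box D :: 'k poly3 set) \<le> (D + 1) ^ 3"
    using card_image_le[OF box_card(1)[of D], of "monomial :: _ \<Rightarrow> 'k poly3"] box_card(2)[of D] by linarith
  also have "\<dots> \<le> (4 * e * (N + 1)) ^ 3"
    by (rule power_mono) (auto simp: D_def e_def)
  also have "\<dots> = N * (N + 1) ^ 3" by (simp only: N_def power_mult_distrib)
  also have "\<dots> < (N + 1) * (N + 1) ^ 3" by simp
  also have "\<dots> = card T" by (simp add: T_def card_cartesian_product power3_eq_cube algebra_simps)
  finally have lt: "card (monomial ` box D :: 'k poly3 set) < card T" .
  have fin: "finite T" "finite (monomial ` box D :: 'k poly3 set)"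
    using box_card(1) by (simp_all add: T_def)
  obtain u where "(\<Sum>t\<in>T. Const (u t) * f t) = 0 \<and> (\<exists>t\<in>T. u t \<noteq> 0)"
    using linear_relation[OF fin f lt] by (rule exE)
  then have u: "(\<Sum>t\<in>T. Const (u t) * f t) = 0" "\<exists>t\<in>T. u t \<noteq> 0" by blast+
  show ?thesis
  proof (rule exI[of _ N], rule exI[of _ "\<lambda>i j k l. u (i, j, k, l)"], rule conjI)
    show "(\<Sum>(i, j, k, l)\<in>{..N} \<times> {..N} \<times> {..N} \<times> {..N}.
        Const (u (i, j, k, l)) * (p ^ i * a1 ^ j * a2 ^ k * a3 ^ l)) = 0"
      using u(1) by (simp add: T_def f_def case_prod_unfold)
    show "\<exists>i\<le>N. \<exists>j\<le>N. \<exists>k\<le>N. \<exists>l\<le>N. u (i, j, k, l) \<noteq> 0"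
      using u(2) by (auto simp: T_def)
  qed
qed

text \<open>The sum is a^j0 (H j0 + a R) for some R. Powers of a nonzerodivisor modulo the ideal can
  be cancelled, and what remains is H j0 up to a multiple of \<open>a\<close>.\<close>

lemma lowest_coefficient:
  assumes nzd: "\<And>s. a * s \<in> Gen A \<Longrightarrow> s \<in> Gen A"
    and rel: "(\<Sum>j\<le>N. H j * a ^ j) \<in> Gen A" and j0: "j0 \<le> N" "\<And>j. j < j0 \<Longrightarrow> H j = 0"
  shows "H j0 \<in> Gen (insert a A)"
proof -
  have pow: "a ^ n * s \<in> Gen A \<Longrightarrow> s \<in> Gen A" for n s
    by (induction n) (auto simp: mult.assoc intro: nzd)
  define R where "R = (\<Sum>j=Suc j0..N. H j * a ^ (j - Suc j0))"
  have "(\<Sum>j\<le>N. H j * a ^ j) = (\<Sum>j=j0..N. H j * a ^ j)"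
    by (rule sum.mono_neutral_right) (use j0 in \<open>auto simp: not_le\<close>)
  also have "\<dots> = H j0 * a ^ j0 + (\<Sum>j=Suc j0..N. H j * a ^ j)"
    using j0(1) by (rule sum.atLeast_Suc_atMost)
  also have "(\<Sum>j=Suc j0..N. H j * a ^ j) = (\<Sum>j=Suc j0..N. a ^ j0 * (a * (H j * a ^ (j - Suc j0))))"
  proof (rule sum.cong[OF refl])
    fix j assume "j \<in> {Suc j0..N}"
    then have "a ^ j = a ^ (j0 + Suc (j - Suc j0))" by simp
    also have "\<dots> = a ^ j0 * (a * a ^ (j - Suc j0))" by (simp only: power_add power_Suc)
    finally show "H j * a ^ j = a ^ j0 * (a * (H j * a ^ (j - Suc j0)))" by (simp add: ac_simps)
  qed
  finally have "(\<Sum>j\<le>N. H j * a ^ j) = a ^ j0 * (H j0 + a * R)"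
    by (simp add: R_def sum_distrib_left distrib_left mult.commute)
  then have "H j0 + a * R \<in> Gen A" using rel pow by simp
  moreover have "H j0 = (- R) * a + (H j0 + a * R)" by (simp add: algebra_simps)
  ultimately show ?thesis unfolding Gen_insert by blast
qed

lemma regular_sequence_3:
  assumes "regular_sequence [a1, a2, a3]"
  shows "a1 * s = 0 \<Longrightarrow> s = 0" "a2 * s \<in> Gen {a1} \<Longrightarrow> s \<in> Gen {a1}"
    "a3 * s \<in> Gen {a2, a1} \<Longrightarrow> s \<in> Gen {a2, a1}"
proof -
  have r: "i < 3 \<Longrightarrow> [a1, a2, a3] ! i * s \<in> Gen (set (take i [a1, a2, a3])) \<Longrightarrow> s \<in> Gen (set (take i [a1, a2, a3]))" for i s
    using assms unfolding regular_sequence_def Gen_def by simp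
  show "a1 * s = 0 \<Longrightarrow> s = 0" using r[of 0 s] by (simp add: Gen_empty)
  show "a2 * s \<in> Gen {a1} \<Longrightarrow> s \<in> Gen {a1}" using r[of 1 s] by simp
  show "a3 * s \<in> Gen {a2, a1} \<Longrightarrow> s \<in> Gen {a2, a1}"
    using r[of 2 s] by (simp add: numeral_2_eq_2 insert_commute)
qed

text \<open>From an algebraic relation between \<open>p\<close> and the sequence, the lowest
  occurring powers of \<open>a1\<close>, \<open>a2\<close> and \<open>a3\<close> are isolated in
  turn. Each time the coefficient lies in the ideal enlarged by that element; the last one is a
  polynomial expression in \<open>p\<close> alone with some nonzero coefficient.\<close>

lemma algebraic_mod_regular_sequence:
  fixes p :: "'k::field poly3"
  assumes reg: "regular_sequence [a1, a2, a3]"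
  shows "\<exists>N u. (\<Sum>i\<le>N. Const (u i) * p ^ i) \<in> Gen {a3, a2, a1} \<and> (\<exists>i\<le>N. u i \<noteq> 0)"
proof -
  obtain N u where rel: "(\<Sum>(i, j, k, l)\<in>{..N} \<times> {..N} \<times> {..N} \<times> {..N}. Const (u i j k l) * (p ^ i * a1 ^ j * a2 ^ k * a3 ^ l)) = 0"
    and nz: "\<exists>i\<le>N. \<exists>j\<le>N. \<exists>k\<le>N. \<exists>l\<le>N. u i j k l \<noteq> 0"
    using algebraic_dependence[of p a1 a2 a3] by blast
  define G where "G = (\<lambda>j k l. \<Sum>i\<le>N. Const (u i j k l) * p ^ i)"
  define G3 where "G3 = (\<lambda>j k. \<Sum>l\<le>N. G j k l * a3 ^ l)"
  define G2 where "G2 = (\<lambda>j. \<Sum>k\<le>N. G3 j k * a2 ^ k)"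
  have "(\<Sum>j\<le>N. G2 j * a1 ^ j) = (\<Sum>j\<le>N. \<Sum>k\<le>N. \<Sum>l\<le>N. \<Sum>i\<le>N. Const (u i j k l) * (p ^ i * a1 ^ j * a2 ^ k * a3 ^ l))"
    by (simp add: G2_def G3_def G_def sum_distrib_right sum_distrib_left mult_ac)
  also have "\<dots> = (\<Sum>j\<le>N. \<Sum>k\<le>N. \<Sum>i\<le>N. \<Sum>l\<le>N. Const (u i j k l) * (p ^ i * a1 ^ j * a2 ^ k * a3 ^ l))"
    by (rule sum.cong[OF refl], rule sum.cong[OF refl], rule sum.swap)
  also have "\<dots> = (\<Sum>j\<le>N. \<Sum>i\<le>N. \<Sum>k\<le>N. \<Sum>l\<le>N. Const (u i j k l) * (p ^ i * a1 ^ j * a2 ^ k * a3 ^ l))"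
    by (rule sum.cong[OF refl], rule sum.swap)
  also have "\<dots> = (\<Sum>i\<le>N. \<Sum>j\<le>N. \<Sum>k\<le>N. \<Sum>l\<le>N. Const (u i j k l) * (p ^ i * a1 ^ j * a2 ^ k * a3 ^ l))"
    by (rule sum.swap)
  also have "\<dots> = 0" using rel by (simp add: sum.cartesian_product case_prod_unfold)
  finally have 1: "(\<Sum>j\<le>N. G2 j * a1 ^ j) \<in> Gen {}" by (simp add: Gen_empty)
  let ?Q1 = "\<lambda>j. j \<le> N \<and> (\<exists>i\<le>N. \<exists>k\<le>N. \<exists>l\<le>N. u i j k l \<noteq> 0)"
  \<comment> \<open>The least exponent of \<open>a1\<close> that occurs with a nonzero coefficient;
    \<open>k0\<close> and \<open>l0\<close> are chosen likewise with the earlier exponents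
    fixed.\<close>
  define j0 where "j0 = (LEAST j. ?Q1 j)"
  have j0: "?Q1 j0" unfolding j0_def by (rule LeastI_ex) (use nz in blast)
  have j0': "\<not> ?Q1 j" if "j < j0" for j using that not_less_Least unfolding j0_def by blast
  have z1: "G2 j = 0" if "j < j0" for j
    using j0'[OF that] that j0 by (simp add: G2_def G3_def G_def Const_simps)
  have "a1 * s \<in> Gen {} \<Longrightarrow> s \<in> Gen {}" for s
    using regular_sequence_3(1)[OF reg, of s] by (simp add: Gen_empty)
  from lowest_coefficient[of a1 "{}", OF this 1 conjunct1[OF j0] z1]
  have 2: "(\<Sum>k\<le>N. G3 j0 k * a2 ^ k) \<in> Gen {a1}" by (simp add: G2_def)
  let ?Q2 = "\<lambda>k. k \<le> N \<and> (\<exists>i\<le>N. \<exists>l\<le>N. u i j0 k l \<noteq> 0)"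
  define k0 where "k0 = (LEAST k. ?Q2 k)"
  have k0: "?Q2 k0" unfolding k0_def by (rule LeastI_ex) (use j0 in blast)
  have k0': "\<not> ?Q2 k" if "k < k0" for k using that not_less_Least unfolding k0_def by blast
  have z2: "G3 j0 k = 0" if "k < k0" for k
    using k0'[OF that] that k0 by (simp add: G3_def G_def Const_simps)
  from lowest_coefficient[of a2 "{a1}", OF regular_sequence_3(2)[OF reg] 2 conjunct1[OF k0] z2]
  have 3: "(\<Sum>l\<le>N. G j0 k0 l * a3 ^ l) \<in> Gen {a2, a1}" by (simp add: G3_def)
  let ?Q3 = "\<lambda>l. l \<le> N \<and> (\<exists>i\<le>N. u i j0 k0 l \<noteq> 0)"
  define l0 where "l0 = (LEAST l. ?Q3 l)"
  have l0: "?Q3 l0" unfolding l0_def by (rule LeastI_ex) (use k0 in blast)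
  have l0': "\<not> ?Q3 l" if "l < l0" for l using that not_less_Least unfolding l0_def by blast
  have z3: "G j0 k0 l = 0" if "l < l0" for l
    using l0'[OF that] that l0 by (simp add: G_def Const_simps)
  from lowest_coefficient[of a3 "{a2, a1}", OF regular_sequence_3(3)[OF reg] 3 conjunct1[OF l0] z3]
  have "G j0 k0 l0 \<in> Gen {a3, a2, a1}" .
  then show ?thesis
    using l0 by (intro exI[of _ N] exI[of _ "\<lambda>i. u i j0 k0 l0"]) (simp add: G_def)
qed

text \<open>Division by the highest nonzero coefficient makes the relation monic. If that
  coefficient is the constant term, then n = 0 and the conclusion says that 1 lies in
  \<open>A\<close>.\<close>

lemma reduce_power:
  fixes p :: "'k::field poly3"
  assumes A: "is_ideal A" and rel: "(\<Sum>i\<le>N. Const (u i) * p ^ i) \<in> A" and nz: "\<exists>i\<le>N. u i \<noteq> 0"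
  shows "\<exists>n d. p ^ n - (\<Sum>j<n. Const (d j) * p ^ j) \<in> A"
proof -
  let ?Q = "\<lambda>i. i \<le> N \<and> u i \<noteq> 0"
  define n where "n = (GREATEST i. ?Q i)"
  have n: "?Q n" unfolding n_def by (rule GreatestI_ex_nat[where b=N]) (use nz in auto)
  have n': "u i = 0" if "n < i" "i \<le> N" for i
    using Greatest_le_nat[of ?Q i N] that unfolding n_def by auto
  have "(\<Sum>i\<le>N. Const (u i) * p ^ i) = (\<Sum>i\<le>n. Const (u i) * p ^ i)"
    by (rule sum.mono_neutral_right) (use n n' in \<open>auto simp: Const_simps\<close>)
  also have "\<dots> = (\<Sum>i<n. Const (u i) * p ^ i) + Const (u n) * p ^ n"
    by (simp flip: lessThan_Suc_atMost)
  finally have *: "Const (inverse (u n)) * ((\<Sum>i<n. Const (u i) * p ^ i) + Const (u n) * p ^ n) \<in> A"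
    using rel is_idealD(3)[OF A] by metis
  have e1: "Const (inverse (u n)) * (Const (u n) * p ^ n) = p ^ n"
    using n by (simp add: Const_simps(4) flip: mult.assoc Const_simps(2))
  have e2: "Const (inverse (u n)) * (\<Sum>i<n. Const (u i) * p ^ i) =
      - (\<Sum>i<n. Const (- inverse (u n) * u i) * p ^ i)"
    by (simp only: sum_distrib_left sum_negf Const_simps(2,5) mult.assoc mult_minus_left minus_minus)
  from * have "p ^ n - (\<Sum>i<n. Const (- inverse (u n) * u i) * p ^ i) \<in> A"
    unfolding distrib_left e1 e2 by (simp only: add.commute[of "- _"] add_uminus_conv_diff)
  then show ?thesis by (intro exI[of _ n] exI[of _ "\<lambda>i. - inverse (u n) * u i"])
qed

lemma var_power: "var i ^ n = monomial (Poly_Mapping.single i n)"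
  by (induction n) (simp_all add: monomial_0 var_def monomial_mult flip: single_add)

text \<open>The span \<open>R\<close> of the normal forms of the monomials with all exponents below
  \<open>n i\<close> contains the class of 1 and is stable under the variables, hence is the whole
  quotient.\<close>

lemma finite_if_powers_reduce:
  fixes A :: "'k::field poly3 set"
  assumes nf: "normal_form A B nf" and A: "is_ideal A"
    and red: "\<And>i. var i ^ n i - (\<Sum>j<n i. Const (d i j) * var i ^ j) \<in> A"
  shows "finite B"
proof -
  define C where "C = {m :: 3 \<Rightarrow>\<^sub>0 nat. \<forall>i. lookup m i < n i}"
  define R where "R = P.span ((\<lambda>m. nf (monomial m)) ` C)"
  note lin = nf_klin[OF nf]
  have "C \<subseteq> box (Max (range n))"
    by (auto simp: C_def box_def intro: order_trans[OF less_imp_le Max_ge])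
  then have "finite C" using box_card(1) finite_subset by blast
  have R: "nf (monomial m) \<in> R" if "m \<in> C" for m
    unfolding R_def by (rule P.span_base) (use that in blast)
  have sub: "P.subspace R" unfolding R_def by (rule P.subspace_span)
  have step: "nf (var i * q) \<in> R" if q: "q \<in> R" for i q
  proof -
    have "P.subspace {q. nf (var i * q) \<in> R}"
    proof -
      have "nf (var i * (Const c * q)) = Const c * nf (var i * q)" for c q
        using klin_scale[OF lin, of c "var i * q"] by (simp add: mult.left_commute)
      then show ?thesis
        using sub unfolding P.subspace_def by (simp add: distrib_left klin_add[OF lin] klin_0[OF lin])
    qed
    moreover have "(\<lambda>m. nf (monomial m)) ` C \<subseteq> {q. nf (var i * q) \<in> R}"
    proof clarsimp
      fix m assume m: "m \<in> C"
      have *: "nf (var i * nf (monomial m)) = nf (monomial (Poly_Mapping.single i 1 + m))"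
        by (simp only: nf_mult_nf[OF nf A] var_def monomial_mult)
      show "nf (var i * nf (monomial m)) \<in> R"
      proof (cases "Suc (lookup m i) = n i")
        case False
        then have "Poly_Mapping.single i 1 + m \<in> C"
          using m by (auto simp: C_def lookup_add lookup_single when_def) (metis Suc_lessI)
        then show ?thesis using R * by simp
      next
        case True
        \<comment> \<open>The exponent of the i-th variable would reach \<open>n i\<close>. With
          \<open>m'\<close> free of this variable, its power can be replaced by lower ones.\<close>
        define m' where "m' = m - Poly_Mapping.single i (lookup m i)"
        have m': "Poly_Mapping.single i 1 + m = Poly_Mapping.single i (n i) + m'"
          using True by (intro poly_mapping_eqI)
            (auto simp: m'_def lookup_add lookup_minus lookup_single when_def)
        have "Poly_Mapping.single i j + m' \<in> C" if "j < n i" for j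
          using that m by (auto simp: m'_def C_def lookup_add lookup_minus lookup_single when_def)
        then have "nf (var i ^ j * monomial m') \<in> R" if "j < n i" for j
          using R that by (simp add: var_power monomial_mult)
        then have "(\<Sum>j<n i. Const (d i j) * nf (var i ^ j * monomial m')) \<in> R"
          unfolding R_def by (intro P.span_sum P.span_scale) auto
        also have "(\<Sum>j<n i. Const (d i j) * nf (var i ^ j * monomial m')) =
            nf ((\<Sum>j<n i. Const (d i j) * var i ^ j) * monomial m')"
          by (simp add: sum_distrib_right klin_sum[OF lin] klin_scale[OF lin] mult.assoc)
        also have "\<dots> = nf (var i ^ n i * monomial m')"
          using is_idealD(4)[OF A red[of i], of "monomial m'"]
          by (subst eq_commute) (simp add: nf_eq[OF nf] left_diff_distrib)
        also have "\<dots> = nf (var i * nf (monomial m))"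
          unfolding * m' by (simp add: var_power monomial_mult)
        finally show ?thesis .
      qed
    qed
    ultimately have "R \<subseteq> {q. nf (var i * q) \<in> R}"
      using P.span_minimal unfolding R_def by blast
    then show ?thesis using q by blast
  qed
  \<comment> \<open>When some \<open>n i\<close> is 0, the set \<open>C\<close> is empty, but then 1
    lies in \<open>A\<close> and its normal form is 0.\<close>
  have one: "nf 1 \<in> R"
  proof (cases "\<exists>i. n i = 0")
    case True
    then obtain i where "n i = 0" ..
    then have "1 \<in> A" using red[of i] by simp
    then show ?thesis using nf_eq_0[OF nf, of 1] P.subspace_0[OF sub] by simp
  next
    case False
    then have "0 \<in> C" by (auto simp: C_def)
    then show ?thesis using R[of 0] by (simp add: monomial_0)
  qed
  have "nf p \<in> R" for p
  proof (induction p rule: poly3_induct)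
    case (Const c)
    then show ?case
      using klin_scale[OF lin, of c 1] P.subspace_scale[OF sub one, of c] by simp
  next
    case (var i p)
    then show ?case using step[OF var, of i] by (simp add: nf_mult_nf[OF nf A])
  qed (use sub P.subspace_0 P.subspace_add in \<open>auto simp: klin_0 klin_add lin\<close>)
  then have "{p. keys p \<subseteq> B} \<subseteq> R" unfolding nf_range[OF nf, symmetric] by blast
  moreover have "P.fd R" unfolding R_def P.fd_def using \<open>finite C\<close> by blast
  ultimately show ?thesis using P.fd_subset fd_keys by blast
qed

lemma regular_sequence_finite:
  fixes a1 :: "'k::field poly3"
  assumes reg: "regular_sequence [a1, a2, a3]" and nf: "normal_form (Gen {a3, a2, a1}) B nf"
  shows "finite B"
proof -
  have "\<exists>n d. var i ^ n - (\<Sum>j<n. Const (d j) * var i ^ j) \<in> Gen {a3, a2, a1}" for i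
    using algebraic_mod_regular_sequence[OF reg, of "var i"] reduce_power[OF is_ideal_Gen] by blast
  then have "\<forall>i. \<exists>n d. var i ^ n - (\<Sum>j<n. Const (d j) * var i ^ j) \<in> Gen {a3, a2, a1}" by (rule allI)
  from choice[OF this] obtain n
    where "\<forall>i. \<exists>d. var i ^ n i - (\<Sum>j<n i. Const (d j) * var i ^ j) \<in> Gen {a3, a2, a1}" by (rule exE)
  from choice[OF this] obtain d
    where "\<forall>i. var i ^ n i - (\<Sum>j<n i. Const (d i j) * var i ^ j) \<in> Gen {a3, a2, a1}" by (rule exE)
  then show ?thesis by (intro finite_if_powers_reduce[OF nf is_ideal_Gen, of n d]) (rule spec)
qed

section \<open>The Koszul complex of the difference operators\<close>

text \<open>Division by x_i, discarding the terms free of x_i; a left inverse of multiplication by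
  x_i.\<close>

definition shift :: "3 \<Rightarrow> 'k::field poly3 \<Rightarrow> 'k poly3" where
  "shift i = Poly_Mapping.map_key (\<lambda>m. m + Poly_Mapping.single i 1)"

text \<open>The part of \<open>p\<close> free of x_i, that is, substitution of 0 for x_i.\<close>

definition eps :: "3 \<Rightarrow> 'k::field poly3 \<Rightarrow> 'k poly3" where
  "eps i p = p - var i * shift i p"

lemma lookup_shift: "lookup (shift i p) m = lookup p (m + Poly_Mapping.single i 1)"
  unfolding shift_def by (subst map_key.rep_eq) (auto intro: injI)

lemma klin_shift: "klin (shift i)"
  unfolding klin_def
  by (auto intro!: poly_mapping_eqI simp: lookup_shift lookup_add lookup_Const_mult simp del: One_nat_def)

lemmas shift_simps = klin_add[OF klin_shift] klin_scale[OF klin_shift] klin_0[OF klin_shift] klin_diff[OF klin_shift]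

lemma shift_monomial:
  "shift i (monomial m) = (if lookup m i = 0 then 0 else monomial (m - Poly_Mapping.single i 1))"
proof (rule poly_mapping_eqI)
  fix n
  have "n + Poly_Mapping.single i 1 = m \<longleftrightarrow> lookup m i \<noteq> 0 \<and> n = m - Poly_Mapping.single i 1"
  proof
    assume "n + Poly_Mapping.single i 1 = m"
    then show "lookup m i \<noteq> 0 \<and> n = m - Poly_Mapping.single i 1"
      by (auto simp: lookup_add)
  next
    assume "lookup m i \<noteq> 0 \<and> n = m - Poly_Mapping.single i 1"
    then show "n + Poly_Mapping.single i 1 = m"
      by (intro poly_mapping_eqI) (auto simp: lookup_add lookup_minus lookup_single when_def)
  qed
  then show "lookup (shift i (monomial m)) n =
      lookup (if lookup m i = 0 then 0 else monomial (m - Poly_Mapping.single i 1)) n"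
    by (auto simp: lookup_shift lookup_monomial simp del: One_nat_def)
qed

lemma klin_mult: "klin (\<lambda>p. q * p)"
  by (simp add: klin_def distrib_left mult.left_commute)

lemma klin_comp: "klin f \<Longrightarrow> klin g \<Longrightarrow> klin (\<lambda>p. f (g p))"
  by (simp add: klin_def)

lemma shift_var: "shift i (var i * p) = p"
proof (rule klin_eqI[of "\<lambda>p. shift i (var i * p)" "\<lambda>p. p"])
  show "klin (\<lambda>p. shift i (var i * p))" by (rule klin_comp[OF klin_shift klin_mult])
  show "klin (\<lambda>p. p)" by (simp add: klin_def)
  show "shift i (var i * monomial m) = monomial m" for m
    by (simp add: var_def monomial_mult shift_monomial lookup_add)
qed

lemma shift_var_other:
  assumes "i \<noteq> j"
  shows "shift i (var j * p) = var j * shift i p"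
proof (rule klin_eqI[of "\<lambda>p. shift i (var j * p)" "\<lambda>p. var j * shift i p"])
  show "klin (\<lambda>p. shift i (var j * p))" by (rule klin_comp[OF klin_shift klin_mult])
  show "klin (\<lambda>p. var j * shift i p)" by (rule klin_comp[OF klin_mult klin_shift])
  show "shift i (var j * monomial m) = var j * shift i (monomial m)" for m
  proof -
    have "lookup m i \<noteq> 0 \<Longrightarrow> Poly_Mapping.single j 1 + m - Poly_Mapping.single i 1 =
        Poly_Mapping.single j 1 + (m - Poly_Mapping.single i 1)"
      using assms by (intro poly_mapping_eqI) (auto simp: lookup_add lookup_minus lookup_single when_def)
    then show ?thesis
      using assms by (simp add: var_def monomial_mult shift_monomial lookup_add lookup_single when_def
        del: One_nat_def)
  qed
qed

lemma shift_Const: "shift i (Const (c :: 'a::field)) = 0"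
proof -
  have "shift i 1 = (0 :: 'a poly3)"
    unfolding monomial_0[symmetric] by (simp add: shift_monomial)
  then show ?thesis using klin_scale[OF klin_shift, of i c 1] by simp
qed

lemma klin_eps: "klin (eps i)"
  unfolding klin_def eps_def
  by (simp add: shift_simps distrib_left add_diff_add right_diff_distrib mult.left_commute)

lemma shift_eps: "shift i (eps i p) = 0"
  by (simp add: eps_def shift_simps shift_var)

lemma eps_var: "eps i (var i * p) = 0"
  by (simp add: eps_def shift_var)

lemma eps_var_other: "i \<noteq> j \<Longrightarrow> eps i (var j * p) = var j * eps i p"
  by (simp add: eps_def shift_var_other right_diff_distrib mult.left_commute)

lemma shift_shift: "shift i (shift j p) = shift j (shift i p)"
  by (rule poly_mapping_eqI) (simp add: lookup_shift add.assoc add.commute[of "Poly_Mapping.single i _"]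
      del: One_nat_def)

lemma shift_eps_other: "i \<noteq> j \<Longrightarrow> shift i (eps j p) = eps j (shift i p)"
  by (simp add: eps_def shift_simps shift_var_other shift_shift[of i j])

lemma klin_funpow: "klin f \<Longrightarrow> klin (f ^^ n)"
  by (induction n) (simp_all add: klin_def)

lemma shift_pow_var: "(shift i ^^ Suc n) (var i * p) = (shift i ^^ n) p"
  by (simp add: funpow_Suc_right shift_var del: funpow.simps)

lemma shift_pow_var_other: "i \<noteq> j \<Longrightarrow> (shift i ^^ n) (var j * p) = var j * (shift i ^^ n) p"
  by (induction n) (simp_all add: shift_var_other)

lemma shift_pow_shift: "shift j ((shift i ^^ n) p) = (shift i ^^ n) (shift j p)"
  by (induction n) (simp_all add: shift_shift[of j i])

lemma shift_pow_var_pow: "(shift i ^^ n) (var i ^ n * p) = p"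
  by (induction n arbitrary: p) (simp_all add: funpow_Suc_right shift_var mult.assoc del: funpow.simps)

lemma shift_nilpotent: "\<exists>N. \<forall>n\<ge>N. (shift i ^^ n) p = 0"
proof (induction p rule: poly3_induct)
  case zero
  then show ?case using klin_0[OF klin_funpow[OF klin_shift]] by blast
next
  case (add p q)
  then obtain N M where "\<forall>n\<ge>N. (shift i ^^ n) p = 0" "\<forall>n\<ge>M. (shift i ^^ n) q = 0" by blast
  then show ?case
    by (intro exI[of _ "max N M"]) (simp add: klin_add[OF klin_funpow[OF klin_shift]])
next
  case (Const c)
  have "(shift i ^^ n) (Const c) = 0" if "n \<ge> 1" for n
    using that by (cases n) (simp_all add: funpow_Suc_right shift_Const
        klin_0[OF klin_funpow[OF klin_shift]] del: funpow.simps)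
  then show ?case by blast
next
  case (var j p)
  then obtain N where N: "\<forall>n\<ge>N. (shift i ^^ n) p = 0" by blast
  have "(shift i ^^ n) (var j * p) = 0" if "n \<ge> Suc N" for n
  proof (cases "i = j")
    case True
    then show ?thesis using that N by (cases n) (simp_all add: shift_pow_var del: funpow.simps)
  next
    case False
    then show ?thesis using that N by (simp add: shift_pow_var_other)
  qed
  then show ?case by blast
qed

text \<open>Linear maps into S carry two actions of S, on values and on arguments; this is the first
  action of x_i minus the second.\<close>

definition diff_op :: "3 \<Rightarrow> ('k::field poly3 \<Rightarrow> 'k poly3) \<Rightarrow> 'k poly3 \<Rightarrow> 'k poly3" where
  "diff_op i w = (\<lambda>s. var i * w s - w (var i * s))"

text \<open>A constant function, so that scaling of values becomes multiplication in the commutative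
  ring of functions.\<close>

definition scal :: "'k::field poly3 \<Rightarrow> 'k poly3 \<Rightarrow> 'k poly3" where
  "scal a = (\<lambda>s. a)"

text \<open>\<open>homotopy\<close> inverts \<open>diff_op i\<close> up to \<open>proj\<close>, which substitutes the action on the argument for
  the variable \<open>i\<close> in the values; the number \<open>N\<close> only has to be large enough for the sums to be
  complete.\<close>

definition homotopy :: "nat \<Rightarrow> 3 \<Rightarrow> ('k::field poly3 \<Rightarrow> 'k poly3) \<Rightarrow> 'k poly3 \<Rightarrow> 'k poly3" where
  "homotopy N i w = (\<lambda>s. \<Sum>n<N. (shift i ^^ Suc n) (w (var i ^ n * s)))"

definition proj :: "nat \<Rightarrow> 3 \<Rightarrow> ('k::field poly3 \<Rightarrow> 'k poly3) \<Rightarrow> 'k poly3 \<Rightarrow> 'k poly3" where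
  "proj N i w = (\<lambda>s. \<Sum>n<N. eps i ((shift i ^^ n) (w (var i ^ n * s))))"

text \<open>Says that the values of \<open>w\<close> have degree less than \<open>N\<close> in each
  variable.\<close>

definition vanishes_from :: "nat \<Rightarrow> ('k::field poly3 \<Rightarrow> 'k poly3) \<Rightarrow> bool" where
  "vanishes_from N w \<longleftrightarrow> (\<forall>i s. \<forall>n\<ge>N. (shift i ^^ n) (w s) = 0)"

lemma diff_op_simps:
  "diff_op i (u + v) = diff_op i u + diff_op i v"
  "diff_op i (u - v) = diff_op i u - diff_op i v"
  "diff_op i (- u) = - diff_op i u"
  "diff_op i (scal a * u) = scal a * diff_op i u"
  "diff_op i 0 = 0"
  by (auto simp: diff_op_def scal_def fun_eq_iff algebra_simps)

lemma diff_op_commute: "diff_op i (diff_op j u) = diff_op j (diff_op i u)"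
  by (auto simp: diff_op_def fun_eq_iff algebra_simps)

text \<open>The terms \<open>(shift i ^^ n) (w (var i ^ n * s))\<close> telescope: they start at
  \<open>w s\<close> and end at 0 by the degree bound. The \<open>eps\<close> parts left over at
  each stage make up \<open>proj\<close>.\<close>

lemma homotopy:
  assumes w: "vanishes_from N w"
  shows "w = diff_op i (homotopy N i w) + proj N i w"
proof
  fix s
  let ?g = "\<lambda>n. (shift i ^^ n) (w (var i ^ n * s))"
  have "var i * homotopy N i w s = (\<Sum>n<N. ?g n - eps i (?g n))"
    by (simp add: homotopy_def sum_distrib_left eps_def)
  moreover have "homotopy N i w (var i * s) = (\<Sum>n<N. ?g (Suc n))"
    by (simp add: homotopy_def mult.left_commute mult.assoc)
  ultimately have "diff_op i (homotopy N i w) s + proj N i w s = (\<Sum>n<N. ?g n - ?g (Suc n))"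
    by (simp add: diff_op_def proj_def sum_subtractf)
  also have "\<dots> = w s"
    using w by (subst sum_lessThan_telescope') (simp add: vanishes_from_def)
  finally show "w s = (diff_op i (homotopy N i w) + proj N i w) s" by simp
qed

text \<open>If \<open>w\<close> commutes with x_i, then w(x_i^N s) = x_i^N w(s), which has degree at
  least N in x_i unless w(s) = 0.\<close>

lemma diff_op_inj:
  assumes w: "vanishes_from N w" and D: "diff_op i w = 0"
  shows "w = 0"
proof
  fix s
  have "var i * w s = w (var i * s)" for s
    using D by (simp add: diff_op_def fun_eq_iff)
  then have "var i ^ n * w s = w (var i ^ n * s)" for n
    by (induction n) (simp_all add: mult.assoc)
  then have "w s = (shift i ^^ N) (w (var i ^ N * s))"
    by (metis shift_pow_var_pow)
  then show "w s = 0 s" using w by (simp add: vanishes_from_def)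
qed

text \<open>Substituting the action on arguments for x_i kills the difference of the two actions.
  With \<open>Suc N\<close> summands the telescoping sum ends at \<open>N\<close> shifts of a value
  of \<open>u\<close>, which is 0.\<close>

lemma proj_diff_op:
  assumes u: "vanishes_from N u"
  shows "proj (Suc N) i (diff_op i u) = 0"
proof
  fix s
  let ?F = "\<lambda>n. if n = 0 then 0 else eps i ((shift i ^^ (n - 1)) (u (var i ^ n * s)))"
  have "eps i ((shift i ^^ n) (diff_op i u (var i ^ n * s))) = ?F n - ?F (Suc n)" for n
  proof -
    have "eps i ((shift i ^^ n) (var i * u (var i ^ n * s))) = ?F n"
      by (cases n) (simp_all add: eps_var shift_pow_var del: funpow.simps)
    then show ?thesis
      by (simp add: diff_op_def klin_diff[OF klin_eps] klin_diff[OF klin_funpow[OF klin_shift]] mult.assoc)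
  qed
  then have "proj (Suc N) i (diff_op i u) s = (\<Sum>n<Suc N. ?F n - ?F (Suc n))"
    unfolding proj_def by (rule sum.cong[OF refl])
  also have "\<dots> = 0"
    using u by (subst sum_lessThan_telescope') (simp add: vanishes_from_def klin_0[OF klin_eps])
  finally show "proj (Suc N) i (diff_op i u) s = 0 s" by simp
qed

lemma proj_diff_op_other:
  "i \<noteq> j \<Longrightarrow> proj N i (diff_op j w) = diff_op j (proj N i w)"
  by (auto simp: fun_eq_iff proj_def diff_op_def klin_diff[OF klin_eps] klin_diff[OF klin_funpow[OF klin_shift]]
      eps_var_other shift_pow_var_other sum_subtractf sum_distrib_left mult.left_commute)

lemma proj_add: "proj N i (u + v) = proj N i u + proj N i v"
  by (auto simp: fun_eq_iff proj_def klin_add[OF klin_eps] klin_add[OF klin_funpow[OF klin_shift]] sum.distrib)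

lemma shift_proj_self: "shift i (proj N i w s) = 0"
  by (simp add: proj_def klin_sum[OF klin_shift] shift_eps)

lemma shift_proj_other:
  assumes "i \<noteq> j" "\<And>s. shift i (w s) = 0"
  shows "shift i (proj N j w s) = 0"
  using assms by (simp add: proj_def klin_sum[OF klin_shift] shift_eps_other shift_pow_shift
      klin_0[OF klin_funpow[OF klin_shift]] klin_0[OF klin_eps])

lemma shift_zero_imp_Const:
  assumes "\<And>i. shift i p = 0"
  shows "p = Const (lookup p 0)"
proof (rule poly_mapping_eqI)
  fix m
  show "lookup p m = lookup (Const (lookup p 0)) m"
  proof (cases "m = 0")
    case False
    then obtain i where i: "lookup m i \<noteq> 0" by (metis lookup_zero poly_mapping_eqI)
    then have "m = (m - Poly_Mapping.single i 1) + Poly_Mapping.single i 1"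
      by (intro poly_mapping_eqI) (auto simp: lookup_add lookup_minus lookup_single when_def)
    then have "lookup p m = lookup (shift i p) (m - Poly_Mapping.single i 1)"
      by (metis lookup_shift)
    then show ?thesis using assms False by (simp add: Const_def lookup_single when_def)
  qed (simp add: Const_def)
qed

section \<open>Exactness of the Koszul complex on the linear maps from the quotient to S\<close>

context cofinite_normal_form
begin

definition Phi :: "('k poly3 \<Rightarrow> 'k poly3) set" where
  "Phi = {w. klin w \<and> (\<forall>f\<in>I. w f = 0)}"

lemma Phi_klin: "w \<in> Phi \<Longrightarrow> klin w" and Phi_I: "w \<in> Phi \<Longrightarrow> f \<in> I \<Longrightarrow> w f = 0"
  by (auto simp: Phi_def)

lemma Phi_nf: "w \<in> Phi \<Longrightarrow> w (nf p) = w p"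
  using Phi_I[OF _ nf_diff(1)[OF nf, of p]] by (simp add: klin_diff[OF Phi_klin])

lemma I_mult: "f \<in> I \<Longrightarrow> s * f \<in> I" "f \<in> I \<Longrightarrow> f * s \<in> I"
  using is_idealD[OF I] by auto

lemma Phi_closed:
  "0 \<in> Phi" "u \<in> Phi \<Longrightarrow> v \<in> Phi \<Longrightarrow> u + v \<in> Phi" "u \<in> Phi \<Longrightarrow> - u \<in> Phi"
  "u \<in> Phi \<Longrightarrow> v \<in> Phi \<Longrightarrow> u - v \<in> Phi" "u \<in> Phi \<Longrightarrow> scal a * u \<in> Phi"
  "u \<in> Phi \<Longrightarrow> (\<lambda>s. u (r * s)) \<in> Phi"
proof -
  show "u \<in> Phi \<Longrightarrow> (\<lambda>s. u (r * s)) \<in> Phi"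
    using klin_comp[OF _ klin_mult, of u r] by (auto simp: Phi_def I_mult)
qed (auto simp: Phi_def klin_def scal_def distrib_left right_diff_distrib mult.left_commute)

lemma Phi_diff_op:
  assumes "u \<in> Phi"
  shows "diff_op i u \<in> Phi"
proof -
  have "diff_op i u = scal (var i) * u - (\<lambda>s. u (var i * s))"
    by (auto simp: diff_op_def scal_def)
  then show ?thesis using assms by (simp add: Phi_closed)
qed

lemma Phi_sum: "(\<And>n. n \<in> A \<Longrightarrow> f n \<in> Phi) \<Longrightarrow> sum f A \<in> Phi"
  by (induction A rule: infinite_finite_induct) (auto intro: Phi_closed)

lemma Phi_comp: "klin f \<Longrightarrow> u \<in> Phi \<Longrightarrow> (\<lambda>s. f (u (r * s))) \<in> Phi"
  using Phi_closed(6)[of u r] klin_comp[of f "\<lambda>s. u (r * s)"] by (auto simp: Phi_def klin_0)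

lemma Phi_proj:
  assumes "u \<in> Phi"
  shows "proj N i u \<in> Phi"
proof -
  have "proj N i u = (\<Sum>n<N. (\<lambda>s. eps i ((shift i ^^ n) (u (var i ^ n * s)))))"
    by (simp add: fun_eq_iff proj_def sum_fun_apply)
  also have "\<dots> \<in> Phi"
    by (rule Phi_sum, rule Phi_comp[of "\<lambda>p. eps i ((shift i ^^ _) p)"])
      (rule klin_comp[OF klin_eps klin_funpow[OF klin_shift]], rule assms)
  finally show ?thesis .
qed

lemma Phi_homotopy:
  assumes "u \<in> Phi"
  shows "homotopy N i u \<in> Phi"
proof -
  have "homotopy N i u = (\<Sum>n<N. (\<lambda>s. (shift i ^^ Suc n) (u (var i ^ n * s))))"
    by (simp add: fun_eq_iff homotopy_def sum_fun_apply)
  also have "\<dots> \<in> Phi"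
    by (rule Phi_sum, rule Phi_comp[OF klin_funpow[OF klin_shift] assms])
  finally show ?thesis .
qed

text \<open>A map in \<open>Phi\<close> is determined by its finitely many values on
  \<open>B\<close>, so one bound serves all values and all three variables.\<close>

lemma Phi_vanishes:
  assumes w: "w \<in> Phi"
  shows "\<exists>N. \<forall>M\<ge>N. vanishes_from M w"
proof -
  obtain N where N: "\<And>i p n. n \<ge> N i p \<Longrightarrow> (shift i ^^ n) p = (0 :: 'k poly3)"
    using shift_nilpotent by metis
  define M where "M = (\<Sum>i\<in>UNIV. \<Sum>b\<in>B. N i (w (monomial b)))"
  have "(shift i ^^ n) (w s) = 0" if n: "n \<ge> M" for i n s
  proof -
    have l: "klin (\<lambda>p. (shift i ^^ n) (w p))"
      by (intro klin_comp[of "shift i ^^ n" w] klin_funpow klin_shift Phi_klin w)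
    have "(shift i ^^ n) (w (monomial b)) = 0" if b: "b \<in> B" for b
    proof (rule N)
      have "N i (w (monomial b)) \<le> (\<Sum>b\<in>B. N i (w (monomial b)))"
        using b B by (intro member_le_sum) auto
      also have "\<dots> \<le> M" unfolding M_def
        by (rule member_le_sum[of i UNIV "\<lambda>i. \<Sum>b\<in>B. N i (w (monomial b))"]) auto
      finally show "N i (w (monomial b)) \<le> n" using n by simp
    qed
    then have "(shift i ^^ n) (w (nf s)) = 0"
      by (subst nf_expand[OF l]) simp
    then show ?thesis by (simp add: Phi_nf[OF w])
  qed
  then show ?thesis by (auto simp: vanishes_from_def intro!: exI[of _ M])
qed

lemma Phi_vanishes2:
  assumes "w \<in> Phi" "u \<in> Phi"
  shows "\<exists>N. vanishes_from N w \<and> vanishes_from N u \<and> vanishes_from (Suc N) w \<and> vanishes_from (Suc N) u"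
proof -
  obtain M N where "\<forall>n\<ge>M. vanishes_from n w" "\<forall>n\<ge>N. vanishes_from n u"
    using Phi_vanishes assms by metis
  then show ?thesis by (intro exI[of _ "max M N"]) auto
qed

lemma koszul_inj: "w \<in> Phi \<Longrightarrow> diff_op i w = 0 \<Longrightarrow> w = 0"
  using Phi_vanishes diff_op_inj by blast

text \<open>The differences behave as a regular sequence. \<open>proj i\<close> kills the right-hand
  side and commutes with \<open>diff_op j\<close>, which is injective; so \<open>proj i\<close>
  kills \<open>w\<close>, and the homotopy exhibits \<open>w\<close> as a difference.\<close>

lemma koszul_reg2:
  assumes w: "w \<in> Phi" and u: "u \<in> Phi" and "i \<noteq> j" and e: "diff_op j w = diff_op i u"
  shows "\<exists>u'\<in>Phi. w = diff_op i u'"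
proof -
  obtain N where N: "vanishes_from N u" "vanishes_from (Suc N) w"
    using Phi_vanishes2[OF w u] by blast
  have "diff_op j (proj (Suc N) i w) = 0"
    using proj_diff_op[OF N(1), of i] proj_diff_op_other[OF \<open>i \<noteq> j\<close>, of "Suc N" w] e by simp
  then have "proj (Suc N) i w = 0" by (rule koszul_inj[OF Phi_proj[OF w]])
  then show ?thesis using homotopy[OF N(2), of i] Phi_homotopy[OF w] by auto
qed

text \<open>Eliminating x_i by \<open>proj i\<close> leaves an instance of
  \<open>koszul_reg2\<close> for the other two variables.\<close>

lemma koszul_reg3:
  assumes w: "w \<in> Phi" and u: "u \<in> Phi" and v: "v \<in> Phi" and ne: "i \<noteq> j" "i \<noteq> k" "j \<noteq> k"
    and e: "diff_op k w = diff_op i u + diff_op j v"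
  shows "\<exists>u'\<in>Phi. \<exists>v'\<in>Phi. w = diff_op i u' + diff_op j v'"
proof -
  obtain N where N: "vanishes_from N u" "vanishes_from (Suc N) w"
    using Phi_vanishes2[OF w u] by blast
  have "diff_op k (proj (Suc N) i w) = diff_op j (proj (Suc N) i v)"
    using proj_diff_op[OF N(1), of i] proj_diff_op_other[OF ne(2), of "Suc N" w]
      proj_diff_op_other[OF ne(1), of "Suc N" v] e by (simp add: proj_add)
  then obtain v' where "v' \<in> Phi" "proj (Suc N) i w = diff_op j v'"
    using koszul_reg2[OF Phi_proj[OF w] Phi_proj[OF v] ne(3)] by blast
  then show ?thesis using homotopy[OF N(2), of i] Phi_homotopy[OF w] by metis
qed

text \<open>The potential \<open>u\<close> found for \<open>t0\<close> also serves \<open>t1\<close>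
  and \<open>t2\<close>, because the errors are killed by the injective
  \<open>diff_op 0\<close>.\<close>

lemma koszul_H1:
  assumes t: "t0 \<in> Phi" "t1 \<in> Phi" "t2 \<in> Phi"
    and e: "diff_op 0 t1 = diff_op 1 t0" "diff_op 0 t2 = diff_op 2 t0"
  shows "\<exists>u\<in>Phi. t0 = diff_op 0 u \<and> t1 = diff_op 1 u \<and> t2 = diff_op 2 u"
proof -
  obtain u where u: "u \<in> Phi" "t0 = diff_op 0 u"
    using koszul_reg2[OF t(1,2), of 0 1] e by auto
  have "t1 - diff_op 1 u = 0"
    by (rule koszul_inj[of _ 0])
      (use t u e in \<open>simp_all add: Phi_closed Phi_diff_op diff_op_simps diff_op_commute[of 0 1]\<close>)
  moreover have "t2 - diff_op 2 u = 0"
    by (rule koszul_inj[of _ 0])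
      (use t u e in \<open>simp_all add: Phi_closed Phi_diff_op diff_op_simps diff_op_commute[of 0 2]\<close>)
  ultimately show ?thesis using u by auto
qed

text \<open>\<open>koszul_reg3\<close> splits \<open>v01\<close>; the correction this causes in
  \<open>v02\<close> is handled by \<open>koszul_reg2\<close>, and the one in \<open>v12\<close> by
  injectivity.\<close>

lemma koszul_H2:
  assumes v: "v12 \<in> Phi" "v02 \<in> Phi" "v01 \<in> Phi"
    and e: "diff_op 0 v12 - diff_op 1 v02 + diff_op 2 v01 = 0"
  shows "\<exists>b0\<in>Phi. \<exists>b1\<in>Phi. \<exists>b2\<in>Phi. v01 = diff_op 0 b1 - diff_op 1 b0 \<and>
    v02 = diff_op 0 b2 - diff_op 2 b0 \<and> v12 = diff_op 1 b2 - diff_op 2 b1"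
proof -
  have "diff_op 2 v01 = diff_op 0 (- v12) + diff_op 1 v02"
    using e by (simp add: diff_op_simps algebra_simps)
  then obtain p q where pq: "p \<in> Phi" "q \<in> Phi" "v01 = diff_op 0 p + diff_op 1 q"
    using koszul_reg3[OF v(3) Phi_closed(3)[OF v(1)] v(2), of 0 1 2] by auto
  have e1: "diff_op 1 (v02 - diff_op 2 q) = diff_op 0 (v12 + diff_op 2 p)"
    using e by (simp add: pq(3) diff_op_simps diff_op_commute[of 2] algebra_simps)
  then obtain r where r: "r \<in> Phi" "v02 - diff_op 2 q = diff_op 0 r"
    using koszul_reg2[of "v02 - diff_op 2 q" "v12 + diff_op 2 p" 0 1] v pq
    by (auto simp: Phi_closed Phi_diff_op)
  have "v12 + diff_op 2 p - diff_op 1 r = 0"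
    by (rule koszul_inj[of _ 0])
      (use v pq r e1 in \<open>simp_all add: Phi_closed Phi_diff_op diff_op_simps diff_op_commute[of 1 0]\<close>)
  then have "v12 = diff_op 1 r - diff_op 2 p" by (simp add: algebra_simps)
  moreover have "v02 = diff_op 0 r - diff_op 2 (- q)" "v01 = diff_op 0 p - diff_op 1 (- q)"
    using r pq by (simp_all add: diff_op_simps algebra_simps)
  ultimately show ?thesis using pq(1,2) r(1) Phi_closed(3) by blast
qed

text \<open>The top cohomology of the Koszul complex is the dual of the quotient.\<close>

lemma koszul_top:
  assumes w: "w \<in> Phi"
  shows "\<exists>\<mu>. (\<forall>p q. \<mu> (p + q) = \<mu> p + \<mu> q) \<and> (\<forall>c p. \<mu> (Const c * p) = c * \<mu> p) \<and> (\<forall>f\<in>I. \<mu> f = (0::'k)) \<and>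
    (\<forall>r. (\<forall>s. \<mu> (r * s) = 0) \<longrightarrow> (\<exists>a\<in>Phi. \<exists>b\<in>Phi. \<exists>c\<in>Phi.
      (\<lambda>s. w (r * s)) = diff_op 0 a + diff_op 1 b + diff_op 2 c))"
proof -
  obtain N0 where N0: "vanishes_from N0 w" using Phi_vanishes w by blast
  define w1 where "w1 = proj N0 0 w"
  have w1: "w1 \<in> Phi" unfolding w1_def by (rule Phi_proj[OF w])
  obtain N1 where N1: "vanishes_from N1 w1" using Phi_vanishes w1 by blast
  define w2 where "w2 = proj N1 1 w1"
  have w2: "w2 \<in> Phi" unfolding w2_def by (rule Phi_proj[OF w1])
  obtain N2 where N2: "vanishes_from N2 w2" using Phi_vanishes w2 by blast
  define w3 where "w3 = proj N2 2 w2"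
  have w3: "w3 \<in> Phi" unfolding w3_def by (rule Phi_proj[OF w2])
  \<comment> \<open>After substitution for all three variables the values are constants. The
    functional \<open>\<mu>\<close> reads them off: it is what remains of \<open>w\<close> modulo
    the differences.\<close>
  have "shift i (w3 s) = 0" for i s
  proof -
    have 0: "shift 0 (w1 s) = 0" for s unfolding w1_def by (rule shift_proj_self)
    have 1: "shift 1 (w2 s) = 0" for s unfolding w2_def by (rule shift_proj_self)
    have 01: "shift 0 (w2 s) = 0" for s unfolding w2_def by (rule shift_proj_other[OF _ 0]) simp
    have "shift 0 (w3 s) = 0" unfolding w3_def by (rule shift_proj_other[OF _ 01]) simp
    moreover have "shift 1 (w3 s) = 0" unfolding w3_def by (rule shift_proj_other[OF _ 1]) simp
    moreover have "shift 2 (w3 s) = 0" unfolding w3_def by (rule shift_proj_self)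
    ultimately show ?thesis using exhaust_three[of i] by auto
  qed
  then have w3_Const: "w3 s = Const (lookup (w3 s) 0)" for s by (rule shift_zero_imp_Const)
  define \<mu> where "\<mu> = (\<lambda>s. lookup (w3 s) 0)"
  have "\<exists>a\<in>Phi. \<exists>b\<in>Phi. \<exists>c\<in>Phi. (\<lambda>s. w (r * s)) = diff_op 0 a + diff_op 1 b + diff_op 2 c"
    if r: "\<forall>s. \<mu> (r * s) = 0" for r
  proof -
    \<comment> \<open>Precomposition with multiplication by \<open>r\<close> commutes with the
      differences, so the homotopies of \<open>w\<close> also serve the precomposed map.\<close>
    let ?h = "\<lambda>N i w. (\<lambda>s. homotopy N i w (r * s))"
    have D: "diff_op i w (r * s) = diff_op i (\<lambda>s. w (r * s)) s" for i w s
      by (simp add: diff_op_def mult.left_commute)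
    have "w (r * s) = diff_op 0 (?h N0 0 w) s + diff_op 1 (?h N1 1 w1) s + diff_op 2 (?h N2 2 w2) s" for s
    proof -
      have "w (r * s) = diff_op 0 (homotopy N0 0 w) (r * s) + w1 (r * s)"
        using homotopy[OF N0, of 0] unfolding w1_def by (metis plus_fun_apply)
      moreover have "w1 (r * s) = diff_op 1 (homotopy N1 1 w1) (r * s) + w2 (r * s)"
        using homotopy[OF N1, of 1] unfolding w2_def by (metis plus_fun_apply)
      moreover have "w2 (r * s) = diff_op 2 (homotopy N2 2 w2) (r * s) + w3 (r * s)"
        using homotopy[OF N2, of 2] unfolding w3_def by (metis plus_fun_apply)
      moreover have "w3 (r * s) = 0"
        using r w3_Const[of "r * s"] by (simp add: \<mu>_def Const_simps)
      ultimately show ?thesis by (simp add: D add.assoc)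
    qed
    then have "(\<lambda>s. w (r * s)) = diff_op 0 (?h N0 0 w) + diff_op 1 (?h N1 1 w1) + diff_op 2 (?h N2 2 w2)"
      by (simp add: fun_eq_iff)
    then show ?thesis using Phi_closed(6)[OF Phi_homotopy] w w1 w2 by blast
  qed
  then show ?thesis
    by (intro exI[of _ \<mu>]) (simp add: \<mu>_def klin_add[OF Phi_klin[OF w3]] klin_scale[OF Phi_klin[OF w3]]
        lookup_add lookup_Const_mult Phi_I[OF w3])
qed

end

section \<open>Complete intersections are Frobenius algebras\<close>

lemma Gen_1: "s \<in> Gen {a} \<longleftrightarrow> (\<exists>u. s = a * u)"
  unfolding Gen_insert Gen_empty by (auto simp: mult.commute)

lemma Gen_2: "s \<in> Gen {a, b} \<longleftrightarrow> (\<exists>u v. s = a * u + b * v)"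
  unfolding Gen_insert[of a "{b}"] by (auto simp: Gen_1 mult.commute)

lemma Gen_3: "s \<in> Gen {a, b, c} \<longleftrightarrow> (\<exists>u v w. s = a * u + b * v + c * w)"
  unfolding Gen_insert[of a "{b, c}"] by (auto simp: Gen_2 mult.commute add.assoc)

context cofinite_normal_form
begin

lemma Phi_extend: "(\<lambda>s. \<Sum>m\<in>B. Const (lookup (nf s) m) * U m) \<in> Phi"
proof -
  define L where "L = (\<lambda>s. \<Sum>m\<in>B. Const (lookup (nf s) m) * U m)"
  have "L (p + q) = L p + L q" for p q
    unfolding L_def klin_add[OF lin] lookup_add Const_simps(1) distrib_right sum.distrib ..
  moreover have "L (Const c * p) = Const c * L p" for c p
    unfolding L_def klin_scale[OF lin] lookup_Const_mult Const_simps(2) sum_distrib_left mult.assoc ..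
  moreover have "L f = 0" if "f \<in> I" for f
    using that nf_eq_0[OF nf, of f] by (simp add: L_def Const_simps)
  ultimately show ?thesis unfolding L_def[symmetric] by (simp add: Phi_def klin_def)
qed

text \<open>Coefficients chosen for each value separately need not be linear in \<open>s\<close>;
  chosen on the basis \<open>B\<close> and extended linearly, they are.\<close>

lemma Phi_lift3:
  assumes w: "w \<in> Phi" and v: "\<And>s. w s \<in> Gen {a, b, c}"
  shows "\<exists>x\<in>Phi. \<exists>y\<in>Phi. \<exists>z\<in>Phi. w = scal a * x + scal b * y + scal c * z"
proof -
  obtain x y z where xyz: "\<And>s. w s = a * x s + b * y s + c * z s"
    using v unfolding Gen_3 by metis
  let ?L = "\<lambda>U s. \<Sum>m\<in>B. Const (lookup (nf s) m) * U (monomial m)"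
  have "w s = a * ?L x s + b * ?L y s + c * ?L z s" for s
  proof -
    have "w s = (\<Sum>m\<in>B. Const (lookup (nf s) m) * w (monomial m))"
      using nf_expand[OF Phi_klin[OF w], of s] by (simp add: Phi_nf[OF w])
    also have "\<dots> = a * ?L x s + b * ?L y s + c * ?L z s"
      unfolding sum_distrib_left sum.distrib[symmetric]
      by (rule sum.cong) (simp_all add: xyz distrib_left mult.left_commute)
    finally show ?thesis .
  qed
  then have "w = scal a * ?L x + scal b * ?L y + scal c * ?L z"
    by (simp add: fun_eq_iff scal_def)
  then show ?thesis using Phi_extend[of "\<lambda>m. x (monomial m)"] Phi_extend[of "\<lambda>m. y (monomial m)"]
      Phi_extend[of "\<lambda>m. z (monomial m)"] by blast
qed

lemma Phi_lift2:
  assumes w: "w \<in> Phi" and v: "\<And>s. w s \<in> Gen {a, b}"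
  shows "\<exists>x\<in>Phi. \<exists>y\<in>Phi. w = scal a * x + scal b * y"
proof -
  have "w s \<in> Gen {a, b, 0}" for s using v[of s] by (auto simp: Gen_2 Gen_3)
  moreover have "scal 0 = (0 :: 'k poly3 \<Rightarrow> 'k poly3)" by (simp add: scal_def fun_eq_iff)
  ultimately show ?thesis using Phi_lift3[OF w, of a b 0] by auto
qed

lemma Phi_lift1:
  assumes w: "w \<in> Phi" and v: "\<And>s. w s \<in> Gen {a}"
  shows "\<exists>x\<in>Phi. w = scal a * x"
proof -
  have "w s \<in> Gen {a, 0}" for s using v[of s] by (auto simp: Gen_1 Gen_2)
  moreover have "scal 0 = (0 :: 'k poly3 \<Rightarrow> 'k poly3)" by (simp add: scal_def fun_eq_iff)
  ultimately show ?thesis using Phi_lift2[OF w, of a 0] by auto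
qed

context
  fixes a1 a2 a3 :: "'k poly3"
  assumes I_Gen: "I = Gen {a3, a2, a1}"
    and nzd1: "\<And>s. a1 * s = 0 \<Longrightarrow> s = 0"
    and nzd2: "\<And>s. a2 * s \<in> Gen {a1} \<Longrightarrow> s \<in> Gen {a1}"
    and nzd3: "\<And>s. a3 * s \<in> Gen {a2, a1} \<Longrightarrow> s \<in> Gen {a2, a1}"
begin

lemma cancel1: "scal a1 * w = 0 \<Longrightarrow> w = 0"
proof
  fix s
  assume "scal a1 * w = 0"
  then have "(scal a1 * w) s = 0" by simp
  then show "w s = 0 s" using nzd1[of "w s"] by (simp add: scal_def)
qed

text \<open>Regularity of \<open>a2\<close> modulo \<open>a1\<close> is applied to each value, and
  \<open>Phi_lift1\<close> assembles the quotients into a linear map.\<close>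

lemma cancel2:
  assumes "u \<in> Phi" and e: "scal a2 * u + scal a1 * v = 0"
  shows "\<exists>x\<in>Phi. u = scal a1 * x"
proof (rule Phi_lift1[OF assms(1) nzd2])
  fix s
  have "(scal a2 * u + scal a1 * v) s = 0" using e by simp
  then have "a2 * u s = a1 * (- v s)" by (simp add: scal_def eq_neg_iff_add_eq_0)
  then show "a2 * u s \<in> Gen {a1}" unfolding Gen_1 by blast
qed

lemma cancel3:
  assumes "u \<in> Phi" and e: "scal a3 * u + scal a2 * v + scal a1 * t = 0"
  shows "\<exists>x\<in>Phi. \<exists>y\<in>Phi. u = scal a2 * x + scal a1 * y"
proof (rule Phi_lift2[OF assms(1) nzd3])
  fix s
  have "(scal a3 * u + scal a2 * v + scal a1 * t) s = 0" using e by simp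
  then have "a3 * u s = a2 * (- v s) + a1 * (- t s)" by (simp add: scal_def eq_neg_iff_add_eq_0 algebra_simps)
  then show "a3 * u s \<in> Gen {a2, a1}" unfolding Gen_2 by blast
qed

text \<open>Exactness modulo \<open>a1\<close>. The defect \<open>c\<close> is closed, since
  \<open>a1\<close> times it is a coboundary and \<open>a1\<close> can be cancelled. By
  \<open>koszul_H2\<close> it is the coboundary of some \<open>e\<close>, and subtracting
  \<open>a1\<close> times \<open>e\<close> makes \<open>t\<close> closed.\<close>

lemma koszul_H1_mod:
  assumes P: "t0 \<in> Phi" "t1 \<in> Phi" "t2 \<in> Phi" "c01 \<in> Phi" "c02 \<in> Phi" "c12 \<in> Phi"
    and e: "diff_op 0 t1 - diff_op 1 t0 = scal a1 * c01" "diff_op 0 t2 - diff_op 2 t0 = scal a1 * c02"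
      "diff_op 1 t2 - diff_op 2 t1 = scal a1 * c12"
  shows "\<exists>u\<in>Phi. \<exists>e0\<in>Phi. \<exists>e1\<in>Phi. \<exists>e2\<in>Phi. t0 = diff_op 0 u + scal a1 * e0 \<and>
    t1 = diff_op 1 u + scal a1 * e1 \<and> t2 = diff_op 2 u + scal a1 * e2"
proof -
  have "scal a1 * (diff_op 0 c12 - diff_op 1 c02 + diff_op 2 c01) =
      diff_op 0 (scal a1 * c12) - diff_op 1 (scal a1 * c02) + diff_op 2 (scal a1 * c01)"
    unfolding diff_op_simps by (simp add: algebra_simps)
  also have "\<dots> = 0"
    unfolding e[symmetric]
    by (simp add: diff_op_simps diff_op_commute[of 1 0] diff_op_commute[of 2 0] diff_op_commute[of 2 1])
  finally obtain e0 e1 e2 where E: "e0 \<in> Phi" "e1 \<in> Phi" "e2 \<in> Phi"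
    "c01 = diff_op 0 e1 - diff_op 1 e0" "c02 = diff_op 0 e2 - diff_op 2 e0" "c12 = diff_op 1 e2 - diff_op 2 e1"
    using koszul_H2[OF P(6,5,4) cancel1] by blast
  have "\<exists>u\<in>Phi. t0 - scal a1 * e0 = diff_op 0 u \<and> t1 - scal a1 * e1 = diff_op 1 u \<and> t2 - scal a1 * e2 = diff_op 2 u"
  proof (rule koszul_H1)
    show "diff_op 0 (t1 - scal a1 * e1) = diff_op 1 (t0 - scal a1 * e0)"
      using e(1) unfolding diff_op_simps E(4) by (simp add: algebra_simps)
    show "diff_op 0 (t2 - scal a1 * e2) = diff_op 2 (t0 - scal a1 * e0)"
      using e(2) unfolding diff_op_simps E(5) by (simp add: algebra_simps)
  qed (use P E(1-3) in \<open>simp_all add: Phi_closed\<close>)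
  then obtain u where "u \<in> Phi" "t0 - scal a1 * e0 = diff_op 0 u" "t1 - scal a1 * e1 = diff_op 1 u"
    "t2 - scal a1 * e2 = diff_op 2 u" by blast
  then show ?thesis using E(1-3) by (metis diff_add_cancel)
qed

text \<open>The zigzag run backwards. An exact end \<open>w\<close> lets \<open>v\<close>,
  \<open>t\<close> and at last \<open>\<sigma>\<close> be corrected by multiples of the sequence
  until nothing remains, so \<open>\<sigma>\<close> is a combination of \<open>a1\<close>,
  \<open>a2\<close>, \<open>a3\<close> with coefficients in \<open>Phi\<close>.\<close>

lemma zigzag_descent:
  assumes P: "w \<in> Phi" "\<And>i. t i \<in> Phi" "\<And>i. t' i \<in> Phi" "\<And>i. t'' i \<in> Phi"
      "\<And>i j. v i j \<in> Phi" "\<And>i j. v' i j \<in> Phi" "\<sigma> \<in> Phi" "a \<in> Phi" "b \<in> Phi" "c \<in> Phi"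
    and t: "\<And>i. diff_op i \<sigma> = scal a3 * t i + scal a2 * t' i + scal a1 * t'' i"
    and v: "\<And>i j. diff_op i (t j) - diff_op j (t i) = scal a2 * v i j + scal a1 * v' i j"
    and w: "diff_op 0 (v 1 2) - diff_op 1 (v 0 2) + diff_op 2 (v 0 1) = scal a1 * w"
    and exact: "w = diff_op 0 a + diff_op 1 b + diff_op 2 c"
  shows "\<sigma> s \<in> I"
proof -
  \<comment> \<open>Absorbing the exact \<open>w\<close> into \<open>v\<close> makes
    \<open>v\<close> closed, hence a coboundary up to multiples of \<open>a1\<close>.\<close>
  have "diff_op 0 (v 1 2 - scal a1 * a) - diff_op 1 (v 0 2 + scal a1 * b) + diff_op 2 (v 0 1 - scal a1 * c) =
      (diff_op 0 (v 1 2) - diff_op 1 (v 0 2) + diff_op 2 (v 0 1)) - scal a1 * w"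
    unfolding exact unfolding diff_op_simps by (simp add: algebra_simps)
  also have "\<dots> = 0" by (simp add: w)
  finally obtain b0 b1 b2 where b: "b0 \<in> Phi" "b1 \<in> Phi" "b2 \<in> Phi"
      "v 0 1 - scal a1 * c = diff_op 0 b1 - diff_op 1 b0"
      "v 0 2 + scal a1 * b = diff_op 0 b2 - diff_op 2 b0"
      "v 1 2 - scal a1 * a = diff_op 1 b2 - diff_op 2 b1"
    using koszul_H2[of "v 1 2 - scal a1 * a" "v 0 2 + scal a1 * b" "v 0 1 - scal a1 * c"] P
    by (auto simp: Phi_closed)
  have v01: "v 0 1 = diff_op 0 b1 - diff_op 1 b0 + scal a1 * c"
    and v02: "v 0 2 = diff_op 0 b2 - diff_op 2 b0 - scal a1 * b"
    and v12: "v 1 2 = diff_op 1 b2 - diff_op 2 b1 + scal a1 * a"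
    using b(4-6) by (simp_all add: algebra_simps)
  have d: "diff_op i (t j - scal a2 * y) - diff_op j (t i - scal a2 * x) =
      scal a2 * (v i j - (diff_op i y - diff_op j x)) + scal a1 * v' i j" for i j x y
    using v[of i j] unfolding diff_op_simps by (simp add: algebra_simps)
  have "\<exists>u\<in>Phi. \<exists>e0\<in>Phi. \<exists>e1\<in>Phi. \<exists>e2\<in>Phi. t 0 - scal a2 * b0 = diff_op 0 u + scal a1 * e0 \<and>
    t 1 - scal a2 * b1 = diff_op 1 u + scal a1 * e1 \<and> t 2 - scal a2 * b2 = diff_op 2 u + scal a1 * e2"
  proof (rule koszul_H1_mod)
    show "diff_op 0 (t 1 - scal a2 * b1) - diff_op 1 (t 0 - scal a2 * b0) = scal a1 * (scal a2 * c + v' 0 1)"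
      unfolding d v01 by (simp add: algebra_simps)
    show "diff_op 0 (t 2 - scal a2 * b2) - diff_op 2 (t 0 - scal a2 * b0) = scal a1 * (- (scal a2 * b) + v' 0 2)"
      unfolding d v02 by (simp add: algebra_simps)
    show "diff_op 1 (t 2 - scal a2 * b2) - diff_op 2 (t 1 - scal a2 * b1) = scal a1 * (scal a2 * a + v' 1 2)"
      unfolding d v12 by (simp add: algebra_simps)
  qed (use P b in \<open>simp_all add: Phi_closed\<close>)
  then obtain u e0 e1 e2 where u: "u \<in> Phi" "e0 \<in> Phi" "e1 \<in> Phi" "e2 \<in> Phi"
      "t 0 - scal a2 * b0 = diff_op 0 u + scal a1 * e0"
      "t 1 - scal a2 * b1 = diff_op 1 u + scal a1 * e1"
      "t 2 - scal a2 * b2 = diff_op 2 u + scal a1 * e2"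
    by blast
  define bb where "bb = (\<lambda>i :: 3. if i = 0 then b0 else if i = 1 then b1 else b2)"
  define ee where "ee = (\<lambda>i :: 3. if i = 0 then e0 else if i = 1 then e1 else e2)"
  have tu: "t i = diff_op i u + scal a2 * bb i + scal a1 * ee i" for i
    using exhaust_three[of i] u(5-7) by (auto simp: bb_def ee_def algebra_simps)
  define p where "p = (\<lambda>i. scal a3 * bb i + t' i)"
  define q where "q = (\<lambda>i. scal a3 * ee i + t'' i)"
  have Pp: "p i \<in> Phi" "q i \<in> Phi" for i
    using P b u by (auto simp: p_def q_def bb_def ee_def Phi_closed)
  \<comment> \<open>Subtracting \<open>a3\<close> times the potential of \<open>t\<close> removes
    \<open>a3\<close> from the differences of \<open>\<sigma>\<close>; \<open>y\<close> and
    \<open>y'\<close> do the same for \<open>a2\<close> and \<open>a1\<close>.\<close>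
  define \<tau> where "\<tau> = \<sigma> - scal a3 * u"
  have \<tau>: "\<tau> \<in> Phi" using P u by (simp add: \<tau>_def Phi_closed)
  have D\<tau>: "diff_op i \<tau> = scal a2 * p i + scal a1 * q i" for i
    unfolding \<tau>_def p_def q_def diff_op_simps t tu by (simp add: algebra_simps)
  have "\<exists>g\<in>Phi. diff_op i (p j) - diff_op j (p i) = scal a1 * g" for i j
  proof (rule cancel2)
    have "scal a2 * (diff_op i (p j) - diff_op j (p i)) + scal a1 * (diff_op i (q j) - diff_op j (q i)) =
        diff_op i (diff_op j \<tau>) - diff_op j (diff_op i \<tau>)"
      unfolding D\<tau> unfolding diff_op_simps by (simp add: algebra_simps)
    then show "scal a2 * (diff_op i (p j) - diff_op j (p i)) + scal a1 * (diff_op i (q j) - diff_op j (q i)) = 0"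
      using diff_op_commute[of i j \<tau>] by simp
  qed (simp add: Pp Phi_closed Phi_diff_op)
  then obtain g where g: "\<And>i j. g i j \<in> Phi" "\<And>i j. diff_op i (p j) - diff_op j (p i) = scal a1 * g i j"
    by metis
  have "\<exists>y\<in>Phi. \<exists>h0\<in>Phi. \<exists>h1\<in>Phi. \<exists>h2\<in>Phi. p 0 = diff_op 0 y + scal a1 * h0 \<and>
    p 1 = diff_op 1 y + scal a1 * h1 \<and> p 2 = diff_op 2 y + scal a1 * h2"
    by (rule koszul_H1_mod[OF Pp(1) Pp(1) Pp(1) g(1) g(1) g(1) g(2) g(2) g(2)])
  then obtain y h0 h1 h2 where y: "y \<in> Phi" "h0 \<in> Phi" "h1 \<in> Phi" "h2 \<in> Phi"
    "p 0 = diff_op 0 y + scal a1 * h0" "p 1 = diff_op 1 y + scal a1 * h1" "p 2 = diff_op 2 y + scal a1 * h2"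
    by blast
  define hh where "hh = (\<lambda>i :: 3. if i = 0 then h0 else if i = 1 then h1 else h2)"
  have py: "p i = diff_op i y + scal a1 * hh i" for i
    using exhaust_three[of i] y(5-7) by (auto simp: hh_def)
  define q' where "q' = (\<lambda>i. scal a2 * hh i + q i)"
  have Pq': "q' i \<in> Phi" for i using y Pp by (auto simp: q'_def hh_def Phi_closed)
  have D\<tau>': "diff_op i (\<tau> - scal a2 * y) = scal a1 * q' i" for i
    unfolding diff_op_simps D\<tau> py q'_def by (simp add: algebra_simps)
  have closed: "diff_op i (q' j) = diff_op j (q' i)" for i j
  proof -
    have "scal a1 * (diff_op i (q' j) - diff_op j (q' i)) =
        diff_op i (scal a1 * q' j) - diff_op j (scal a1 * q' i)"
      unfolding diff_op_simps by (simp add: algebra_simps)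
    also have "\<dots> = 0"
      unfolding D\<tau>'[symmetric] using diff_op_commute[of i j "\<tau> - scal a2 * y"] by simp
    finally have "diff_op i (q' j) - diff_op j (q' i) = 0" by (rule cancel1)
    then show ?thesis by simp
  qed
  obtain y' where y': "y' \<in> Phi" "q' 0 = diff_op 0 y'"
    using koszul_H1[OF Pq' Pq' Pq' closed closed] by blast
  \<comment> \<open>All differences are used up, and injectivity of \<open>diff_op 0\<close> leaves
    no constant of integration.\<close>
  have "\<tau> - scal a2 * y - scal a1 * y' = 0"
  proof (rule koszul_inj)
    show "\<tau> - scal a2 * y - scal a1 * y' \<in> Phi" using \<tau> y y' by (simp add: Phi_closed)
    have "diff_op 0 (\<tau> - scal a2 * y - scal a1 * y') = diff_op 0 (\<tau> - scal a2 * y) - scal a1 * diff_op 0 y'"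
      by (simp add: diff_op_simps)
    then show "diff_op 0 (\<tau> - scal a2 * y - scal a1 * y') = 0" unfolding D\<tau>' y'(2) by simp
  qed
  then have "\<sigma> = scal a3 * u + scal a2 * y + scal a1 * y'" by (simp add: \<tau>_def algebra_simps)
  then have "\<sigma> s = a3 * u s + a2 * y s + a1 * y' s" by (simp add: scal_def)
  then show ?thesis unfolding I_Gen Gen_3 by blast
qed

text \<open>The section \<open>nf\<close> commutes with the variables only modulo \<open>I\<close>,
  so its differences are combinations of the sequence. Taking differences again and cancelling by
  regularity trades one element of the sequence for one degree of the Koszul complex, until all
  three are used.\<close>

lemma zigzag:
  "\<exists>t t' t'' v v' w. (\<forall>i. t i \<in> Phi \<and> t' i \<in> Phi \<and> t'' i \<in> Phi) \<and> (\<forall>i j. v i j \<in> Phi \<and> v' i j \<in> Phi) \<and> w \<in> Phi \<and>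
    (\<forall>i. diff_op i nf = scal a3 * t i + scal a2 * t' i + scal a1 * t'' i) \<and>
    (\<forall>i j. diff_op i (t j) - diff_op j (t i) = scal a2 * v i j + scal a1 * v' i j) \<and>
    diff_op 0 (v 1 2) - diff_op 1 (v 0 2) + diff_op 2 (v 0 1) = scal a1 * w"
proof -
  have nfP: "nf \<in> Phi" using nf_eq_0[OF nf] by (simp add: Phi_def lin)
  have "diff_op i nf s \<in> Gen {a3, a2, a1}" for i s
    unfolding I_Gen[symmetric] nf_eq_0[OF nf, symmetric]
    by (simp add: diff_op_def klin_diff[OF lin] nf_nf[OF nf] nf_mult_nf[OF nf I])
  then have "\<exists>x\<in>Phi. \<exists>y\<in>Phi. \<exists>z\<in>Phi. diff_op i nf = scal a3 * x + scal a2 * y + scal a1 * z" for i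
    by (rule Phi_lift3[OF Phi_diff_op[OF nfP]])
  then obtain t t' t'' where P: "\<And>i. t i \<in> Phi" "\<And>i. t' i \<in> Phi" "\<And>i. t'' i \<in> Phi"
    and t: "\<And>i. diff_op i nf = scal a3 * t i + scal a2 * t' i + scal a1 * t'' i"
    by metis
  have "\<exists>x\<in>Phi. \<exists>y\<in>Phi. diff_op i (t j) - diff_op j (t i) = scal a2 * x + scal a1 * y" for i j
  proof (rule cancel3)
    have "scal a3 * (diff_op i (t j) - diff_op j (t i)) + scal a2 * (diff_op i (t' j) - diff_op j (t' i)) +
        scal a1 * (diff_op i (t'' j) - diff_op j (t'' i)) = diff_op i (diff_op j nf) - diff_op j (diff_op i nf)"
      unfolding t unfolding diff_op_simps by (simp add: algebra_simps)
    then show "scal a3 * (diff_op i (t j) - diff_op j (t i)) + scal a2 * (diff_op i (t' j) - diff_op j (t' i)) +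
        scal a1 * (diff_op i (t'' j) - diff_op j (t'' i)) = 0"
      using diff_op_commute[of i j nf] by simp
  qed (simp add: P Phi_closed Phi_diff_op)
  then obtain v v' where V: "\<And>i j. v i j \<in> Phi" "\<And>i j. v' i j \<in> Phi"
    and v: "\<And>i j. diff_op i (t j) - diff_op j (t i) = scal a2 * v i j + scal a1 * v' i j"
    by metis
  have "\<exists>w\<in>Phi. diff_op 0 (v 1 2) - diff_op 1 (v 0 2) + diff_op 2 (v 0 1) = scal a1 * w"
  proof (rule cancel2)
    have "scal a2 * (diff_op 0 (v 1 2) - diff_op 1 (v 0 2) + diff_op 2 (v 0 1)) +
        scal a1 * (diff_op 0 (v' 1 2) - diff_op 1 (v' 0 2) + diff_op 2 (v' 0 1)) =
        diff_op 0 (scal a2 * v 1 2 + scal a1 * v' 1 2) - diff_op 1 (scal a2 * v 0 2 + scal a1 * v' 0 2) +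
        diff_op 2 (scal a2 * v 0 1 + scal a1 * v' 0 1)"
      unfolding diff_op_simps by (simp add: algebra_simps)
    also have "\<dots> = 0"
      unfolding v[symmetric]
      by (simp add: diff_op_simps diff_op_commute[of 1 0] diff_op_commute[of 2 0] diff_op_commute[of 2 1])
    finally show "scal a2 * (diff_op 0 (v 1 2) - diff_op 1 (v 0 2) + diff_op 2 (v 0 1)) +
        scal a1 * (diff_op 0 (v' 1 2) - diff_op 1 (v' 0 2) + diff_op 2 (v' 0 1)) = 0" .
  qed (simp add: V Phi_closed Phi_diff_op)
  then show ?thesis using P V t v by metis
qed

text \<open>If \<open>\<mu>\<close> kills all multiples of \<open>r\<close>, then the zigzag of the
  map sending s to \<open>nf (r * s)\<close> ends in an exact \<open>w\<close>, and the descent puts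
  \<open>nf r\<close>, hence \<open>r\<close>, into \<open>I\<close>.\<close>

theorem frobenius_form:
  "\<exists>\<mu>. (\<forall>p q. \<mu> (p + q) = \<mu> p + \<mu> q) \<and> (\<forall>c p. \<mu> (Const c * p) = c * \<mu> p) \<and>
    (\<forall>f\<in>I. \<mu> f = (0::'k)) \<and> (\<forall>r. (\<forall>s. \<mu> (r * s) = 0) \<longrightarrow> r \<in> I)"
proof -
  obtain t t' t'' v v' w where P: "\<And>i. t i \<in> Phi" "\<And>i. t' i \<in> Phi" "\<And>i. t'' i \<in> Phi"
      "\<And>i j. v i j \<in> Phi" "\<And>i j. v' i j \<in> Phi" "w \<in> Phi"
    and t: "\<And>i. diff_op i nf = scal a3 * t i + scal a2 * t' i + scal a1 * t'' i"
    and v: "\<And>i j. diff_op i (t j) - diff_op j (t i) = scal a2 * v i j + scal a1 * v' i j"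
    and w: "diff_op 0 (v 1 2) - diff_op 1 (v 0 2) + diff_op 2 (v 0 1) = scal a1 * w"
    using zigzag by metis
  obtain \<mu> where \<mu>: "\<forall>p q. \<mu> (p + q) = \<mu> p + \<mu> q" "\<forall>c p. \<mu> (Const c * p) = c * \<mu> p" "\<forall>f\<in>I. \<mu> f = (0::'k)"
    and top: "\<And>r. \<forall>s. \<mu> (r * s) = 0 \<Longrightarrow> \<exists>a\<in>Phi. \<exists>b\<in>Phi. \<exists>c\<in>Phi.
      (\<lambda>s. w (r * s)) = diff_op 0 a + diff_op 1 b + diff_op 2 c"
    using koszul_top[OF P(6)] by metis
  have "r \<in> I" if r: "\<forall>s. \<mu> (r * s) = 0" for r
  proof -
    define cr :: "('k poly3 \<Rightarrow> 'k poly3) \<Rightarrow> 'k poly3 \<Rightarrow> 'k poly3" where "cr = (\<lambda>u s. u (r * s))"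
    have cr: "cr (x + y) = cr x + cr y" "cr (x - y) = cr x - cr y" "cr (scal a * x) = scal a * cr x"
      "diff_op i (cr x) = cr (diff_op i x)" for x y a i
      by (auto simp: cr_def scal_def diff_op_def mult.left_commute)
    have crP: "x \<in> Phi \<Longrightarrow> cr x \<in> Phi" for x unfolding cr_def by (rule Phi_closed)
    have nfP: "nf \<in> Phi" using nf_eq_0[OF nf] by (simp add: Phi_def lin)
    obtain a b c where abc: "a \<in> Phi" "b \<in> Phi" "c \<in> Phi" "cr w = diff_op 0 a + diff_op 1 b + diff_op 2 c"
      using top[OF r] unfolding cr_def by blast
    have "cr nf 1 \<in> I"
    proof (rule zigzag_descent[where a = a and b = b and c = c and \<sigma> = "cr nf" and w = "cr w" and t = "\<lambda>i. cr (t i)" and t' = "\<lambda>i. cr (t' i)"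
          and t'' = "\<lambda>i. cr (t'' i)" and v = "\<lambda>i j. cr (v i j)" and v' = "\<lambda>i j. cr (v' i j)"])
      show "diff_op i (cr nf) = scal a3 * cr (t i) + scal a2 * cr (t' i) + scal a1 * cr (t'' i)" for i
        unfolding cr(4) t by (simp add: cr)
      show "diff_op i (cr (t j)) - diff_op j (cr (t i)) = scal a2 * cr (v i j) + scal a1 * cr (v' i j)" for i j
        unfolding cr(4) cr(2)[symmetric] v by (simp add: cr)
      show "diff_op 0 (cr (v 1 2)) - diff_op 1 (cr (v 0 2)) + diff_op 2 (cr (v 0 1)) = scal a1 * cr w"
        unfolding cr(4) cr(1)[symmetric] cr(2)[symmetric] w by (simp add: cr)
    qed (fact abc(4) | rule crP | rule P abc nfP)+
    then have "nf r \<in> I" by (simp add: cr_def)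
    then show "r \<in> I" using nf_eq_0[OF nf] nf_nf[OF nf] by metis
  qed
  then show ?thesis using \<mu> by blast
qed

end

end

section \<open>Parity for homogeneous ideals\<close>

lemma lookup_hom_component: "lookup (hom_component n f) m = (if total_deg m = n then lookup f m else 0)"
proof -
  have "lookup (hom_component n f) m =
      (\<Sum>k | k \<in> keys f \<and> total_deg k = n. if k = m then lookup f k else 0)"
    unfolding hom_component_def lookup_sum by (rule sum.cong) (auto simp: lookup_single when_def)
  then show ?thesis by (auto simp: in_keys_iff)
qed

lemma total_deg_add: "total_deg (m + n) = total_deg m + total_deg n"
  by (simp add: total_deg_def lookup_add sum.distrib)

lemma total_deg_single: "total_deg (Poly_Mapping.single i n) = n"
proof -
  have "total_deg (Poly_Mapping.single i n) = (\<Sum>j\<in>UNIV. if j = i then n else 0)"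
    unfolding total_deg_def by (rule sum.cong) (auto simp: lookup_single when_def)
  then show ?thesis by simp
qed

lemma three_arith: "(l::3) + 1 + 1 = l + 2" "l + 1 + 2 = l" "l + 2 + 1 = l" "l + 2 + 2 = l + 1"
  "l + 1 \<noteq> l + 2" "l + 2 \<noteq> l + 1"
  using exhaust_three[of l] by auto

lemma three_cases: "(i::3) = j \<or> (\<exists>l. i = l + 1 \<and> j = l + 2) \<or> (\<exists>l. i = l + 2 \<and> j = l + 1)"
proof -
  have "j = i \<or> j = i + 1 \<or> j = i + 2"
    using exhaust_three[of i] exhaust_three[of j] by auto
  then show ?thesis
    by (metis three_arith(2) three_arith(3) three_arith(1) three_arith(4))
qed

context cofinite_normal_form
begin

text \<open>The symmetric matrix of the quadratic form with values \<open>tr (P\<^sub>0 [X\<^sub>1, P\<^sub>2]) + \<dots>\<close> on triples of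
  operators; its radical is \<open>Z1\<close>.\<close>

definition form :: "3 \<times> (3 \<Rightarrow>\<^sub>0 nat) \<times> (3 \<Rightarrow>\<^sub>0 nat) \<Rightarrow> 3 \<times> (3 \<Rightarrow>\<^sub>0 nat) \<times> (3 \<Rightarrow>\<^sub>0 nat) \<Rightarrow> 'k" where
  "form = (\<lambda>(l, a, b) (j, c, e).
     (if j = l + 2 then (if e = a then X (l + 1) b c else 0) - (if c = b then X (l + 1) e a else 0) else 0) -
     (if j = l + 1 then (if e = a then X (l + 2) b c else 0) - (if c = b then X (l + 2) e a else 0) else 0))"

text \<open>Indices are cyclic modulo 3: exchanging the arguments exchanges the branches
  \<open>j = l + 1\<close> and \<open>j = l + 2\<close>, and the change of sign is compensated by
  the exchange of the two terms inside a branch.\<close>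

lemma form_symmetric: "form x y = form y x"
proof -
  obtain l a b where x: "x = (l, a, b)" by (cases x)
  obtain j c e where y: "y = (j, c, e)" by (cases y)
  consider "j = l" | "j = l + 1" | "j = l + 2"
    using exhaust_three[of l] exhaust_three[of j] by fastforce
  then show ?thesis
  proof cases
    case 1
    have "l + 1 \<noteq> l" "l + 2 \<noteq> l" using exhaust_three[of l] by auto
    then show ?thesis using 1 by (simp add: form_def x y)
  next
    case 2
    then have c: "(j = l + 1) = True" "(l = j + 2) = True" "(j = l + 2) = False" "(l = j + 1) = False"
      and e: "l + 2 = j + 1"
      using exhaust_three[of l] by auto
    show ?thesis unfolding form_def x y prod.case c if_True if_False e by auto
  next
    case 3
    then have c: "(j = l + 2) = True" "(l = j + 1) = True" "(j = l + 1) = False" "(l = j + 2) = False"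
      and e: "l + 1 = j + 2"
      using exhaust_three[of l] by auto
    show ?thesis unfolding form_def x y prod.case c if_True if_False e by auto
  qed
qed

text \<open>Pairing with the elementary matrix at \<open>(a, b)\<close> in slot \<open>l\<close>
  reads off one entry of a difference of commutators; the trace transposes its position.\<close>

lemma sum_form:
  assumes "a \<in> B" "b \<in> B"
  shows "(\<Sum>x\<in>UNIV \<times> B \<times> B. form (l, a, b) x * g x) = ent g (l + 1) (l + 2) b a - ent g (l + 2) (l + 1) b a"
proof -
  have *: "(\<Sum>c\<in>B. \<Sum>e\<in>B. ((if e = a then X i b c else 0) - (if c = b then X i e a else 0)) * h c e) =
      (\<Sum>c\<in>B. X i b c * h c a) - (\<Sum>e\<in>B. h b e * X i e a)" for i h
  proof -
    have "(\<Sum>c\<in>B. \<Sum>e\<in>B. ((if e = a then X i b c else 0) - (if c = b then X i e a else 0)) * h c e) =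
      (\<Sum>c\<in>B. \<Sum>e\<in>B. if e = a then X i b c * h c e else 0) - (\<Sum>c\<in>B. \<Sum>e\<in>B. if c = b then h c e * X i e a else 0)"
      unfolding sum_subtractf[symmetric]
      by (intro sum.cong refl) (auto simp: algebra_simps)
    also have "(\<Sum>c\<in>B. \<Sum>e\<in>B. if c = b then h c e * X i e a else 0) = (\<Sum>e\<in>B. \<Sum>c\<in>B. if c = b then h c e * X i e a else 0)"
      by (rule sum.swap)
    finally show ?thesis using assms B by simp
  qed
  let ?A = "\<lambda>i j. \<Sum>c\<in>B. \<Sum>e\<in>B. ((if e = a then X i b c else 0) - (if c = b then X i e a else 0)) * g (j, c, e)"
  have "(\<Sum>x\<in>UNIV \<times> B \<times> B. form (l, a, b) x * g x) = (\<Sum>j\<in>UNIV. \<Sum>c\<in>B. \<Sum>e\<in>B. form (l, a, b) (j, c, e) * g (j, c, e))"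
    by (simp add: sum.cartesian_product case_prod_unfold)
  also have "\<dots> = (\<Sum>j\<in>UNIV. (if j = l + 2 then ?A (l + 1) j else 0) - (if j = l + 1 then ?A (l + 2) j else 0))"
  proof (rule sum.cong[OF refl])
    fix j
    let ?d = "\<lambda>i c e. (if e = a then X i b c else 0) - (if c = b then X i e a else 0)"
    have "(\<Sum>c\<in>B. \<Sum>e\<in>B. form (l, a, b) (j, c, e) * g (j, c, e)) =
        (\<Sum>c\<in>B. \<Sum>e\<in>B. if j = l + 2 then ?d (l + 1) c e * g (j, c, e) else 0) -
        (\<Sum>c\<in>B. \<Sum>e\<in>B. if j = l + 1 then ?d (l + 2) c e * g (j, c, e) else 0)"
      unfolding sum_subtractf[symmetric]
      by (intro sum.cong refl) (auto simp: form_def three_arith algebra_simps)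
    then show "(\<Sum>c\<in>B. \<Sum>e\<in>B. form (l, a, b) (j, c, e) * g (j, c, e)) =
        (if j = l + 2 then ?A (l + 1) j else 0) - (if j = l + 1 then ?A (l + 2) j else 0)"
      by (simp split del: if_split cong: if_cong) auto
  qed
  also have "\<dots> = ?A (l + 1) (l + 2) - ?A (l + 2) (l + 1)"
    by (simp add: sum_subtractf)
  finally show ?thesis by (simp add: * ent_def)
qed

lemma Z1_radical: "Z1 = {g \<in> supp (UNIV \<times> B \<times> B). \<forall>y\<in>UNIV \<times> B \<times> B. (\<Sum>x\<in>UNIV \<times> B \<times> B. form y x * g x) = 0}"
proof (intro equalityI subsetI)
  fix g assume "g \<in> Z1"
  then show "g \<in> {g \<in> supp (UNIV \<times> B \<times> B). \<forall>y\<in>UNIV \<times> B \<times> B. (\<Sum>x\<in>UNIV \<times> B \<times> B. form y x * g x) = 0}"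
    by (auto simp: Z1_def sum_form)
next
  fix g assume g: "g \<in> {g \<in> supp (UNIV \<times> B \<times> B). \<forall>y\<in>UNIV \<times> B \<times> B. (\<Sum>x\<in>UNIV \<times> B \<times> B. form y x * g x) = 0}"
  have *: "ent g (l + 1) (l + 2) b a = ent g (l + 2) (l + 1) b a" if "a \<in> B" "b \<in> B" for l a b
    using g that sum_form[OF that, of l g] by auto
  have "ent g i j a b = ent g j i a b" if "a \<in> B" "b \<in> B" for i j a b
    using three_cases[of i j] *[OF that(2,1)] by metis
  then show "g \<in> Z1" using g by (auto simp: Z1_def)
qed

text \<open>\<open>form\<close> is block off-diagonal, so its radical is the sum of the kernels of
  one block and of its transpose, and the dimensions of these differ by the difference of the block
  sizes.\<close>

lemma even_dim_Z1:
  assumes hom: "\<And>m a. a \<in> keys (nf (monomial m)) \<Longrightarrow> total_deg a = total_deg m"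
  shows "even (KF.dim Z1 + card B)"
proof -
  \<comment> \<open>The matrix entry \<open>(a, b)\<close> has degree total_deg a - total_deg b, and
    \<open>w\<close> selects the negative degrees. As n and -1 - n are never both negative or both
    nonnegative, \<open>Pos\<close> (the negative degrees) and \<open>Neg\<close> each pair
    trivially with themselves.\<close>
  define w :: "3 \<times> (3 \<Rightarrow>\<^sub>0 nat) \<times> (3 \<Rightarrow>\<^sub>0 nat) \<Rightarrow> bool" where "w = (\<lambda>(l, a, b). total_deg a < total_deg b)"
  define Om where "Om = (UNIV :: 3 set) \<times> B \<times> B"
  define Pos where "Pos = {x \<in> Om. w x}"
  define Neg where "Neg = {x \<in> Om. \<not> w x}"
  have fin: "finite Pos" "finite Neg" "finite Om" using B by (auto simp: Pos_def Neg_def Om_def)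
  have Om: "Om = Pos \<union> Neg" "Pos \<inter> Neg = {}" by (auto simp: Pos_def Neg_def)
  have Xdeg: "X i a b \<noteq> 0 \<Longrightarrow> total_deg a = total_deg b + 1" for i a b
    using hom[of a "Poly_Mapping.single i 1 + b"]
    by (simp add: X_def var_def monomial_mult in_keys_iff total_deg_add total_deg_single)
  have form0: "form x y = 0" if "w x = w y" for x y
  proof (rule ccontr)
    assume n: "form x y \<noteq> 0"
    obtain l a b where x: "x = (l, a, b)" by (cases x)
    obtain j c e where y: "y = (j, c, e)" by (cases y)
    have "(\<exists>i. e = a \<and> X i b c \<noteq> 0) \<or> (\<exists>i. c = b \<and> X i e a \<noteq> 0)"
      using n unfolding form_def x y by (auto split: if_splits)
    then have "total_deg b + total_deg e = total_deg a + total_deg c + 1"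
      using Xdeg by fastforce
    moreover have "total_deg a < total_deg b \<longleftrightarrow> total_deg c < total_deg e"
      using that by (simp add: w_def x y)
    ultimately show False
      using \<open>(\<exists>i. e = a \<and> X i b c \<noteq> 0) \<or> (\<exists>i. c = b \<and> X i e a \<noteq> 0)\<close> Xdeg by fastforce
  qed
  have split: "(\<Sum>x\<in>Om. form y x * g x) = (\<Sum>x\<in>Pos. form y x * g x) + (\<Sum>x\<in>Neg. form y x * g x)" for y g
    unfolding Om(1) by (rule sum.union_disjoint[OF fin(1,2) Om(2)])
  have Pos0: "(\<Sum>x\<in>Pos. form y x * g x) = 0" if "y \<in> Pos" for y g
    using that by (intro sum.neutral) (auto simp: Pos_def form0)
  have Neg0: "(\<Sum>x\<in>Neg. form y x * g x) = 0" if "y \<in> Neg" for y g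
    using that by (intro sum.neutral) (auto simp: Neg_def form0)
  define ZP where "ZP = {g \<in> supp Pos. \<forall>y\<in>Neg. (\<Sum>x\<in>Pos. form y x * g x) = 0}"
  define ZN where "ZN = {g \<in> supp Neg. \<forall>y\<in>Pos. (\<Sum>x\<in>Neg. form y x * g x) = 0}"
  have Z: "g \<in> Z1 \<longleftrightarrow> g \<in> supp Om \<and> (\<forall>y\<in>Neg. (\<Sum>x\<in>Pos. form y x * g x) = 0) \<and> (\<forall>y\<in>Pos. (\<Sum>x\<in>Neg. form y x * g x) = 0)" for g
  proof -
    have N: "(\<Sum>x\<in>Om. form y x * g x) = (\<Sum>x\<in>Pos. form y x * g x)" if "y \<in> Neg" for y
      using Neg0[OF that] by (simp add: split)
    have P: "(\<Sum>x\<in>Om. form y x * g x) = (\<Sum>x\<in>Neg. form y x * g x)" if "y \<in> Pos" for y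
      using Pos0[OF that] by (simp add: split)
    let ?Q = "\<lambda>y. (\<Sum>x\<in>Om. form y x * g x) = 0"
    have "(\<forall>y\<in>Om. ?Q y) \<longleftrightarrow> (\<forall>y\<in>Neg. ?Q y) \<and> (\<forall>y\<in>Pos. ?Q y)"
      using Om(1) by blast
    moreover have "(\<forall>y\<in>Neg. ?Q y) \<longleftrightarrow> (\<forall>y\<in>Neg. (\<Sum>x\<in>Pos. form y x * g x) = 0)"
      by (rule ball_cong) (simp_all add: N)
    moreover have "(\<forall>y\<in>Pos. ?Q y) \<longleftrightarrow> (\<forall>y\<in>Pos. (\<Sum>x\<in>Neg. form y x * g x) = 0)"
      by (rule ball_cong) (simp_all add: P)
    ultimately show ?thesis unfolding Z1_radical Om_def[symmetric] by simp
  qed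
  define f where "f = (\<lambda>(g :: _ \<Rightarrow> 'k) x. if x \<in> Pos then g x else 0)"
  have f: "Vector_Spaces.linear (\<lambda>c g x. c * g x) (\<lambda>c g x. c * g x) f"
    by (rule KF_linearI) (auto simp: f_def)
  have fP: "(\<Sum>x\<in>Pos. form y x * f g x) = (\<Sum>x\<in>Pos. form y x * g x)" for y g
    by (rule sum.cong) (auto simp: f_def)
  have sub: "KF.subspace Z1"
  proof -
    have Zs: "Z1 = {g. g \<in> supp Om \<and> (\<forall>y\<in>Neg. (\<Sum>x\<in>Pos. form y x * g x) = 0) \<and>
        (\<forall>y\<in>Pos. (\<Sum>x\<in>Neg. form y x * g x) = 0)}"
      using Z by blast
    show ?thesis
      unfolding KF.subspace_def Zs
      by (auto simp: supp_def distrib_left sum.distrib mult.left_commute simp flip: sum_distrib_left)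
  qed
  have fd: "KF.fd Z1"
    by (rule KF.fd_subset[OF _ supp_dim(2)[OF fin(3)]]) (auto simp: Z)
  have im: "f ` Z1 = ZP"
  proof (intro equalityI subsetI)
    fix h assume "h \<in> f ` Z1"
    then obtain g where "g \<in> Z1" "h = f g" by blast
    moreover have "f g \<in> supp Pos" by (simp add: f_def supp_def)
    ultimately show "h \<in> ZP" by (simp add: Z ZP_def fP)
  next
    fix g assume g: "g \<in> ZP"
    then have g0: "g x = 0" if "x \<notin> Pos" for x using that unfolding ZP_def supp_def by blast
    have "(\<Sum>x\<in>Neg. form y x * g x) = 0" for y
      by (rule sum.neutral) (use g0 Om(2) in auto)
    moreover have "g \<in> supp Om" using g0 Om(1) unfolding supp_def by blast
    ultimately have "g \<in> Z1" using g unfolding Z ZP_def by blast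
    moreover have "f g = g" using g0 by (auto simp: f_def)
    ultimately show "g \<in> f ` Z1" by (metis imageI)
  qed
  have ker: "{g \<in> Z1. f g = 0} = ZN"
  proof (intro equalityI subsetI)
    fix g assume g: "g \<in> {g \<in> Z1. f g = 0}"
    have "g x = 0" if "x \<notin> Neg" for x
    proof (cases "x \<in> Pos")
      case True
      have "f g x = 0" using g by simp
      then show ?thesis using True by (simp add: f_def)
    next
      case False
      then have "x \<notin> Om" using that Om(1) by blast
      then show ?thesis using g unfolding Z supp_def by blast
    qed
    then have "g \<in> supp Neg" unfolding supp_def by blast
    then show "g \<in> ZN" using g unfolding ZN_def Z by blast
  next
    fix g assume g: "g \<in> ZN"
    then have g0: "g x = 0" if "x \<notin> Neg" for x using that unfolding ZN_def supp_def by blast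
    have "(\<Sum>x\<in>Pos. form y x * g x) = 0" for y
      by (rule sum.neutral) (use g0 Om(2) in auto)
    moreover have "g \<in> supp Om" using g0 Om(1) unfolding supp_def by blast
    ultimately have "g \<in> Z1" using g unfolding Z ZN_def by blast
    moreover have "f g = 0" using g0 Om(2) by (auto simp: f_def fun_eq_iff)
    ultimately show "g \<in> {g \<in> Z1. f g = 0}" by simp
  qed
  have "KF.dim Z1 = KF.dim ZP + KF.dim ZN"
    using KF2.rank_nullity[OF f sub fd] unfolding im ker .
  moreover have "KF.dim ZP + card Neg = KF.dim ZN + card Pos"
    unfolding ZP_def ZN_def
    using dim_kernel_transpose[OF fin(1,2), of "\<lambda>x y. form y x"] by (simp add: form_symmetric)
  moreover have "card Pos + card Neg = 3 * (card B * card B)"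
  proof -
    have "card Om = 3 * (card B * card B)" by (simp add: Om_def card_cartesian_product)
    then show ?thesis using card_Un_disjoint[OF fin(1,2) Om(2)] Om(1) by simp
  qed
  \<comment> \<open>Adding 2 card \<open>Neg\<close> avoids subtraction of naturals; 3 d^2 + d is
    even for every d.\<close>
  ultimately have "KF.dim Z1 + card B + 2 * card Neg = 2 * KF.dim ZN + 3 * (card B * card B) + card B"
    by linarith
  moreover have "even (2 * KF.dim ZN + 3 * (card B * card B) + card B)" by auto
  ultimately show ?thesis by (metis even_add even_mult_iff even_numeral)
qed

lemma homogeneous_parity:
  assumes "homogeneous_ideal I"
  shows "even (PF.dim (Tan I nf) + card B)"
proof -
  \<comment> \<open>\<open>B\<close> was chosen without regard to degrees. Still, the part of
    \<open>nf (monomial m)\<close> in the degree of \<open>m\<close> is supported on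
    \<open>B\<close> and congruent to the monomial modulo the homogeneous ideal, so it is the whole
    normal form.\<close>
  have "total_deg a = total_deg m" if a: "a \<in> keys (nf (monomial m))" for m a
  proof -
    define f where "f = monomial m - nf (monomial m)"
    define h where "h = hom_component (total_deg m) f"
    have "h \<in> I"
      using assms nf_diff(2)[OF nf, of "monomial m"] by (simp add: homogeneous_ideal_def h_def f_def)
    define q where "q = monomial m - h"
    have lq: "lookup q n = (if total_deg n = total_deg m then lookup (nf (monomial m)) n else 0)" for n
      by (auto simp: q_def h_def lookup_hom_component f_def lookup_minus lookup_monomial)
    then have "keys q \<subseteq> B" using nf_keys[OF nf, of "monomial m"] by (auto simp: in_keys_iff split: if_splits)
    then have "q = nf (monomial m)"
      using \<open>h \<in> I\<close> nf_id[OF nf, of q] nf_eq_0[OF nf, of h] by (simp add: q_def klin_diff[OF lin])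
    then have "lookup q a \<noteq> 0" using a by (simp add: in_keys_iff)
    then show ?thesis using lq[of a] by (simp split: if_splits)
  qed
  then have "even (KF.dim Z1 + card B)" by (rule even_dim_Z1)
  moreover have "PF.dim (Tan I nf) + card B * card B = KF.dim Z1 + card B"
    using dim_Ext_Z1 dim_Ext_Tan by simp
  ultimately show ?thesis by (metis even_add even_mult_iff)
qed

end

section \<open>Linkage\<close>

interpretation PKF: vspace_pair "\<lambda>(c::'k::field) (p :: 'k poly3). Const c * p"
  "\<lambda>(c::'k::field) (f :: 'y \<Rightarrow> 'k) x. c * f x" ..

lemma normal_form_mono_finite:
  fixes A :: "'k::field poly3 set"
  assumes A: "normal_form A B nu" "finite B" and J: "normal_form J B' nf" and sub: "A \<subseteq> J"
  shows "finite B'"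
proof -
  have "nf p = nf (nu p)" for p
    using nf_diff(2)[OF A(1), of p] sub by (auto simp: nf_eq[OF J])
  then have "range nf \<subseteq> nf ` {p. keys p \<subseteq> B}"
    unfolding nf_range[OF A(1), symmetric] by auto
  moreover have "P.fd (nf ` {p. keys p \<subseteq> B})"
    using PP.fd_image[of nf "{p. keys p \<subseteq> B}"] nf_klin[OF J] A(2) by (simp add: klin_linear fd_keys)
  ultimately have "P.fd {p :: 'k poly3. keys p \<subseteq> B'}"
    unfolding nf_range[OF J, symmetric] by (rule P.fd_subset)
  then show ?thesis by (simp add: fd_keys)
qed

context cofinite_normal_form
begin

lemma dim_triples:
  shows "PF.dim {q :: 3 \<Rightarrow> 'k poly3. \<forall>i. nf (q i) = q i} = 3 * card B"
    and "PF.fd {q :: 3 \<Rightarrow> 'k poly3. \<forall>i. nf (q i) = q i}"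
    and "PF.subspace {q :: 3 \<Rightarrow> 'k poly3. \<forall>i. nf (q i) = q i}"
proof -
  let ?V = "{q :: 3 \<Rightarrow> 'k poly3. \<forall>i. nf (q i) = q i}"
  show sub: "PF.subspace ?V"
    by (auto simp: PF.subspace_def klin_0 klin_add klin_scale lin)
  define h where "h = (\<lambda>(q :: 3 \<Rightarrow> 'k poly3) (i, b). lookup (q i) b)"
  have h: "Vector_Spaces.linear (\<lambda>c g x. Const c * g x) (\<lambda>c g x. c * g x) h"
    by (rule PFKF_linearI) (auto simp: h_def fun_eq_iff lookup_add lookup_Const_mult)
  have inj: "inj_on h ?V"
    by (rule inj_onI) (auto simp: h_def fun_eq_iff intro!: poly_mapping_eqI)
  have im: "h ` ?V = supp (UNIV \<times> B)"
  proof (intro equalityI subsetI)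
    fix g assume "g \<in> h ` ?V"
    then obtain q where q: "\<And>i. nf (q i) = q i" "g = h q" by blast
    have "lookup (q i) b = 0" if "b \<notin> B" for i b using lookup_nf[OF that, of "q i"] by (simp add: q(1))
    then show "g \<in> supp (UNIV \<times> B)" by (auto simp: supp_def h_def q(2))
  next
    fix g :: "3 \<times> (3 \<Rightarrow>\<^sub>0 nat) \<Rightarrow> 'k" assume g: "g \<in> supp (UNIV \<times> B)"
    define q where "q = (\<lambda>i. pol (\<lambda>b. g (i, b)))"
    have "q \<in> ?V" by (simp add: q_def nf_id[OF nf keys_pol])
    moreover have "h q = g" using g by (auto simp: h_def q_def lookup_pol fun_eq_iff supp_def)
    ultimately show "g \<in> h ` ?V" by blast
  qed
  show "PF.dim ?V = 3 * card B"
    using PFKF.dim_image_inj_on[OF h sub inj] supp_dim(1)[of "(UNIV :: 3 set) \<times> B", where 'k='k] B im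
    by (simp add: card_cartesian_product)
  show "PF.fd ?V"
    by (rule PFKF.fd_inj_image[OF h sub inj]) (simp add: im supp_dim(2) B)
qed

end

text \<open>What the linkage argument uses of a regular sequence. By \<open>rel\<close> the conormal
  module of \<open>A\<close> is free on the \<open>a i\<close>, so homomorphisms from
  \<open>A\<close> to S/A are arbitrary triples of values; \<open>\<mu>\<close> makes S/A a
  Frobenius algebra.\<close>

locale complete_intersection_algebra = cofinite_normal_form A BA nu
  for A :: "'k::field poly3 set" and BA nu +
  fixes a :: "3 \<Rightarrow> 'k poly3" and \<mu> :: "'k poly3 \<Rightarrow> 'k"
  assumes mem: "f \<in> A \<longleftrightarrow> (\<exists>c. f = (\<Sum>i\<in>UNIV. c i * a i))"
    and rel: "(\<Sum>i\<in>UNIV. c i * a i) = 0 \<Longrightarrow> c i \<in> A"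
    and \<mu>_add: "\<mu> (p + q) = \<mu> p + \<mu> q" and \<mu>_scale: "\<mu> (Const k * p) = k * \<mu> p"
    and \<mu>_A: "f \<in> A \<Longrightarrow> \<mu> f = 0" and \<mu>_nondeg: "(\<And>s. \<mu> (r * s) = 0) \<Longrightarrow> r \<in> A"
begin

lemma nu_eq: "nu p = nu q \<longleftrightarrow> p - q \<in> A"
  by (rule nf_eq[OF nf])

lemma \<mu>_cong: "nu p = nu q \<Longrightarrow> \<mu> p = \<mu> q"
  using \<mu>_add[of q "p - q"] \<mu>_A[of "p - q"] by (simp add: nu_eq)

text \<open>By nondegeneracy, sending c to the functional s |-> \<open>\<mu> (c * s)\<close> embeds
  S/A into its dual, and equal dimensions make this an isomorphism.\<close>

lemma functional_representation:
  assumes add: "\<And>p q. \<kappa> (p + q) = \<kappa> p + \<kappa> q" and scale: "\<And>k p. \<kappa> (Const k * p) = k * \<kappa> p"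
    and A: "\<And>f. f \<in> A \<Longrightarrow> \<kappa> f = (0::'k)"
  shows "\<exists>c. \<forall>s. \<kappa> s = \<mu> (c * s)"
proof -
  define V where "V = {p :: 'k poly3. keys p \<subseteq> BA}"
  define T where "T = (\<lambda>p b. if b \<in> BA then \<mu> (p * monomial b) else 0)"
  have ext: "\<kappa>1 s = \<kappa>2 s" if "\<And>p q. \<kappa>1 (p + q) = \<kappa>1 p + \<kappa>1 q" "\<And>k p. \<kappa>1 (Const k * p) = k * \<kappa>1 p"
      "\<And>f. f \<in> A \<Longrightarrow> \<kappa>1 f = 0" "\<And>p q. \<kappa>2 (p + q) = \<kappa>2 p + \<kappa>2 q"
      "\<And>k p. \<kappa>2 (Const k * p) = k * \<kappa>2 p" "\<And>f. f \<in> A \<Longrightarrow> \<kappa>2 f = (0::'k)"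
      "\<And>b. b \<in> BA \<Longrightarrow> \<kappa>1 (monomial b) = \<kappa>2 (monomial b)" for \<kappa>1 \<kappa>2 s
  proof -
    have *: "\<kappa> s = (\<Sum>b\<in>BA. lookup (nu s) b * \<kappa> (monomial b))"
      if k: "\<And>p q. \<kappa> (p + q) = \<kappa> p + \<kappa> q" "\<And>k p. \<kappa> (Const k * p) = k * \<kappa> p"
        "\<And>f. f \<in> A \<Longrightarrow> \<kappa> f = (0::'k)" for \<kappa>
    proof -
      have "\<kappa> s = \<kappa> (nu s)"
        using k(1)[of "nu s" "s - nu s"] k(3)[OF nf_diff(2)[OF nf, of s]] by simp
      also have "\<dots> = \<kappa> (\<Sum>b\<in>BA. Const (lookup (nu s) b) * monomial b)"
        using pol_lookup[of s] by (simp add: pol_def)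
      also have "\<dots> = (\<Sum>b\<in>BA. lookup (nu s) b * \<kappa> (monomial b))"
      proof -
        have "\<kappa> 0 = 0" using k(2)[of 0 0] by simp
        then have "\<kappa> (\<Sum>b\<in>C. Const (lookup (nu s) b) * monomial b) = (\<Sum>b\<in>C. lookup (nu s) b * \<kappa> (monomial b))" for C
          by (induction C rule: infinite_finite_induct) (simp_all add: k)
        then show ?thesis .
      qed
      finally show ?thesis .
    qed
    show ?thesis using *[of \<kappa>1] *[of \<kappa>2] that by simp
  qed
  have \<mu>: "\<mu> (p * (q + r)) = \<mu> (p * q) + \<mu> (p * r)" "\<mu> (p * (Const k * q)) = k * \<mu> (p * q)"
      "f \<in> A \<Longrightarrow> \<mu> (p * f) = 0" for p q r k f
    using \<mu>_scale[of k "p * q"] \<mu>_A[OF I_mult(1)] by (simp_all add: distrib_left \<mu>_add mult.left_commute)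
  have T: "Vector_Spaces.linear (\<lambda>c p. Const c * p) (\<lambda>c g x. c * g x) T"
    unfolding Vector_Spaces.linear_iff
    by (intro conjI P.vector_space_axioms KF.vector_space_axioms)
      (auto simp: T_def fun_eq_iff distrib_right \<mu>_add \<mu>_scale mult.assoc)
  have sub: "P.subspace V" unfolding V_def by (rule subspace_keys)
  have inj: "inj_on T V"
    unfolding PKF.linear_inj_on_iff_eq_0[OF T sub]
  proof (intro ballI impI)
    fix p assume p: "p \<in> V" and T0: "T p = 0"
    have b: "\<mu> (p * monomial b) = 0" if "b \<in> BA" for b
    proof -
      have "T p b = 0" using T0 by simp
      then show ?thesis using that by (simp add: T_def)
    qed
    have "\<mu> (p * s) = 0" for s
      by (rule ext[of "\<lambda>s. \<mu> (p * s)" "\<lambda>s. 0"]) (simp_all only: \<mu> b mult_zero_right add_0_right)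
    then have "p \<in> A" by (rule \<mu>_nondeg)
    then show "p = 0" using p nf_eq_0[OF nf, of p] nf_id[OF nf, of p] by (simp add: V_def)
  qed
  have "KF.dim (T ` V) = KF.dim (supp BA :: (_ \<Rightarrow> 'k) set)"
    using PKF.dim_image_inj_on[OF T sub inj] supp_dim(1)[OF B, where 'k='k] dim_keys[OF B]
    by (simp add: V_def)
  then have "T ` V = supp BA"
    by (intro KF.subspace_eq_if_dim_eq PKF.linear_subspace_image[OF T sub] supp_dim(2)[OF B])
      (auto simp: T_def supp_def)
  moreover have "(\<lambda>b. if b \<in> BA then \<kappa> (monomial b) else 0) \<in> supp BA" by (simp add: supp_def)
  ultimately have "(\<lambda>b. if b \<in> BA then \<kappa> (monomial b) else 0) \<in> T ` V" by (simp only:)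
  then obtain c where c: "(\<lambda>b. if b \<in> BA then \<kappa> (monomial b) else 0) = T c" and "c \<in> V"
    by (rule imageE)
  have "\<kappa> s = \<mu> (c * s)" for s
  proof (rule ext[of \<kappa> "\<lambda>s. \<mu> (c * s)"])
    fix b assume "b \<in> BA"
    then show "\<kappa> (monomial b) = \<mu> (c * monomial b)" using fun_cong[OF c, of b] by (simp add: T_def)
  qed (simp_all only: add scale A \<mu>)
  then show ?thesis by blast
qed

text \<open>Self-injectivity of S/A. The functional \<open>\<mu>\<close> after \<open>h\<close>,
  extended by zero to a complement of \<open>K\<close>, is represented by some c, and nondegeneracy
  forces h f = c f for f in \<open>K\<close>. As \<open>h\<close> takes polynomial values, it is
  linear only up to \<open>nu\<close>.\<close>

lemma baer:
  assumes K: "is_ideal K" "A \<subseteq> K"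
    and add: "\<And>f g. f \<in> K \<Longrightarrow> g \<in> K \<Longrightarrow> nu (h (f + g)) = nu (h f + h g)"
    and mult: "\<And>f s. f \<in> K \<Longrightarrow> nu (h (s * f)) = nu (s * h f)"
    and zero: "\<And>f. f \<in> A \<Longrightarrow> nu (h f) = 0"
  shows "\<exists>c. \<forall>f\<in>K. nu (h f) = nu (c * f)"
proof -
  obtain C nk where nk: "normal_form K C nk" using normal_form_exists[OF K(1)] by blast
  note l = nf_klin[OF nk]
  have inK: "p - nk p \<in> K" for p by (rule nf_diff(2)[OF nk])
  define \<kappa> where "\<kappa> = (\<lambda>s. \<mu> (h (s - nk s)))"
  have \<kappa>K: "\<kappa> f = \<mu> (h f)" if "f \<in> K" for f
    using that nf_eq_0[OF nk, of f] by (simp add: \<kappa>_def)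
  have "\<kappa> (p + q) = \<kappa> p + \<kappa> q" for p q
    using \<mu>_cong[OF add[OF inK[of p] inK[of q]]]
    by (simp add: \<kappa>_def klin_add[OF l] \<mu>_add add_diff_add)
  moreover have "\<kappa> (Const k * p) = k * \<kappa> p" for k p
    using \<mu>_cong[OF mult[OF inK[of p], of "Const k"]]
    by (simp add: \<kappa>_def klin_scale[OF l] \<mu>_scale right_diff_distrib)
  moreover have "\<kappa> f = 0" if "f \<in> A" for f
  proof -
    have "h f \<in> A" using zero[OF that] nf_eq_0[OF nf] by blast
    then show ?thesis using that K(2) \<mu>_A by (auto simp: \<kappa>K)
  qed
  ultimately obtain c where c: "\<And>s. \<kappa> s = \<mu> (c * s)"
    using functional_representation[of \<kappa>] by blast
  have "h f - c * f \<in> A" if f: "f \<in> K" for f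
  proof (rule \<mu>_nondeg)
    fix s
    have sf: "s * f \<in> K" using is_idealD(3)[OF K(1) f] .
    have "\<mu> (s * h f) = \<mu> (c * (s * f))"
      using \<mu>_cong[OF mult[OF f, of s]] \<kappa>K[OF sf] c by simp
    moreover have "s * h f = (h f - c * f) * s + c * (s * f)" by (simp add: algebra_simps)
    ultimately show "\<mu> ((h f - c * f) * s) = 0" using \<mu>_add[of "(h f - c * f) * s" "c * (s * f)"] by simp
  qed
  then have "\<forall>f\<in>K. nu (h f) = nu (c * f)" by (simp add: nu_eq)
  then show ?thesis by blast
qed

text \<open>Otherwise some coefficient of the normal form modulo \<open>K\<close> separates
  \<open>s\<close> from \<open>K\<close>. As a functional on S/A it is represented by some c, which
  annihilates \<open>K\<close> but not \<open>s\<close>.\<close>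

lemma double_annihilator:
  assumes K: "is_ideal K" "A \<subseteq> K" and s: "\<And>g. (\<And>f. f \<in> K \<Longrightarrow> g * f \<in> A) \<Longrightarrow> s * g \<in> A"
  shows "s \<in> K"
proof (rule ccontr)
  assume "s \<notin> K"
  obtain C nk where nk: "normal_form K C nk" using normal_form_exists[OF K(1)] by blast
  have "nk s \<noteq> 0" using \<open>s \<notin> K\<close> nf_eq_0[OF nk, of s] by simp
  then obtain b where b: "lookup (nk s) b \<noteq> 0" by (metis lookup_zero poly_mapping_eqI)
  have "lookup (nk f) b = 0" if "f \<in> K" for f using that nf_eq_0[OF nk, of f] by simp
  moreover have "lookup (nk f) b = 0" if "f \<in> A" for f using that K(2) calculation by blast
  ultimately obtain c where c: "\<And>p. lookup (nk p) b = \<mu> (c * p)" and K0: "\<And>f. f \<in> K \<Longrightarrow> lookup (nk f) b = 0"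
    using functional_representation[of "\<lambda>p. lookup (nk p) b"]
    by (auto simp: klin_add[OF nf_klin[OF nk]] klin_scale[OF nf_klin[OF nk]] lookup_add lookup_Const_mult)
  have "c * f \<in> A" if "f \<in> K" for f
  proof (rule \<mu>_nondeg)
    fix t
    have "f * t \<in> K" using is_idealD(4)[OF K(1) that] .
    then show "\<mu> (c * f * t) = 0" using c[of "f * t"] K0 by (simp add: mult.assoc)
  qed
  then have "s * c \<in> A" by (rule s)
  then show False using b c[of s] \<mu>_A by (simp add: mult.commute)
qed

text \<open>\<open>ev q\<close> is the homomorphism from \<open>A\<close> to the quotient that maps \<open>a i\<close> to the class of \<open>q i\<close>.\<close>

definition ev :: "(3 \<Rightarrow> 'k poly3) \<Rightarrow> 'k poly3 \<Rightarrow> 'k poly3" where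
  "ev q p = (\<Sum>i\<in>UNIV. (SOME c. p = (\<Sum>i\<in>UNIV. c i * a i)) i * q i)"

text \<open>Two expressions of \<open>p\<close> differ by a relation between the \<open>a i\<close>,
  whose coefficients lie in \<open>A\<close>.\<close>

lemma ev_eq:
  assumes p: "p = (\<Sum>i\<in>UNIV. c i * a i)"
  shows "nu (ev q p) = nu (\<Sum>i\<in>UNIV. c i * q i)"
proof -
  define d where "d = (SOME c. p = (\<Sum>i\<in>UNIV. c i * a i))"
  have "p = (\<Sum>i\<in>UNIV. d i * a i)" unfolding d_def by (rule someI[of _ c]) (rule p)
  then have 0: "(\<Sum>i\<in>UNIV. (d i - c i) * a i) = 0"
    using p by (simp add: left_diff_distrib sum_subtractf)
  have "(d i - c i) * q i \<in> A" for i
    by (rule I_mult(2), rule rel[of "\<lambda>i. d i - c i"], rule 0)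
  then have "(\<Sum>i\<in>UNIV. (d i - c i) * q i) \<in> A" by (intro is_ideal_sum[OF I])
  then show ?thesis by (simp add: ev_def d_def[symmetric] nu_eq left_diff_distrib sum_subtractf)
qed

lemma ev_add:
  assumes "p \<in> A" "p' \<in> A"
  shows "nu (ev q (p + p')) = nu (ev q p + ev q p')"
proof -
  obtain c where c: "p = (\<Sum>i\<in>UNIV. c i * a i)" using assms(1) unfolding mem by (rule exE)
  obtain c' where c': "p' = (\<Sum>i\<in>UNIV. c' i * a i)" using assms(2) unfolding mem by (rule exE)
  have "p + p' = (\<Sum>i\<in>UNIV. (c i + c' i) * a i)" by (simp add: c c' distrib_right sum.distrib)
  from ev_eq[OF this, of q] ev_eq[OF c, of q] ev_eq[OF c', of q] show ?thesis
    by (simp add: klin_add[OF lin] distrib_right sum.distrib)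
qed

lemma nu_mult_cong: "nu p = nu q \<Longrightarrow> nu (s * p) = nu (s * q)"
  by (rule nf_mult_cong[OF nf I])

lemma ev_mult:
  assumes "p \<in> A"
  shows "nu (ev q (s * p)) = nu (s * ev q p)"
proof -
  obtain c where c: "p = (\<Sum>i\<in>UNIV. c i * a i)" using assms unfolding mem by (rule exE)
  then have "s * p = (\<Sum>i\<in>UNIV. (s * c i) * a i)" by (simp add: sum_distrib_left mult.assoc)
  from ev_eq[OF this, of q] nu_mult_cong[OF ev_eq[OF c, of q], of s] show ?thesis
    by (simp add: sum_distrib_left mult.assoc)
qed

lemma a_in_A: "a i \<in> A"
proof -
  have "a i = (\<Sum>j\<in>UNIV. if j = i then a j else 0)" by simp
  also have "\<dots> = (\<Sum>j\<in>UNIV. (if j = i then 1 else 0) * a j)" by (rule sum.cong) auto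
  finally show ?thesis unfolding mem by (rule exI[of _ "\<lambda>j. if j = i then 1 else 0"])
qed

lemma ev_a: "nu (ev q (f * a i)) = nu (f * q i)"
proof -
  have "f * a i = (\<Sum>j\<in>UNIV. if j = i then f * a j else 0)" by simp
  also have "\<dots> = (\<Sum>j\<in>UNIV. (if j = i then f else 0) * a j)" by (rule sum.cong) auto
  finally have "nu (ev q (f * a i)) = nu (\<Sum>j\<in>UNIV. (if j = i then f else 0) * q j)" by (rule ev_eq)
  also have "(\<Sum>j\<in>UNIV. (if j = i then f else 0) * q j) = (\<Sum>j\<in>UNIV. if j = i then f * q j else 0)"
    by (rule sum.cong) auto
  finally show ?thesis by simp
qed

end

text \<open>Serves when a condition \<open>E\<close> fixes the value at \<open>g\<close> only up to
  \<open>J\<close>: uniqueness makes any choice of values linear modulo \<open>J\<close>, and normal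
  forms turn it into a tangent vector.\<close>

lemma Tan_from_relation:
  assumes J: "normal_form J B nf" "is_ideal J"
    and ex: "\<And>g. g \<in> J \<Longrightarrow> \<exists>u. E g u"
    and unique: "\<And>g u u'. g \<in> J \<Longrightarrow> E g u \<Longrightarrow> E g u' \<Longrightarrow> u - u' \<in> J"
    and add: "\<And>g g' u u'. g \<in> J \<Longrightarrow> g' \<in> J \<Longrightarrow> E g u \<Longrightarrow> E g' u' \<Longrightarrow> E (g + g') (u + u')"
    and mult: "\<And>g u s. g \<in> J \<Longrightarrow> E g u \<Longrightarrow> E (s * g) (s * u)"
  shows "\<exists>\<chi>\<in>Tan J nf. \<forall>g\<in>J. \<forall>u. E g u \<longrightarrow> \<chi> g = nf u"
proof -
  define U where "U = (\<lambda>g. SOME u. E g u)"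
  have U: "E g (U g)" if "g \<in> J" for g unfolding U_def using ex[OF that] by (rule someI_ex)
  have eq: "nf (U g) = nf u" if "g \<in> J" "E g u" for g u
    using unique[OF that(1) U that(2)] that(1) by (simp add: nf_eq[OF J(1)])
  define \<chi> where "\<chi> = (\<lambda>p. nf (U (p - nf p)))"
  note l = nf_klin[OF J(1)]
  have inJ: "p - nf p \<in> J" for p by (rule nf_diff(2)[OF J(1)])
  have \<chi>J: "\<chi> g = nf (U g)" if "g \<in> J" for g
    using that nf_eq_0[OF J(1), of g] by (simp add: \<chi>_def)
  have sJ: "s * g \<in> J" if "g \<in> J" for s g using is_idealD(3)[OF J(2) that] .
  have "\<chi> (p + q) = \<chi> p + \<chi> q" for p q
    using eq[OF is_idealD(2)[OF J(2) inJ inJ] add[OF inJ inJ U[OF inJ] U[OF inJ]], of p q]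
    by (simp add: \<chi>_def klin_add[OF l] add_diff_add)
  moreover have "\<chi> (Const c * p) = Const c * \<chi> p" for c p
    using eq[OF sJ[OF inJ] mult[OF inJ U[OF inJ]], of "Const c" p]
    by (simp add: \<chi>_def klin_scale[OF l] right_diff_distrib)
  moreover have "nf (\<chi> p) = \<chi> p" for p by (simp add: \<chi>_def nf_nf[OF J(1)])
  moreover have "\<chi> (s * g) = nf (s * \<chi> g)" if "g \<in> J" for s g
    using eq[OF sJ[OF that] mult[OF that U[OF that]], of s] that
    by (simp add: \<chi>J sJ nf_mult_nf[OF J])
  moreover have "\<chi> (nf p) = 0" for p
  proof -
    have "E (0 * 0) (0 * U 0)" using mult[of 0 "U 0" 0] U[of 0] is_idealD(1)[OF J(2)] by blast
    then have "nf (U 0) = 0" using eq[of 0 0] is_idealD(1)[OF J(2)] klin_0[OF l] by simp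
    then show ?thesis by (simp add: \<chi>_def nf_nf[OF J(1)])
  qed
  ultimately have "\<chi> \<in> Tan J nf" by (simp add: Tan_def Ext_def klin_def)
  moreover have "\<chi> g = nf u" if "g \<in> J" "E g u" for g u using \<chi>J eq that by simp
  ultimately show ?thesis by blast
qed

text \<open>Linkage is recorded symmetrically, each ideal being the annihilator of the other modulo
  \<open>A\<close>, so that every result also holds with the roles exchanged.\<close>

locale linked_pair = complete_intersection_algebra A BA nu a \<mu> +
  NI: cofinite_normal_form II BI nI + NJ: cofinite_normal_form J BJ nJ
  for A :: "'k::field poly3 set" and BA nu a \<mu> and II :: "'k poly3 set" and BI nI and J :: "'k poly3 set" and BJ nJ +
  assumes AI: "A \<subseteq> II" and AJ: "A \<subseteq> J"
    and annI: "f \<in> II \<longleftrightarrow> (\<forall>g\<in>J. f * g \<in> A)" and annJ: "g \<in> J \<longleftrightarrow> (\<forall>f\<in>II. f * g \<in> A)"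
begin

lemma swap: "linked_pair A BA nu a \<mu> J BJ nJ II BI nI"
proof unfold_locales
  show "A \<subseteq> J" "A \<subseteq> II" by (rule AJ AI)+
  show "g \<in> J \<longleftrightarrow> (\<forall>f\<in>II. g * f \<in> A)" for g using annJ[of g] by (simp only: mult.commute)
  show "f \<in> II \<longleftrightarrow> (\<forall>g\<in>J. g * f \<in> A)" for f using annI[of f] by (simp only: mult.commute)
qed

text \<open>The derivative of the product \<open>f * g \<in> A\<close> under deformations of \<open>II\<close> and of \<open>J\<close>, both lying over
  the same deformation \<open>q\<close> of \<open>A\<close>.\<close>

lemma transfer_tangent:
  assumes \<phi>: "\<phi> \<in> Tan II nI" and q: "\<And>i. \<phi> (a i) = nI (q i)"
  shows "\<exists>\<chi>\<in>Tan J nJ. (\<forall>i. \<chi> (a i) = nJ (q i)) \<and>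
    (\<forall>f\<in>II. \<forall>g\<in>J. nu (ev q (f * g)) = nu (g * \<phi> f + f * \<chi> g))"
proof -
  note EI = Tan_Ext[OF \<phi>]
  note l = Ext_klin[OF EI]
  have prod: "f * g \<in> A" if "f \<in> II" "g \<in> J" for f g using annI that by blast
  have congI: "nu (g * x) = nu (g * y)" if "g \<in> J" "nI x = nI y" for g x y
    using prod[of "x - y" g] that by (simp add: nf_eq[OF NI.nf] nu_eq right_diff_distrib mult.commute left_diff_distrib)
  have congJ: "nu (f * x) = nu (f * y)" if "f \<in> II" "nJ x = nJ y" for f x y
    using prod[of f "x - y"] that by (simp add: nf_eq[OF NJ.nf] nu_eq right_diff_distrib)
  define E where "E = (\<lambda>g u. \<forall>f\<in>II. nu (ev q (f * g)) = nu (g * \<phi> f + f * u))"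
  have ex: "\<exists>u. E g u" if g: "g \<in> J" for g
  proof -
    \<comment> \<open>The product rule is solved for the value \<open>u\<close> at \<open>g\<close>:
      it demands \<open>h f = f * u\<close> modulo \<open>A\<close> for all \<open>f\<close> in
      \<open>II\<close>. Modulo \<open>A\<close>, \<open>h\<close> is linear over S on
      \<open>II\<close> and vanishes on \<open>A\<close>, so \<open>baer\<close> supplies
      \<open>u\<close>.\<close>
    define h where "h = (\<lambda>f. ev q (f * g) - g * \<phi> f)"
    have "\<exists>c. \<forall>f\<in>II. nu (h f) = nu (c * f)"
    proof (rule baer[OF NI.I AI])
      fix f f' assume "f \<in> II" "f' \<in> II"
      then show "nu (h (f + f')) = nu (h f + h f')"
        using ev_add[OF prod[OF _ g] prod[OF _ g], of f f' q]
        by (simp add: h_def klin_add[OF l] klin_add[OF lin] klin_diff[OF lin] distrib_right distrib_left algebra_simps)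
    next
      fix f s assume f: "f \<in> II"
      have "nu (g * \<phi> (s * f)) = nu (g * (s * \<phi> f))"
        by (rule congI[OF g]) (simp add: Ext_mult[OF EI f] nf_nf[OF NI.nf])
      then show "nu (h (s * f)) = nu (s * h f)"
        using ev_mult[OF prod[OF f g], of q s]
        by (simp add: h_def klin_diff[OF lin] right_diff_distrib mult.assoc mult.left_commute)
    next
      fix f assume "f \<in> A"
      then obtain c where c: "f = (\<Sum>i\<in>UNIV. c i * a i)" unfolding mem by (rule exE)
      then have "f * g = (\<Sum>i\<in>UNIV. (g * c i) * a i)" by (simp add: sum_distrib_left sum_distrib_right mult_ac)
      from ev_eq[OF this, of q] have "nu (ev q (f * g)) = nu (g * (\<Sum>i\<in>UNIV. c i * q i))"
        by (simp add: sum_distrib_left mult.assoc)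
      \<comment> \<open>Here it enters that \<open>\<phi>\<close> lies over \<open>q\<close>: for
        \<open>f\<close> in \<open>A\<close> both terms of \<open>h\<close> agree.\<close>
      moreover have "nu (g * \<phi> f) = nu (g * (\<Sum>i\<in>UNIV. c i * q i))"
      proof (rule congI[OF g])
        have "a i \<in> II" for i using a_in_A AI by blast
        then have "\<phi> f = (\<Sum>i\<in>UNIV. nI (c i * nI (q i)))"
          by (simp add: c klin_sum[OF l] Ext_mult[OF EI] q)
        then show "nI (\<phi> f) = nI (\<Sum>i\<in>UNIV. c i * q i)"
          by (simp add: klin_sum[OF NI.lin] nf_mult_nf[OF NI.nf NI.I] nf_nf[OF NI.nf])
      qed
      ultimately show "nu (h f) = 0" by (simp add: h_def klin_diff[OF lin])
    qed
    then obtain c where "\<forall>f\<in>II. nu (h f) = nu (c * f)" ..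
    then have "E g c"
      by (auto simp: E_def h_def klin_diff[OF lin] klin_add[OF lin] mult.commute[of c] diff_eq_eq add.commute)
    then show ?thesis ..
  qed
  have "\<exists>\<chi>\<in>Tan J nJ. \<forall>g\<in>J. \<forall>u. E g u \<longrightarrow> \<chi> g = nJ u"
  proof (rule Tan_from_relation[OF NJ.nf NJ.I ex])
    fix g u u' assume "E g u" "E g u'"
    then have "f * (u - u') \<in> A" if "f \<in> II" for f
      using that by (simp add: E_def klin_add[OF lin] nu_eq right_diff_distrib)
    then show "u - u' \<in> J" using annJ by blast
  next
    fix g g' u u' assume "g \<in> J" "g' \<in> J" "E g u" "E g' u'"
    then show "E (g + g') (u + u')"
      using ev_add[OF prod prod] by (simp add: E_def klin_add[OF lin] distrib_left distrib_right add_ac)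
  next
    fix g u s assume g: "g \<in> J" "E g u"
    have "nu (ev q (f * (s * g))) = nu (s * g * \<phi> f + f * (s * u))" if f: "f \<in> II" for f
    proof -
      have "nu (ev q (f * (s * g))) = nu (s * ev q (f * g))"
        using ev_mult[OF prod[OF f g(1)], of q s] by (simp add: mult.left_commute)
      also have "\<dots> = nu (s * (g * \<phi> f + f * u))"
        using g(2) f by (intro nu_mult_cong) (simp add: E_def)
      finally show ?thesis by (simp add: distrib_left mult.assoc mult.left_commute)
    qed
    then show "E (s * g) (s * u)" by (simp add: E_def)
  qed
  then obtain \<chi> where \<chi>: "\<chi> \<in> Tan J nJ" "\<And>g u. g \<in> J \<Longrightarrow> E g u \<Longrightarrow> \<chi> g = nJ u" by blast
  have "\<chi> (a i) = nJ (q i)" for i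
  proof (rule \<chi>(2))
    show "a i \<in> J" using a_in_A AJ by blast
    have "nu (a i * \<phi> f) = 0" for f
      using I_mult(2)[OF a_in_A] nf_eq_0[OF nf] by blast
    then show "E (a i) (q i)" by (simp add: E_def ev_a klin_add[OF lin])
  qed
  moreover have "nu (ev q (f * g)) = nu (g * \<phi> f + f * \<chi> g)" if "f \<in> II" "g \<in> J" for f g
  proof -
    obtain u where u: "E g u" using ex \<open>g \<in> J\<close> by blast
    have "nu (f * \<chi> g) = nu (f * u)"
      by (rule congJ[OF that(1)]) (simp add: \<chi>(2)[OF that(2) u] nf_nf[OF NJ.nf])
    then show ?thesis using u that by (simp add: E_def klin_add[OF lin])
  qed
  ultimately show ?thesis using \<chi>(1) by blast
qed

section \<open>The dimension count for one link\<close>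

definition restrict_gens :: "('k poly3 \<Rightarrow> 'k poly3) \<Rightarrow> 3 \<Rightarrow> 'k poly3" where
  "restrict_gens \<phi> = (\<lambda>i. \<phi> (a i))"

definition reduce :: "(3 \<Rightarrow> 'k poly3) \<Rightarrow> 3 \<Rightarrow> 'k poly3" where
  "reduce q = (\<lambda>i. nI (q i))"

text \<open>The first order deformations of \<open>A\<close> that extend to
  \<open>II\<close>.\<close>

definition Q where
  "Q = {q. (\<forall>i. nu (q i) = q i) \<and> reduce q \<in> restrict_gens ` Tan II nI}"

definition Ker where
  "Ker = {\<phi> \<in> Tan II nI. restrict_gens \<phi> = 0}"

text \<open>Values in S/A on pairs from \<open>II\<close> and \<open>J\<close> form a target common
  to both ideals. The map \<open>e\<close>, in use the identity or the swap, aligns the two orders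
  of a pair.\<close>

definition pairing where
  "pairing e \<phi> = (\<lambda>x. case e x of (f, g) \<Rightarrow> if f \<in> II \<and> g \<in> J then nu (g * \<phi> f) else 0)"

lemma linear_restrict_gens:
  "Vector_Spaces.linear (\<lambda>c g x. Const c * g x) (\<lambda>c g x. Const c * g x) restrict_gens"
  by (rule PFPF_linearI) (auto simp: restrict_gens_def)

lemma linear_reduce:
  "Vector_Spaces.linear (\<lambda>c g x. Const c * g x) (\<lambda>c g x. Const c * g x) reduce"
  by (rule PFPF_linearI) (auto simp: reduce_def klin_add[OF NI.lin] klin_scale[OF NI.lin])

lemma subspace_Ker: "PF.subspace Ker"
  unfolding Ker_def by (rule PFPF.subspace_kernel_on[OF linear_restrict_gens subspace_Tan[OF NI.nf]])

text \<open>Injectivity: if all \<open>g * \<phi> f\<close> lie in \<open>A\<close>, then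
  \<open>\<phi> f\<close> annihilates \<open>J\<close> modulo \<open>A\<close>, so it lies in
  \<open>II\<close> and is 0, being a normal form.\<close>

lemma dim_pairing:
  assumes e: "\<And>x. e (e x) = x"
  shows "PF.dim (pairing e ` Ker) = PF.dim Ker"
proof (rule PFPF.dim_image_inj_on)
  have "nu (g * (Const c * p)) = Const c * nu (g * p)" for g c p
    using klin_scale[OF lin, of c "g * p"] by (simp add: mult.left_commute)
  then show lin': "Vector_Spaces.linear (\<lambda>c g x. Const c * g x) (\<lambda>c g x. Const c * g x) (pairing e)"
    by (intro PFPF_linearI) (auto simp: pairing_def fun_eq_iff distrib_left klin_add[OF lin] split: prod.split)
  show "PF.subspace Ker" by (rule subspace_Ker)
  show "inj_on (pairing e) Ker"
    unfolding PFPF.linear_inj_on_iff_eq_0[OF lin' subspace_Ker]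
  proof (intro ballI impI)
    fix \<phi> assume \<phi>: "\<phi> \<in> Ker" and 0: "pairing e \<phi> = 0"
    have T: "\<phi> \<in> Tan II nI" using \<phi> by (simp add: Ker_def)
    note E = Tan_Ext[OF T]
    have I0: "\<phi> f = 0" if f: "f \<in> II" for f
    proof -
      have "\<phi> f * g \<in> A" if g: "g \<in> J" for g
      proof -
        have "pairing e \<phi> (e (f, g)) = 0" using 0 by simp
        then show ?thesis using f g nf_eq_0[OF nf, of "g * \<phi> f"] by (simp add: pairing_def e mult.commute)
      qed
      then have "\<phi> f \<in> II" using annI by blast
      then show ?thesis using nf_eq_0[OF NI.nf, of "\<phi> f"] Ext_nf[OF E, of f] by simp
    qed
    have "\<phi> p = 0" for p
      using I0[OF nf_diff(2)[OF NI.nf, of p]] by (simp add: klin_diff[OF Ext_klin[OF E]] Tan_nf[OF T])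
    then show "\<phi> = 0" by (simp add: fun_eq_iff)
  qed
qed

text \<open>\<open>Tan II nI\<close> and \<open>Q\<close> both map onto the restrictions to the
  generators. The kernels are \<open>Ker\<close> and the triples in II/A, of dimension 3 card
  \<open>BA\<close> - 3 card \<open>BI\<close>.\<close>

lemma dim_Tan_formula: "PF.dim (Tan II nI) + 3 * card BA = PF.dim Q + PF.dim Ker + 3 * card BI"
proof -
  let ?R = "{q :: 3 \<Rightarrow> 'k poly3. \<forall>i. nu (q i) = q i}"
  let ?S = "{q :: 3 \<Rightarrow> 'k poly3. \<forall>i. nI (q i) = q i}"
  let ?Z = "{q \<in> ?R. reduce q = 0}"
  let ?T = "restrict_gens ` Tan II nI"
  have nI_nu: "nI (nu x) = nI x" for x
    using nf_diff(1)[OF nf, of x] AI by (auto simp: nf_eq[OF NI.nf])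
  have subT: "PF.subspace ?T"
    by (rule PFPF.linear_subspace_image[OF linear_restrict_gens subspace_Tan[OF NI.nf]])
  have QI: "Q = ?R \<inter> {q. reduce q \<in> ?T}" by (auto simp: Q_def)
  have subQ: "PF.subspace Q"
    unfolding QI by (intro PF.subspace_inter dim_triples(3) PFPF.linear_subspace_linear_preimage[OF linear_reduce subT])
  have fdQ: "PF.fd Q" by (rule PF.fd_subset[OF _ dim_triples(2)]) (auto simp: Q_def)
  have imR: "reduce ` ?R = ?S"
  proof (intro equalityI subsetI)
    fix q assume q: "q \<in> ?S"
    have m: "(\<lambda>i. nu (q i)) \<in> ?R" by (simp add: nf_nf[OF nf])
    have "reduce (\<lambda>i. nu (q i)) = q" using q by (simp add: reduce_def nI_nu)
    then show "q \<in> reduce ` ?R" using imageI[OF m, of reduce] by simp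
  qed (auto simp: reduce_def nf_nf[OF NI.nf])
  have imQ: "reduce ` Q = ?T"
  proof (intro equalityI subsetI)
    fix t assume t: "t \<in> ?T"
    then obtain \<phi> where \<phi>: "\<phi> \<in> Tan II nI" "t = restrict_gens \<phi>" by blast
    have r: "reduce (\<lambda>i. nu (t i)) = t"
      by (simp add: reduce_def nI_nu \<phi>(2) restrict_gens_def Ext_nf[OF Tan_Ext[OF \<phi>(1)]])
    then have m: "(\<lambda>i. nu (t i)) \<in> Q" using t by (simp add: Q_def nf_nf[OF nf])
    show "t \<in> reduce ` Q" using imageI[OF m, of reduce] unfolding r .
  qed (auto simp: Q_def)
  have kerQ: "{q \<in> Q. reduce q = 0} = ?Z"
    using PF.subspace_0[OF subT] by (auto simp: Q_def)
  have "PF.dim (Tan II nI) = PF.dim ?T + PF.dim Ker"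
    using PFPF.rank_nullity[OF linear_restrict_gens subspace_Tan[OF NI.nf] fd_Tan[OF NI.nf NI.I NI.B]]
    by (simp add: Ker_def)
  moreover have "PF.dim Q = PF.dim ?T + PF.dim ?Z"
    using PFPF.rank_nullity[OF linear_reduce subQ fdQ] unfolding imQ kerQ .
  moreover have "PF.dim ?R = PF.dim ?S + PF.dim ?Z"
    using PFPF.rank_nullity[OF linear_reduce dim_triples(3,2)] unfolding imR .
  ultimately show ?thesis using dim_triples(1) NI.dim_triples(1) by simp
qed

end

context linked_pair
begin

interpretation sw: linked_pair A BA nu a \<mu> J BJ nJ II BI nI
  by (rule swap)

text \<open>Transferring over \<open>q\<close> = 0 yields a \<open>\<chi>\<close> that also vanishes
  on the generators, and the product rule reads g \<phi>(f) = - f \<chi>(g).\<close>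

lemma pairing_image: "pairing e ` Ker \<subseteq> sw.pairing (\<lambda>x. prod.swap (e x)) ` sw.Ker"
proof (intro image_subsetI)
  fix \<phi> assume \<phi>: "\<phi> \<in> Ker"
  then have T: "\<phi> \<in> Tan II nI" by (simp add: Ker_def)
  have "\<phi> (a i) = nI ((\<lambda>i. 0) i)" for i
  proof -
    have "restrict_gens \<phi> i = 0" using \<phi> by (simp add: Ker_def)
    then show ?thesis by (simp add: restrict_gens_def klin_0[OF NI.lin])
  qed
  from transfer_tangent[OF T this] obtain \<chi> where \<chi>: "\<chi> \<in> Tan J nJ" "\<And>i. \<chi> (a i) = nJ 0"
    and e: "\<And>f g. f \<in> II \<Longrightarrow> g \<in> J \<Longrightarrow> nu (ev (\<lambda>i. 0) (f * g)) = nu (g * \<phi> f + f * \<chi> g)"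
    by blast
  have "\<chi> \<in> sw.Ker" using \<chi> by (simp add: sw.Ker_def sw.restrict_gens_def fun_eq_iff klin_0[OF NJ.lin])
  then have K: "- \<chi> \<in> sw.Ker" by (rule PF.subspace_neg[OF sw.subspace_Ker])
  have "nu (g * \<phi> f) = nu (f * (- \<chi> g))" if "f \<in> II" "g \<in> J" for f g
    using e[OF that] by (simp add: ev_def klin_0[OF lin] klin_add[OF lin] klin_neg[OF lin] eq_neg_iff_add_eq_0)
  then have "pairing e \<phi> = sw.pairing (\<lambda>x. prod.swap (e x)) (- \<chi>)"
    by (auto simp: fun_eq_iff pairing_def sw.pairing_def split: prod.split)
  then show "pairing e \<phi> \<in> sw.pairing (\<lambda>x. prod.swap (e x)) ` sw.Ker" using K by blast
qed

lemma Q_subset: "Q \<subseteq> sw.Q"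
proof
  fix q assume q: "q \<in> Q"
  then obtain \<phi> where \<phi>: "\<phi> \<in> Tan II nI" "reduce q = restrict_gens \<phi>" by (auto simp: Q_def)
  have "\<phi> (a i) = nI (q i)" for i
    using fun_cong[OF \<phi>(2), of i] by (simp add: reduce_def restrict_gens_def)
  from transfer_tangent[OF \<phi>(1) this] obtain \<chi> where \<chi>: "\<chi> \<in> Tan J nJ" "\<forall>i. \<chi> (a i) = nJ (q i)"
    by blast
  then have "sw.reduce q = sw.restrict_gens \<chi>"
    by (simp add: fun_eq_iff sw.reduce_def sw.restrict_gens_def)
  then show "q \<in> sw.Q" using \<chi>(1) q by (simp add: Q_def sw.Q_def)
qed

end

context linked_pair
begin

interpretation sw: linked_pair A BA nu a \<mu> J BJ nJ II BI nI
  by (rule swap)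

text \<open>Both inclusions are used twice, the second time with the roles of the ideals exchanged;
  so \<open>Q\<close> and the dimension of \<open>Ker\<close> are the same for both.\<close>

lemma linkage_dim: "PF.dim (Tan II nI) + 3 * card BJ = PF.dim (Tan J nJ) + 3 * card BI"
proof -
  have "Q = sw.Q" using Q_subset sw.Q_subset by (rule equalityI)
  moreover have "pairing (\<lambda>x. x) ` Ker = sw.pairing prod.swap ` sw.Ker"
    using pairing_image[of "\<lambda>x. x"] sw.pairing_image[of prod.swap] by (simp add: equalityI)
  then have "PF.dim Ker = PF.dim sw.Ker"
    using dim_pairing[of "\<lambda>x. x"] sw.dim_pairing[of prod.swap] by simp
  ultimately show ?thesis using dim_Tan_formula sw.dim_Tan_formula by simp
qed

end

section \<open>Regular sequences give complete intersection algebras\<close>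

lemma UNIV_three: "(UNIV :: 3 set) = {0, 1, 2}"
  using exhaust_three by auto

lemma sum_three: "(\<Sum>i\<in>(UNIV :: 3 set). f i) = f 0 + f 1 + f 2"
  unfolding UNIV_three by (simp add: add.assoc)

lemma complete_intersection_algebra_exists:
  fixes a1 :: "'k::field poly3"
  assumes reg: "regular_sequence [a1, a2, a3]"
  shows "\<exists>B nu \<mu>. complete_intersection_algebra (Gen {a3, a2, a1}) B nu
    (\<lambda>i. if i = 0 then a1 else if i = 1 then a2 else a3) \<mu>"
proof -
  let ?A = "Gen {a3, a2, a1}"
  let ?a = "\<lambda>i :: 3. if i = 0 then a1 else if i = 1 then a2 else a3"
  obtain B nu where nu: "normal_form ?A B nu" using normal_form_exists[OF is_ideal_Gen] by blast
  interpret cofinite_normal_form ?A B nu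
    by unfold_locales (rule nu is_ideal_Gen regular_sequence_finite[OF reg nu])+
  note r = regular_sequence_3[OF reg]
  obtain \<mu> where \<mu>: "\<And>p q. \<mu> (p + q) = \<mu> p + \<mu> q" "\<And>c p. \<mu> (Const c * p) = c * \<mu> p"
      "\<And>f. f \<in> ?A \<Longrightarrow> \<mu> f = (0::'k)" "\<And>r. (\<And>s. \<mu> (r * s) = 0) \<Longrightarrow> r \<in> ?A"
    using frobenius_form[OF refl r] by metis
  have sum: "(\<Sum>i\<in>UNIV. c i * ?a i) = c 0 * a1 + c 1 * a2 + c 2 * a3" for c
    by (simp add: sum_three)
  have mem: "f \<in> ?A \<longleftrightarrow> (\<exists>c. f = (\<Sum>i\<in>UNIV. c i * ?a i))" for f
  proof
    assume "f \<in> ?A"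
    then obtain u v w where "f = a3 * u + a2 * v + a1 * w" unfolding Gen_3 by blast
    then have "f = (\<Sum>i\<in>UNIV. (\<lambda>i. if i = 0 then w else if i = 1 then v else u) i * ?a i)"
      unfolding sum by (simp add: algebra_simps)
    then show "\<exists>c. f = (\<Sum>i\<in>UNIV. c i * ?a i)"
      by (rule exI[of _ "\<lambda>i. if i = 0 then w else if i = 1 then v else u"])
  next
    assume "\<exists>c. f = (\<Sum>i\<in>UNIV. c i * ?a i)"
    then obtain c :: "3 \<Rightarrow> 'k poly3" where "f = c 0 * a1 + c 1 * a2 + c 2 * a3" unfolding sum by (rule exE)
    then have "f = a3 * c 2 + a2 * c 1 + a1 * c 0" by (simp add: algebra_simps)
    then show "f \<in> ?A" unfolding Gen_3 by blast
  qed
  \<comment> \<open>Regularity is applied from \<open>a3\<close> down to \<open>a1\<close>, each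
    time solving for one coefficient; the outcome is that every relation is a Koszul
    relation.\<close>
  have rel: "c i \<in> ?A" if "(\<Sum>i\<in>UNIV. c i * ?a i) = 0" for c i
  proof -
    have 0: "c 0 * a1 + c 1 * a2 + c 2 * a3 = 0" using that unfolding sum .
    then have "a3 * c 2 = a2 * (- c 1) + a1 * (- c 0)" by (simp add: algebra_simps eq_neg_iff_add_eq_0)
    then have "a3 * c 2 \<in> Gen {a2, a1}" unfolding Gen_2 by blast
    then have "c 2 \<in> Gen {a2, a1}" by (rule r(3))
    then obtain u v where c2: "c 2 = a2 * u + a1 * v" unfolding Gen_2 by blast
    have "a2 * (c 1 + a3 * u) = a1 * (- c 0 - a3 * v)"
      using 0 by (simp add: c2 algebra_simps eq_neg_iff_add_eq_0)
    then have "a2 * (c 1 + a3 * u) \<in> Gen {a1}" unfolding Gen_1 by blast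
    then have "c 1 + a3 * u \<in> Gen {a1}" by (rule r(2))
    then obtain w where c1: "c 1 + a3 * u = a1 * w" unfolding Gen_1 by blast
    then have c1': "c 1 = a3 * (- u) + a1 * w" by (simp add: algebra_simps eq_diff_eq)
    have "a1 * (c 0 + a3 * v + a2 * w) = 0"
      using 0 by (simp add: c2 c1' algebra_simps)
    then have "c 0 + a3 * v + a2 * w = 0" by (rule r(1))
    then have c0: "c 0 = a3 * (- v) + a2 * (- w)" by (simp add: algebra_simps eq_neg_iff_add_eq_0)
    have "c 0 = a3 * (- v) + a2 * (- w) + a1 * 0" "c 1 = a3 * (- u) + a2 * 0 + a1 * w"
      "c 2 = a3 * 0 + a2 * u + a1 * v"
      using c0 c1' c2 by simp_all
    then have "c 0 \<in> ?A" "c 1 \<in> ?A" "c 2 \<in> ?A" unfolding Gen_3 by blast+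
    then show ?thesis using exhaust_three[of i] by auto
  qed
  have "complete_intersection_algebra ?A B nu ?a \<mu>"
    by unfold_locales (fact mem rel \<mu>)+
  then show ?thesis by blast
qed

section \<open>Parity along linkage classes\<close>

definition even_point :: "'k::field poly3 set \<Rightarrow> bool" where
  "even_point I \<longleftrightarrow> even (dim_over_k (tangent_space I) + dim_over_k (quotient_module S I))"

lemma cofinite_ideal_iff:
  assumes "normal_form I B nf" "is_ideal I"
  shows "cofinite_ideal I \<longleftrightarrow> finite B"
  using assms by (simp add: cofinite_ideal_def ideal_iff quotient_dim(1))

lemma even_point_iff:
  assumes "normal_form I B nf" "is_ideal I" "finite B"
  shows "even_point I \<longleftrightarrow> even (PF.dim (Tan I nf) + card B)"
  using assms by (simp add: even_point_def tangent_space_dim quotient_dim(2))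

lemma cofinite_regular_sequence:
  assumes "regular_sequence [a1, a2, a3]"
  shows "cofinite_ideal (Gen {a3, a2, a1})"
proof -
  obtain B nu where nu: "normal_form (Gen {a3, a2, a1}) B nu"
    using normal_form_exists[OF is_ideal_Gen] by blast
  then show ?thesis
    using cofinite_ideal_iff[OF nu is_ideal_Gen] regular_sequence_finite[OF assms nu] by blast
qed

lemma length_3_cases:
  assumes "length fs = 3"
  obtains x y z where "fs = [x, y, z]"
  using assms by (auto simp: numeral_3_eq_3 length_Suc_conv)

lemma link_parity:
  fixes II :: "'k::field poly3 set"
  assumes "is_link_of J II"
  shows "cofinite_ideal II" "cofinite_ideal J" "even_point J \<longleftrightarrow> even_point II"
proof -
  obtain fs where cI: "cofinite_ideal II" and fs: "length fs = 3" "regular_sequence fs" "set fs \<subseteq> II"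
      and J: "J = link fs II"
    using assms by (auto simp: is_link_of_def)
  obtain a1 a2 a3 where a: "fs = [a1, a2, a3]" using length_3_cases[OF fs(1)] .
  define A where "A = Gen {a3, a2, a1}"
  have setA: "Idl\<^bsub>S\<^esub> (set fs) = A" unfolding A_def Gen_def a by (simp add: insert_commute)
  note reg = fs(2)[unfolded a]
  obtain BA nu \<mu> where "complete_intersection_algebra A BA nu (\<lambda>i. if i = 0 then a1 else if i = 1 then a2 else a3) \<mu>"
    using complete_intersection_algebra_exists[OF reg] unfolding A_def by blast
  then interpret C: complete_intersection_algebra A BA nu "\<lambda>i. if i = 0 then a1 else if i = 1 then a2 else a3" \<mu> .
  have I: "is_ideal II" using cI by (simp add: cofinite_ideal_def ideal_iff)
  have AI: "A \<subseteq> II" unfolding A_def by (rule Gen_minimal[OF I]) (use fs(3) a in auto)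
  have Jiff: "g \<in> J \<longleftrightarrow> (\<forall>f\<in>II. f * g \<in> A)" for g
    unfolding J link_def setA by (simp add: mult.commute)
  have isJ: "is_ideal J"
    using is_idealD[OF C.I] by (auto simp: is_ideal_def Jiff distrib_left mult.left_commute)
  have AJ: "A \<subseteq> J" using C.I_mult by (auto simp: Jiff)
  \<comment> \<open>That \<open>II\<close> is recovered from its link is the double annihilator
    property of the Frobenius algebra S/A.\<close>
  have Iiff: "f \<in> II \<longleftrightarrow> (\<forall>g\<in>J. f * g \<in> A)" for f
  proof
    assume "\<forall>g\<in>J. f * g \<in> A"
    then show "f \<in> II"
      by (intro C.double_annihilator[OF I AI]) (simp add: Jiff mult.commute)
  qed (use Jiff in blast)
  obtain BI nI where nI: "normal_form II BI nI" using normal_form_exists[OF I] by blast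
  obtain BJ nJ where nJ: "normal_form J BJ nJ" using normal_form_exists[OF isJ] by blast
  have fI: "finite BI" by (rule normal_form_mono_finite[OF C.nf C.B nI AI])
  have fJ: "finite BJ" by (rule normal_form_mono_finite[OF C.nf C.B nJ AJ])
  interpret linked_pair A BA nu "\<lambda>i. if i = 0 then a1 else if i = 1 then a2 else a3" \<mu> II BI nI J BJ nJ
    by unfold_locales (fact nI nJ I isJ fI fJ AI AJ Iiff Jiff)+
  show "cofinite_ideal II" by (rule cI)
  show "cofinite_ideal J" using cofinite_ideal_iff[OF nJ isJ] fJ by blast
  have "even (PF.dim (Tan J nJ) + card BJ) \<longleftrightarrow> even (PF.dim (Tan II nI) + card BI)"
  proof -
    have "even (PF.dim (Tan II nI) + 3 * card BJ) \<longleftrightarrow> even (PF.dim (Tan J nJ) + 3 * card BI)"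
      using linkage_dim by simp
    then show ?thesis by auto
  qed
  then show "even_point J \<longleftrightarrow> even_point II"
    using even_point_iff[OF nI I fI] even_point_iff[OF nJ isJ fJ] by simp
qed

text \<open>Cofiniteness travels along the chain with the parity, as it is needed of the last ideal
  when that one is homogeneous.\<close>

lemma same_linkage_class_parity:
  assumes "same_linkage_class I J" "cofinite_ideal I"
  shows "cofinite_ideal J \<and> (even_point J \<longleftrightarrow> even_point I)"
  using assms(1) unfolding same_linkage_class_def
proof (induction rule: rtranclp_induct)
  case base
  then show ?case using assms(2) by simp
next
  case (step J K)
  then show ?case using link_parity unfolding linked_def by metis
qed

lemma homogeneous_even_point:
  assumes "homogeneous_ideal J" "cofinite_ideal J"
  shows "even_point J"
proof -
  have I: "is_ideal J" using assms(2) by (simp add: cofinite_ideal_def ideal_iff)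
  obtain B nf where nf: "normal_form J B nf" using normal_form_exists[OF I] by blast
  have B: "finite B" using cofinite_ideal_iff[OF nf I] assms(2) by simp
  interpret cofinite_normal_form J B nf by unfold_locales (fact nf I B)+
  show ?thesis using homogeneous_parity[OF assms(1)] even_point_iff[OF nf I B] by simp
qed

lemma klin_hom_component: "klin (hom_component n)"
  by (auto simp: klin_def lookup_hom_component lookup_add lookup_Const_mult intro!: poly_mapping_eqI)

lemma hom_component_var: "hom_component n (var i * f) = (if n = 0 then 0 else var i * hom_component (n - 1) f)"
proof (rule klin_eqI[of "\<lambda>f. hom_component n (var i * f)" "\<lambda>f. if n = 0 then 0 else var i * hom_component (n - 1) f"])
  show "klin (\<lambda>f. hom_component n (var i * f))" by (rule klin_comp[OF klin_hom_component klin_mult])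
  show "klin (\<lambda>f. if n = 0 then 0 else var i * hom_component (n - 1) f)"
  proof (cases "n = 0")
    case False
    then show ?thesis using klin_comp[OF klin_mult klin_hom_component, of "var i" "n - 1"] by simp
  qed (simp add: klin_def)
  have h: "hom_component n (monomial m) = (if total_deg m = n then monomial m else 0)" for n m
    by (auto simp: lookup_hom_component lookup_monomial intro!: poly_mapping_eqI)
  show "hom_component n (var i * monomial m) = (if n = 0 then 0 else var i * hom_component (n - 1) (monomial m))" for m
    unfolding var_def monomial_mult h by (auto simp: total_deg_add total_deg_single monomial_mult)
qed

text \<open>The polynomials with all components in \<open>J\<close> form an ideal, since a variable
  only moves components up by one degree; it contains the monomial generators.\<close>

lemma monomial_imp_homogeneous:
  fixes J :: "'k::field poly3 set"
  assumes "monomial_ideal J"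
  shows "homogeneous_ideal J"
proof -
  obtain M where J: "J = Gen (monomial ` M)" using assms by (auto simp: monomial_ideal_def Gen_def)
  have isJ: "is_ideal J" unfolding J by (rule is_ideal_Gen)
  note D = is_idealD[OF isJ]
  let ?H = "{f. \<forall>n. hom_component n f \<in> J}"
  have "s * f \<in> ?H" if f: "f \<in> ?H" for s f
  proof (induction s rule: poly3_induct)
    case (Const c)
    then show ?case using f D(3) by (simp add: klin_scale[OF klin_hom_component])
  next
    case (var i s)
    then show ?case using D(1,3) by (simp add: mult.assoc hom_component_var)
  qed (use D in \<open>simp_all add: klin_0 klin_add klin_hom_component distrib_right\<close>)
  then have "is_ideal ?H"
    using D(1,2) by (simp add: is_ideal_def klin_0 klin_add klin_hom_component)
  moreover have "monomial ` M \<subseteq> ?H"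
  proof clarify
    fix m n assume "m \<in> M"
    then have "monomial m \<in> J" unfolding J using Gen_superset by blast
    moreover have "hom_component n (monomial m :: 'k poly3) = (if total_deg m = n then monomial m else 0)"
      by (auto simp: lookup_hom_component lookup_monomial intro!: poly_mapping_eqI)
    ultimately show "hom_component n (monomial m) \<in> J" using D(1) by simp
  qed
  ultimately have "J \<subseteq> ?H" unfolding J by (rule Gen_minimal)
  then show ?thesis using isJ by (auto simp: homogeneous_ideal_def ideal_iff)
qed

text \<open>The link of a complete intersection with respect to its own generators is the whole ring, which
  is homogeneous.\<close>

lemma complete_intersection_linked_UNIV:
  assumes "complete_intersection J"
  shows "is_link_of UNIV J"
proof -
  obtain fs where fs: "length fs = 3" "regular_sequence fs" "J = Gen (set fs)"
    using assms by (auto simp: complete_intersection_def Gen_def)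
  obtain a1 a2 a3 where a: "fs = [a1, a2, a3]" using length_3_cases[OF fs(1)] .
  have "J = Gen {a3, a2, a1}" unfolding fs(3) a by (simp add: insert_commute)
  then have "cofinite_ideal J" using cofinite_regular_sequence[of a1 a2 a3] fs(2) a by simp
  moreover have "link fs J = UNIV"
    using is_idealD(3)[OF is_ideal_Gen[of "set fs"]] by (auto simp: link_def fs(3) simp flip: Gen_def)
  moreover have "set fs \<subseteq> J" unfolding fs(3) by (rule Gen_superset)
  ultimately show ?thesis using fs(1,2) by (auto simp: is_link_of_def)
qed

theorem proposition1p13:
  fixes I :: "'k::field poly3 set" and d :: nat
  assumes "I \<in> Hilb d"
    and "\<not> [dim_over_k (tangent_space I) = d] (mod 2)"
  shows "(\<forall>J. homogeneous_ideal J \<longrightarrow> \<not> same_linkage_class I J) \<and>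
         (\<forall>J. monomial_ideal J \<longrightarrow> \<not> same_linkage_class I J) \<and>
         \<not> licci I"
proof -
  have cI: "cofinite_ideal I" and d: "dim_over_k (quotient_module S I) = d"
    using assms(1) by (auto simp: Hilb_def)
  have "[m = n] (mod 2) \<longleftrightarrow> even (m + n)" for m n :: nat
    unfolding cong_def by presburger
  then have odd: "\<not> even_point I" using assms(2) by (simp add: even_point_def d)
  have hom: "\<not> same_linkage_class I J" if "homogeneous_ideal J" for J
    using same_linkage_class_parity[OF _ cI] homogeneous_even_point[OF that] odd by blast
  moreover have "\<not> same_linkage_class I J" if "monomial_ideal J" for J
    using hom monomial_imp_homogeneous[OF that] by blast
  moreover have "\<not> licci I"
  proof
    assume "licci I"
    then obtain J where J: "complete_intersection J" "same_linkage_class I J" by (auto simp: licci_def)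
    \<comment> \<open>One more link leads from the complete intersection to the unit ideal, so the
      homogeneous case applies.\<close>
    have "linked J UNIV" using complete_intersection_linked_UNIV[OF J(1)] by (simp add: linked_def)
    then have "same_linkage_class I UNIV"
      using J(2) unfolding same_linkage_class_def by (rule rtranclp.rtrancl_into_rtrancl[rotated])
    moreover have "homogeneous_ideal (UNIV :: 'k poly3 set)"
      by (simp add: homogeneous_ideal_def ideal_iff is_ideal_def)
    ultimately show False using hom by blast
  qed
  ultimately show ?thesis by blast
qed

end
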